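(* Let $X=\mathbb{C}^2/(\mathbb{Z}^2\oplus\sqrt{-1}\mathbb{Z}^2)$ with flat Kähler form $\omega_0=\sqrt{-1}\sum_idz_i\wedge d\bar z_i$. Let $L$ be any holomorphic line bundle on $X$, let $e^{\sqrt{-1}\hat\theta}$ be the phase determined by $\int_X(\omega_0-F(h))^2\in\mathbb{R}_{>0}e^{\sqrt{-1}\hat\theta}$ for any Hermitian metric $h$ on $L$, and let $\alpha>0$. Let $A=A(x_1)$ be any smooth $\mathbb{Z}$-periodic function of the single symplectic coordinate $x_1$ satisfying the necessary cohomological condition $$\int_0^1A(x_1)\,dx_1=-\alpha\,\frac{\int_X\operatorname{Re}\left(e^{-\sqrt{-1}\hat\theta}(\omega_0-F(h))^2\right)}{\int_X\omega_0^2}.$$ Then there are a $U(1)^2$-invariant Kähler form $\omega\in[\omega_0]$ and a Hermitian metric $h$ on $L$ solving the coupled equations $$\begin{cases}\operatorname{Im}\left(e^{-\sqrt{-1}\hat\theta}(\omega-F(h))^2\right)=0\\[2pt] s(\omega)-\alpha\,\dfrac{\operatorname{Re}\left(e^{-\sqrt{-1}\hat\theta}(\omega-F(h))^2\right)}{\omega^2}=f,\end{cases}$$ with datum $f=f(y_1)$ given by the image of $A$ under Legendre duality, that is $f(\nabla u(x))=A(x_1)$.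
   Context: $F(h)\in\mathcal{A}^{1,1}(X,\sqrt{-1}\mathbb{R})$ is the curvature of the Chern connection of $h$. $U(1)^2$ acts by translations in the direction $\sqrt{-1}\mathbb{R}^2$. Write $y=\operatorname{Re}z$. An invariant Kähler form in $[\omega_0]$ is $\omega=\sqrt{-1}\sum v_{ij}(y)dz_i\wedge d\bar z_j$, with $v_{ij}$ the real Hessian of a convex function $v(y)=\frac12|y|^2+\psi(y)$, $\psi$ being $\mathbb{Z}^2$-periodic. The Legendre transform $u$ of $v$ (for the unknown $\omega$) is defined by $u(x)+v(y)=x\cdot y$, $x=\nabla v(y)$; it has the form $\frac12|x|^2+\phi(x)$ with $\phi$ periodic, and $y=\nabla u(x)$. The scalar curvature is $s(\omega)=-\frac14v^{ij}[\log\det(v_{ab})]_{ij}$. *)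

theory Defs
  imports "HOL-Analysis.Analysis"
begin

section \<open>Smooth functions\<close>

text \<open>Differentiability of all iterated directional derivatives; on an open subset of a Euclidean
  space this is \<open>C\<close>-infinity.  Only meant for open \<open>S\<close>.\<close>

fun Ck_on :: "nat \<Rightarrow> 'a::euclidean_space set \<Rightarrow> ('a \<Rightarrow> 'b::real_normed_vector) \<Rightarrow> bool" where
  "Ck_on 0 S f \<longleftrightarrow> continuous_on S f"
| "Ck_on (Suc k) S f \<longleftrightarrow>
     f differentiable_on S \<and> (\<forall>v. Ck_on k S (\<lambda>x. frechet_derivative f (at x) v))"

definition smooth_on :: "'a::euclidean_space set \<Rightarrow> ('a \<Rightarrow> 'b::real_normed_vector) \<Rightarrow> bool" where
  "smooth_on S f \<longleftrightarrow> (\<forall>k. Ck_on k S f)"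

section \<open>The torus\<close>

text \<open>Functions, forms and open sets on \<open>X = \<complex>\<^sup>2 / \<Lambda>\<close> are represented by their \<open>\<Lambda>\<close>-invariant pullbacks
  to the covering space.\<close>

definition lattice :: "(complex^2) set" where
  "lattice = {l. \<forall>j. Re (l $ j) \<in> \<int> \<and> Im (l $ j) \<in> \<int>}"

definition lattice_periodic :: "(complex^2 \<Rightarrow> 'b) \<Rightarrow> bool" where
  "lattice_periodic f \<longleftrightarrow> (\<forall>z. \<forall>l\<in>lattice. f (z + l) = f z)"

definition re_part :: "complex^2 \<Rightarrow> real^2" where
  "re_part z = (\<chi> j. Re (z $ j))"

text \<open>Integration over the fundamental domain \<open>[0,1]\<^sup>4\<close>.\<close>

definition torus_integral :: "(complex^2 \<Rightarrow> 'b::real_normed_vector) \<Rightarrow> 'b" where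
  "torus_integral f = integral (cbox 0 (\<chi> j. Complex 1 1)) f"

section \<open>Complex-valued differential forms\<close>

text \<open>A \<open>k\<close>-form at a point is a function of \<open>k\<close> real tangent vectors, the tangent space being
  \<open>\<complex>\<^sup>2\<close> with complex structure \<open>a \<mapsto> \<i> *s a\<close>.\<close>

type_synonym one_form = "complex^2 \<Rightarrow> complex^2 \<Rightarrow> complex"
type_synonym two_form = "complex^2 \<Rightarrow> complex^2 \<Rightarrow> complex^2 \<Rightarrow> complex"

definition ext_deriv1 :: "one_form \<Rightarrow> two_form" where
  "ext_deriv1 \<eta> z a b =
     frechet_derivative (\<lambda>w. \<eta> w b) (at z) a - frechet_derivative (\<lambda>w. \<eta> w a) (at z) b"

definition ext_deriv2 ::
    "two_form \<Rightarrow> complex^2 \<Rightarrow> complex^2 \<Rightarrow> complex^2 \<Rightarrow> complex^2 \<Rightarrow> complex" where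
  "ext_deriv2 \<omega> z a b c =
     frechet_derivative (\<lambda>w. \<omega> w b c) (at z) a
     - frechet_derivative (\<lambda>w. \<omega> w a c) (at z) b
     + frechet_derivative (\<lambda>w. \<omega> w a b) (at z) c"

text \<open>The \<open>(1,0)\<close>-part of \<open>d\<phi>\<close>, i.e. \<open>\<Sum>\<^sub>i \<partial>\<phi>/\<partial>z\<^sub>i dz\<^sub>i\<close>.\<close>

definition del :: "(complex^2 \<Rightarrow> complex) \<Rightarrow> one_form" where
  "del \<phi> z a =
     (frechet_derivative \<phi> (at z) a - \<i> * frechet_derivative \<phi> (at z) (\<i> *s a)) / 2"

definition wedge ::
    "(complex^2 \<Rightarrow> complex^2 \<Rightarrow> complex) \<Rightarrow> (complex^2 \<Rightarrow> complex^2 \<Rightarrow> complex) \<Rightarrow>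
     complex^2 \<Rightarrow> complex^2 \<Rightarrow> complex^2 \<Rightarrow> complex^2 \<Rightarrow> complex" where
  "wedge \<beta> \<gamma> a b c d =
     \<beta> a b * \<gamma> c d - \<beta> a c * \<gamma> b d + \<beta> a d * \<gamma> b c
     + \<beta> b c * \<gamma> a d - \<beta> b d * \<gamma> a c + \<beta> c d * \<gamma> a b"

text \<open>Coefficient of a 4-form with respect to \<open>dx\<^sub>1 \<and> dy\<^sub>1 \<and> dx\<^sub>2 \<and> dy\<^sub>2\<close> where \<open>z\<^sub>j = x\<^sub>j + \<i> y\<^sub>j\<close>.
  The space of 4-forms at a point is a complex line, so equations between and quotients of
  4-forms are equations between and quotients of these coefficients, and the integral of a
  4-form is the Lebesgue integral of its coefficient.\<close>

definition top_coeff ::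
    "(complex^2 \<Rightarrow> complex^2 \<Rightarrow> complex^2 \<Rightarrow> complex^2 \<Rightarrow> complex) \<Rightarrow> complex" where
  "top_coeff \<Omega> = \<Omega> (axis 1 1) (axis 1 \<i>) (axis 2 1) (axis 2 \<i>)"

definition square_coeff :: "two_form \<Rightarrow> complex^2 \<Rightarrow> complex" where
  "square_coeff \<beta> z = top_coeff (wedge (\<beta> z) (\<beta> z))"

definition form_diff :: "two_form \<Rightarrow> two_form \<Rightarrow> two_form" where
  "form_diff \<beta> \<gamma> = (\<lambda>z a b. \<beta> z a b - \<gamma> z a b)"

text \<open>The form \<open>\<i> \<Sum>\<^sub>i\<^sub>j H\<^sub>i\<^sub>j dz\<^sub>i \<and> d\<bar>z\<^sub>j\<close>.\<close>

definition form_of_matrix :: "complex^2^2 \<Rightarrow> complex^2 \<Rightarrow> complex^2 \<Rightarrow> complex" where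
  "form_of_matrix H a b =
     \<i> * (\<Sum>i\<in>UNIV. \<Sum>j\<in>UNIV. H $ i $ j * (a $ i * cnj (b $ j) - b $ i * cnj (a $ j)))"

definition flat_form :: two_form where
  "flat_form z = form_of_matrix (mat 1)"

section \<open>Kaehler forms on the torus\<close>

definition kaehler_form :: "two_form \<Rightarrow> bool" where
  "kaehler_form \<omega> \<longleftrightarrow>
     lattice_periodic \<omega> \<and>
     (\<forall>a b. smooth_on UNIV (\<lambda>z. \<omega> z a b)) \<and>
     (\<forall>z. bilinear (\<omega> z)) \<and>
     (\<forall>z a b. \<omega> z a b = - \<omega> z b a) \<and>
     (\<forall>z a b. \<omega> z a b \<in> \<real>) \<and>
     (\<forall>z a b. \<omega> z (\<i> *s a) (\<i> *s b) = \<omega> z a b) \<and>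
     (\<forall>z a. a \<noteq> 0 \<longrightarrow> 0 < Re (\<omega> z a (\<i> *s a))) \<and>
     (\<forall>z a b c. ext_deriv2 \<omega> z a b c = 0)"

text \<open>Equality of de Rham classes on the torus: the difference is the exterior derivative of a global
  1-form on the quotient.\<close>

definition cohomologous :: "two_form \<Rightarrow> two_form \<Rightarrow> bool" where
  "cohomologous \<omega> \<omega>' \<longleftrightarrow>
     (\<exists>\<eta> :: one_form. lattice_periodic \<eta> \<and> (\<forall>a. smooth_on UNIV (\<lambda>z. \<eta> z a)) \<and>
        (\<forall>z. linear (\<eta> z)) \<and> (\<forall>z a b. \<omega> z a b - \<omega>' z a b = ext_deriv1 \<eta> z a b))"

text \<open>Invariance under translation by \<open>\<i> \<real>\<^sup>2\<close>.\<close>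

definition torus_invariant :: "two_form \<Rightarrow> bool" where
  "torus_invariant \<omega> \<longleftrightarrow> (\<forall>z. \<forall>t :: real^2. \<omega> (z + (\<chi> j. \<i> * of_real (t $ j))) = \<omega> z)"

section \<open>Real potentials, Legendre duality and scalar curvature\<close>

definition partial :: "2 \<Rightarrow> (real^2 \<Rightarrow> real) \<Rightarrow> real^2 \<Rightarrow> real" where
  "partial i f y = frechet_derivative f (at y) (axis i 1)"

definition grad :: "(real^2 \<Rightarrow> real) \<Rightarrow> real^2 \<Rightarrow> real^2" where
  "grad f y = (\<chi> i. partial i f y)"

definition hessian :: "(real^2 \<Rightarrow> real) \<Rightarrow> real^2 \<Rightarrow> real^2^2" where
  "hessian f y = (\<chi> i j. partial i (partial j f) y)"

text \<open>The convex function \<open>v(y) = |y|\<^sup>2/2 + \<psi>(y)\<close> describing an invariant form.\<close>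

definition invariant_potential :: "two_form \<Rightarrow> (real^2 \<Rightarrow> real) \<Rightarrow> bool" where
  "invariant_potential \<omega> v \<longleftrightarrow>
     (\<exists>\<psi>. smooth_on UNIV \<psi> \<and>
        (\<forall>y m. (\<forall>j. m $ j \<in> \<int>) \<longrightarrow> \<psi> (y + m) = \<psi> y) \<and>
        v = (\<lambda>y. (norm y)\<^sup>2 / 2 + \<psi> y)) \<and>
     convex_on UNIV v \<and>
     (\<forall>z. \<omega> z = form_of_matrix (\<chi> i j. of_real (hessian v (re_part z) $ i $ j)))"

text \<open>\<open>u(x) + v(y) = x \<bullet> y\<close> for \<open>x = \<nabla>v(y)\<close>; for the potentials above \<open>\<nabla>v\<close> is a bijection
  of the plane, so that \<open>y\<close> is determined by \<open>x\<close>.\<close>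

definition legendre :: "(real^2 \<Rightarrow> real) \<Rightarrow> real^2 \<Rightarrow> real" where
  "legendre v x = (let y = (THE y. grad v y = x) in x \<bullet> y - v y)"

text \<open>Scalar curvature of \<open>\<i> \<Sum> v\<^sub>i\<^sub>j(y) dz\<^sub>i \<and> d\<bar>z\<^sub>j\<close>, as a function of \<open>y = Re z\<close>.\<close>

definition scalar_curv :: "(real^2 \<Rightarrow> real) \<Rightarrow> real^2 \<Rightarrow> real" where
  "scalar_curv v y =
     - (1/4) * (\<Sum>i\<in>UNIV. \<Sum>j\<in>UNIV.
         matrix_inv (hessian v y) $ i $ j * hessian (\<lambda>y'. ln (det (hessian v y'))) y $ i $ j)"

section \<open>Holomorphic line bundles and Hermitian metrics\<close>

definition holomorphic2_on :: "(complex^2 \<Rightarrow> complex) \<Rightarrow> (complex^2) set \<Rightarrow> bool" where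
  "holomorphic2_on f S \<longleftrightarrow>
     (\<forall>z\<in>S. \<exists>D. (f has_derivative D) (at z) \<and> (\<forall>c a. D (c *s a) = c * D a))"

text \<open>A line bundle is given by trivialisations over an open cover of the torus and their transition
  functions; fibre coordinates are related by \<open>\<xi>\<^sub>i = g\<^sub>i\<^sub>j \<xi>\<^sub>j\<close>.\<close>

record 'i line_bundle =
  charts :: "'i set"
  chart_dom :: "'i \<Rightarrow> (complex^2) set"
  transition :: "'i \<Rightarrow> 'i \<Rightarrow> complex^2 \<Rightarrow> complex"

definition holomorphic_line_bundle :: "'i line_bundle \<Rightarrow> bool" where
  "holomorphic_line_bundle L \<longleftrightarrow>
     (\<forall>i\<in>charts L. open (chart_dom L i) \<and>
        (\<forall>z\<in>chart_dom L i. \<forall>l\<in>lattice. z + l \<in> chart_dom L i)) \<and>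
     (\<Union>i\<in>charts L. chart_dom L i) = UNIV \<and>
     (\<forall>i\<in>charts L. \<forall>j\<in>charts L.
        holomorphic2_on (transition L i j) (chart_dom L i \<inter> chart_dom L j) \<and>
        (\<forall>z\<in>chart_dom L i \<inter> chart_dom L j. transition L i j z \<noteq> 0 \<and>
           (\<forall>l\<in>lattice. transition L i j (z + l) = transition L i j z))) \<and>
     (\<forall>i\<in>charts L. \<forall>j\<in>charts L. \<forall>k\<in>charts L.
        \<forall>z\<in>chart_dom L i \<inter> chart_dom L j \<inter> chart_dom L k.
          transition L i j z * transition L j k z = transition L i k z)"

text \<open>\<open>h i\<close> is the squared norm of the local frame \<open>\<xi>\<^sub>i = 1\<close>.\<close>

definition hermitian_metric :: "'i line_bundle \<Rightarrow> ('i \<Rightarrow> complex^2 \<Rightarrow> real) \<Rightarrow> bool" where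
  "hermitian_metric L h \<longleftrightarrow>
     (\<forall>i\<in>charts L. smooth_on (chart_dom L i) (h i) \<and>
        (\<forall>z\<in>chart_dom L i. 0 < h i z \<and> (\<forall>l\<in>lattice. h i (z + l) = h i z))) \<and>
     (\<forall>i\<in>charts L. \<forall>j\<in>charts L. \<forall>z\<in>chart_dom L i \<inter> chart_dom L j.
        h j z = (cmod (transition L i j z))\<^sup>2 * h i z)"

text \<open>In a holomorphic frame the Chern connection is \<open>d + \<partial> log h\<close>, and its curvature
  \<open>d (\<partial> log h)\<close> does not depend on the chart.\<close>

definition chern_connection :: "(complex^2 \<Rightarrow> real) \<Rightarrow> one_form" where
  "chern_connection h = del (\<lambda>w. of_real (ln (h w)))"

definition chern_curvature :: "'i line_bundle \<Rightarrow> ('i \<Rightarrow> complex^2 \<Rightarrow> real) \<Rightarrow> two_form" where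
  "chern_curvature L h z =
     (let i = (SOME i. i \<in> charts L \<and> z \<in> chart_dom L i)
      in ext_deriv1 (chern_connection (h i)) z)"

end

theory Submission
  imports Defs
begin

text \<open>
  Both equations can be solved by data that depend on one real coordinate, after the curvature of
  \<open>L\<close> has been made constant.

  For the first step, on a chart the curvature is \<open>\<i> levi (ln h)\<close>, where \<open>levi w a b\<close> is a real
  constant coefficient operator of second order, applied to \<open>w\<close>; a change of frame adds
  \<open>ln \<bar>g\<bar>\<^sup>2\<close>, which \<open>levi\<close> annihilates (\<open>levi_log_holomorphic\<close>). The operators \<open>levi \<cdot> a b\<close>
  commute, so the global form \<open>\<Phi> = Im F\<close> satisfies \<open>levi (\<Phi> a b) c d = levi (\<Phi> c d) a b\<close>, and this
  is the only consequence of closedness that is used. Since \<open>levi \<cdot> e1 f1\<close> is half the Laplacian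
  \<open>\<Delta>\<^sub>1\<close> of the plane of \<open>z\<^sub>1\<close>, it suffices to invert Laplacians of planes, the other variable
  being a parameter: if \<open>\<Delta>\<^sub>i G\<^sub>i = 1 - E\<^sub>i\<close> with \<open>E\<^sub>i\<close> the mean over the plane of \<open>z\<^sub>i\<close>, then
  \<open>\<phi> = - 2 (G\<^sub>1 \<Phi> e1 f1 + G\<^sub>2 E\<^sub>1 \<Phi> e2 f2)\<close> satisfies
  \<open>levi \<phi> a b = - (1 - E\<^sub>1) \<Phi> a b - (E\<^sub>1 - E\<^sub>2 E\<^sub>1) \<Phi> a b\<close>, and \<open>\<Phi> + levi \<phi> = E\<^sub>2 E\<^sub>1 \<Phi>\<close> is
  constant (\<open>ddbar_lemma\<close>). The operator \<open>G\<close> is a Fourier series in one real direction whose modes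
  are convolved, in the other direction, with the Green function of \<open>m\<^sup>2 - d\<^sup>2/ds\<^sup>2\<close> on the circle
  (\<open>laplace_inv\<close>). Integration by parts shows that the integral which determines \<open>\<theta>\<close> depends on
  the constants only (\<open>integral_curvature_square\<close>).

  For the reduction to one variable, put \<open>v = \<bar>y\<bar>\<^sup>2/2 + \<psi>(y\<^sub>1)\<close> and multiply the metric of constant
  curvature by \<open>exp (4 \<tau> \<psi>(Re z\<^sub>1))\<close>. Then \<open>(\<omega> - F)\<^sup>2\<close> is affine in \<open>\<psi>''\<close>, and for a suitable \<open>\<tau>\<close>
  it has constant phase: the coefficient of \<open>exp(-\<i>\<theta>) (\<omega> - F)\<^sup>2\<close> is \<open>r + 8 c \<psi>''\<close> with \<open>8 c \<le> r\<close>
  (\<open>phase_algebra\<close>), while that of \<open>\<omega>\<^sup>2\<close> is \<open>8 (1 + \<psi>'')\<close>. In the coordinate \<open>x\<^sub>1\<close> write \<open>p(x\<^sub>1)\<close>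
  for the second derivative of \<open>v\<close> at \<open>y\<^sub>1\<close>. The scalar curvature is \<open>- p''/4\<close>, and the second
  equation becomes \<open>p'' + 4 \<alpha> (r/8 - c) / p = - 4 (A + \<alpha> c)\<close>.

  It remains to solve this ordinary differential equation. The condition on the mean of \<open>A\<close> says
  that the right-hand side has mean \<open>4 \<alpha> (r/8 - c)\<close>, which is compatible with \<open>\<integral> 1/p = 1\<close>; the
  latter makes \<open>dy\<^sub>1/dx\<^sub>1 = 1/p\<close> define a diffeomorphism of the line that commutes with the unit
  translation (\<open>legendre_change_of_variable\<close>). If \<open>8 c < r\<close> the singularity is attractive: the
  nonlinearity is monotone, and a contraction between a constant and a supersolution has the
  solution as its fixed point (\<open>singular_ode_periodic\<close>). If \<open>8 c = r\<close> the equation is linear and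
  its additive constant is fixed by \<open>\<integral> 1/p = 1\<close> (\<open>degenerate_ode_periodic\<close>).
\<close>

section \<open>Iterated directional derivatives\<close>

abbreviation (input) smooth :: "('a::euclidean_space \<Rightarrow> 'b::real_normed_vector) \<Rightarrow> bool" where
  "smooth f \<equiv> smooth_on UNIV f"

text \<open>Written as an operator on functions, so that mixed derivatives are iterates
  \<open>dd a (dd b f)\<close>.\<close>

definition dd :: "'a::euclidean_space \<Rightarrow> ('a \<Rightarrow> 'b::real_normed_vector) \<Rightarrow> 'a \<Rightarrow> 'b" where
  "dd v f x = frechet_derivative f (at x) v"

lemma Ck_on_Suc_dd: "Ck_on (Suc k) S f \<longleftrightarrow> f differentiable_on S \<and> (\<forall>v. Ck_on k S (dd v f))"
  by (simp add: dd_def[abs_def])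

declare Ck_on.simps(2)[simp del]

lemma dd_eqI: "(f has_derivative f') (at x) \<Longrightarrow> dd v f x = f' v"
  unfolding dd_def by (metis frechet_derivative_at)

lemma Ck_on_cong:
  assumes "open S" "\<And>x. x \<in> S \<Longrightarrow> f x = g x"
  shows "Ck_on k S f \<longleftrightarrow> Ck_on k S g"
  using assms(2)
proof (induction k arbitrary: f g)
  case 0
  then show ?case by (simp cong: continuous_on_cong)
next
  case (Suc k)
  have d: "f differentiable_on S \<longleftrightarrow> g differentiable_on S"
    using Suc.prems by (auto simp: differentiable_on_def intro: differentiable_transform_within[OF _
        zero_less_one])
  show ?case
  proof (cases "f differentiable_on S")
    case True
    have "dd v f x = dd v g x" if "x \<in> S" for v x
      unfolding dd_def
      using frechet_derivative_transform_within_open[of f x S g] True that assms(1) Suc.prems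
      by (simp add: differentiable_on_eq_differentiable_at)
    then show ?thesis using d Suc.IH[of "dd v f" "dd v g" for v] unfolding Ck_on_Suc_dd by blast
  next
    case False
    then show ?thesis using d by (simp add: Ck_on_Suc_dd)
  qed
qed

lemma Ck_on_subset:
  assumes "Ck_on k S f" "T \<subseteq> S"
  shows "Ck_on k T f"
  using assms
  by (induction k arbitrary: f) (auto simp: Ck_on_Suc_dd intro: continuous_on_subset
      differentiable_on_subset)

lemma Ck_on_SucD: "Ck_on (Suc k) S f \<Longrightarrow> Ck_on k S f"
  by (induction k arbitrary: f) (auto simp: Ck_on_Suc_dd differentiable_imp_continuous_on)

lemma Ck_on_has_derivative:
  assumes "Ck_on (Suc k) S f" "open S" "x \<in> S"
  shows "(f has_derivative (\<lambda>v. dd v f x)) (at x)"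
  using assms unfolding Ck_on_Suc_dd dd_def
  by (metis differentiable_on_eq_differentiable_at frechet_derivative_works)

text \<open>Lets any formula for the derivative replace \<open>frechet_derivative\<close> in inductions on the order
  of differentiability.\<close>

lemma Ck_on_SucI:
  assumes "open S" "\<And>x. x \<in> S \<Longrightarrow> (f has_derivative f' x) (at x)" "\<And>v. Ck_on k S (\<lambda>x. f' x v)"
  shows "Ck_on (Suc k) S f"
proof -
  have "Ck_on k S (dd v f)" for v
    using Ck_on_cong[OF assms(1), of "dd v f" "\<lambda>x. f' x v"] assms(2,3) dd_eqI by blast
  then show ?thesis
    using assms(1,2) unfolding Ck_on_Suc_dd
    by (auto simp: differentiable_on_eq_differentiable_at differentiable_def)
qed

lemma Ck_on_const: "Ck_on k S (\<lambda>x. c)"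
proof (induction k arbitrary: c)
  case (Suc k)
  have "dd v (\<lambda>x::'a. c) = (\<lambda>x. 0)" for v by (rule ext) (rule dd_eqI, simp)
  then show ?case using Suc by (simp add: Ck_on_Suc_dd)
qed simp

lemma Ck_on_bounded_linear:
  assumes "bounded_linear L" "open S" "Ck_on k S f"
  shows "Ck_on k S (\<lambda>x. L (f x))"
  using assms(3)
proof (induction k arbitrary: f)
  case 0
  then show ?case using assms(1) by (simp add: bounded_linear.continuous_on)
next
  case (Suc k)
  show ?case
    using Suc assms(1,2) Ck_on_has_derivative[OF Suc.prems assms(2)]
    by (intro Ck_on_SucI[where f'="\<lambda>x v. L (dd v f x)"])
      (auto simp: Ck_on_Suc_dd intro!: bounded_linear.has_derivative[OF assms(1)])
qed

lemma Ck_on_add: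
  assumes "open S" "Ck_on k S f" "Ck_on k S g"
  shows "Ck_on k S (\<lambda>x. f x + g x)"
  using assms(2,3)
proof (induction k arbitrary: f g)
  case 0
  then show ?case by (simp add: continuous_on_add)
next
  case (Suc k)
  show ?case
    using Suc assms(1) Ck_on_has_derivative[OF Suc.prems(1) assms(1)] Ck_on_has_derivative[OF
        Suc.prems(2) assms(1)]
    by (intro Ck_on_SucI[where f'="\<lambda>x v. dd v f x + dd v g x"])
      (auto simp: Ck_on_Suc_dd has_derivative_add)
qed

lemma Ck_on_sum:
  assumes "open S" "\<And>i. i \<in> I \<Longrightarrow> Ck_on k S (f i)"
  shows "Ck_on k S (\<lambda>x. \<Sum>i\<in>I. f i x)"
  using assms(2) by (induction I rule: infinite_finite_induct)
      (auto simp: Ck_on_const Ck_on_add assms(1))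

lemma Ck_on_bilinear:
  assumes "bounded_bilinear B" "open S" "Ck_on k S f" "Ck_on k S g"
  shows "Ck_on k S (\<lambda>x. B (f x) (g x))"
  using assms(3,4)
proof (induction k arbitrary: f g)
  case 0
  then show ?case by (simp add: assms(1) bounded_bilinear.continuous_on)
next
  case (Suc k)
  have s: "Ck_on k S f" "Ck_on k S g" using Suc.prems Ck_on_SucD by auto
  show ?case
    using Suc s assms(1,2) Ck_on_has_derivative[OF Suc.prems(1) assms(2)] Ck_on_has_derivative[OF
        Suc.prems(2) assms(2)]
    by (intro Ck_on_SucI[where f'="\<lambda>x v. B (f x) (dd v g x) + B (dd v f x) (g x)"])
      (auto simp: Ck_on_Suc_dd intro!: Ck_on_add Suc.IH bounded_bilinear.FDERIV[OF assms(1)])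
qed

lemma Ck_on_id: "Ck_on k S (\<lambda>x. x)"
proof (cases k)
  case (Suc j)
  have "dd v (\<lambda>x::'a. x) = (\<lambda>x. v)" for v by (rule ext) (rule dd_eqI, simp)
  then show ?thesis using Suc by (simp add: Ck_on_Suc_dd Ck_on_const)
qed simp

text \<open>The derivative of \<open>g\<close> is expanded in the basis: this exhibits the derivative of the
  composite as a sum of products of functions to which the induction hypothesis applies.\<close>

lemma Ck_on_compose:
  assumes S: "open S" "open T" "f ` S \<subseteq> T" and f: "Ck_on k S f" and g: "Ck_on k T g"
  shows "Ck_on k S (\<lambda>x. g (f x))"
  using f g
proof (induction k arbitrary: g)
  case 0
  then show ?case using assms(3) by (auto intro: continuous_on_compose2)
next
  case (Suc k)
  let ?f' = "\<lambda>x v. \<Sum>b\<in>Basis. (dd v f x \<bullet> b) *\<^sub>R dd b g (f x)"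
  have fk: "Ck_on k S f" using Suc.prems Ck_on_SucD by auto
  show ?case
  proof (rule Ck_on_SucI[OF S(1), where f'="?f'"])
    fix x assume x: "x \<in> S"
    have df: "(f has_derivative (\<lambda>v. dd v f x)) (at x)"
      using Ck_on_has_derivative[OF Suc.prems(1) S(1) x] .
    have dg: "(g has_derivative (\<lambda>v. dd v g (f x))) (at (f x))"
      using Ck_on_has_derivative[OF Suc.prems(2) S(2)] x S(3) by auto
    then have lin: "linear (\<lambda>v. dd v g (f x))" by (rule has_derivative_linear)
    have "dd (dd v f x) g (f x) = ?f' x v" for v
    proof -
      have "dd (dd v f x) g (f x) = dd (\<Sum>b\<in>Basis. (dd v f x \<bullet> b) *\<^sub>R b) g (f x)"
        by (simp only: euclidean_representation)
      also have "\<dots> = ?f' x v"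
        by (simp only: linear_sum[OF lin] linear_scale[OF lin])
      finally show ?thesis .
    qed
    then show "((\<lambda>x. g (f x)) has_derivative ?f' x) (at x)"
      using has_derivative_compose[OF df dg] by simp
  next
    fix v
    show "Ck_on k S (\<lambda>x. ?f' x v)"
      using Suc.prems Suc.IH fk
      by (intro Ck_on_sum Ck_on_bilinear[OF bounded_bilinear_scaleR] S
          Ck_on_bounded_linear[OF bounded_linear_inner_left])
        (auto simp: Ck_on_Suc_dd)
  qed
qed

lemma Ck_on_local:
  assumes "\<And>x. x \<in> S \<Longrightarrow> \<exists>U. open U \<and> x \<in> U \<and> Ck_on k U f"
  shows "Ck_on k S f"
  using assms
proof (induction k arbitrary: f)
  case 0
  have "continuous (at x within S) f" if "x \<in> S" for x
    using 0[OF that] by (metis Ck_on.simps(1) continuous_on_eq_continuous_at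
        continuous_at_imp_continuous_at_within)
  then show ?case by (simp add: continuous_on_eq_continuous_within)
next
  case (Suc k)
  have "f differentiable (at x within S)" if "x \<in> S" for x
    using Suc.prems[OF that] unfolding Ck_on_Suc_dd
    by (metis differentiable_on_eq_differentiable_at differentiable_at_withinI)
  moreover have "Ck_on k S (dd v f)" for v
    by (rule Suc.IH) (use Suc.prems in \<open>auto simp: Ck_on_Suc_dd\<close>)
  ultimately show ?case by (simp add: Ck_on_Suc_dd differentiable_on_def)
qed

lemma smooth_on_cong:
  assumes "open S" "\<And>x. x \<in> S \<Longrightarrow> f x = g x" "smooth_on S g"
  shows "smooth_on S f"
  using assms Ck_on_cong[OF assms(1,2)] by (simp add: smooth_on_def)

lemma smooth_on_subset: "smooth_on S f \<Longrightarrow> T \<subseteq> S \<Longrightarrow> smooth_on T f"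
  unfolding smooth_on_def by (metis Ck_on_subset)

lemma smooth_on_local:
  assumes "\<And>x. x \<in> S \<Longrightarrow> \<exists>U. open U \<and> x \<in> U \<and> smooth_on U f"
  shows "smooth_on S f"
  using assms Ck_on_local unfolding smooth_on_def by metis

lemma smooth_on_has_derivative:
  assumes "smooth_on S f" "open S" "x \<in> S"
  shows "(f has_derivative (\<lambda>v. dd v f x)) (at x)"
  using Ck_on_has_derivative assms unfolding smooth_on_def by blast

lemma smooth_on_continuous: "smooth_on S f \<Longrightarrow> continuous_on S f"
  unfolding smooth_on_def by (metis Ck_on.simps(1))

lemma smooth_on_dd: "smooth_on S f \<Longrightarrow> smooth_on S (dd v f)"
  unfolding smooth_on_def using Ck_on_Suc_dd by blast

lemma smooth_onI:
  assumes "open S" "\<And>x. x \<in> S \<Longrightarrow> (f has_derivative f' x) (at x)" "\<And>v. smooth_on S (\<lambda>x. f' x v)"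
  shows "smooth_on S f"
  unfolding smooth_on_def
proof
  fix k
  have "Ck_on (Suc k) S f" using assms by (intro Ck_on_SucI) (auto simp: smooth_on_def)
  then show "Ck_on k S f" by (rule Ck_on_SucD)
qed

lemma smooth_on_const [simp]: "smooth_on S (\<lambda>x. c)"
  by (simp add: smooth_on_def Ck_on_const)
lemma smooth_on_id [simp]: "smooth_on S (\<lambda>x. x)"
  by (simp add: smooth_on_def Ck_on_id)
lemma smooth_on_linear: "bounded_linear L \<Longrightarrow> open S \<Longrightarrow> smooth_on S f \<Longrightarrow> smooth_on S (\<lambda>x. L (f x))"
  by (simp add: smooth_on_def Ck_on_bounded_linear)
lemma smooth_on_add: "open S \<Longrightarrow> smooth_on S f \<Longrightarrow> smooth_on S g \<Longrightarrow> smooth_on S (\<lambda>x. f x + g x)"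
  by (simp add: smooth_on_def Ck_on_add)
lemma smooth_on_uminus: "open S \<Longrightarrow> smooth_on S f \<Longrightarrow> smooth_on S (\<lambda>x. - f x)"
  using smooth_on_linear[OF bounded_linear_minus[OF bounded_linear_ident]] .
lemma smooth_on_diff: "open S \<Longrightarrow> smooth_on S f \<Longrightarrow> smooth_on S g \<Longrightarrow> smooth_on S (\<lambda>x. f x - g x)"
  using smooth_on_add[OF _ _ smooth_on_uminus, of S f g] by simp
lemma smooth_on_mult: "open S \<Longrightarrow> smooth_on S f \<Longrightarrow> smooth_on S g
    \<Longrightarrow> smooth_on S (\<lambda>x. f x * (g x :: 'b::real_normed_algebra))"
  by (simp add: smooth_on_def Ck_on_bilinear[OF bounded_bilinear_mult])
lemma smooth_on_compose:
  "smooth_on T g \<Longrightarrow> open S \<Longrightarrow> open T \<Longrightarrow> f ` S \<subseteq> T \<Longrightarrow> smooth_on S f \<Longrightarrow> smooth_on S (\<lambda>x. g (f x))"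
  by (simp add: smooth_on_def Ck_on_compose)

lemmas smooth_intros = smooth_on_const smooth_on_id smooth_on_add smooth_on_uminus smooth_on_diff
  smooth_on_mult

lemma Ck_on_realI:
  fixes f :: "real \<Rightarrow> 'b::real_normed_vector"
  assumes "open S" "\<And>x. x \<in> S \<Longrightarrow> (f has_vector_derivative f' x) (at x)" "Ck_on k S f'"
  shows "Ck_on (Suc k) S f"
  using assms
  by (intro Ck_on_SucI[where f'="\<lambda>x v. v *\<^sub>R f' x"])
    (auto simp: has_vector_derivative_def intro!: Ck_on_bounded_linear[OF bounded_linear_scaleR_right])

text \<open>Bootstrapping: \<open>f\<close> is as regular as \<open>f' = F \<circ> f\<close>, hence one degree more regular than
  assumed.\<close>

lemma smooth_on_autonomous:
  fixes f :: "real \<Rightarrow> real"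
  assumes S: "open S" "open T" "f ` S \<subseteq> T"
    and der: "\<And>x. x \<in> S \<Longrightarrow> (f has_real_derivative F (f x)) (at x)" and F: "smooth_on T F"
  shows "smooth_on S f"
proof -
  have "Ck_on k S f" for k
  proof (induction k)
    case 0
    then show ?case using der S(1) by (auto intro!: continuous_at_imp_continuous_on DERIV_isCont)
  next
    case (Suc k)
    show ?case
      using Ck_on_compose[OF S Suc] F der S
      by (intro Ck_on_realI) (auto simp: smooth_on_def has_real_derivative_iff_has_vector_derivative)
  qed
  then show ?thesis by (simp add: smooth_on_def)
qed

lemma smooth_exp: "smooth (exp :: real \<Rightarrow> real)"
  by (rule smooth_on_autonomous[where F="\<lambda>x. x" and T=UNIV]) (auto intro!: derivative_eq_intros)

lemma smooth_on_inverse: "smooth_on {0<..} (inverse :: real \<Rightarrow> real)"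
  by (rule smooth_on_autonomous[where F="\<lambda>x. - (x * x)" and T=UNIV])
    (auto intro!: derivative_eq_intros smooth_intros simp: power2_eq_square)

lemma smooth_on_ln: "smooth_on {0<..} (ln :: real \<Rightarrow> real)"
proof (rule smooth_onI[where f'="\<lambda>x v. v * inverse x"])
  show "(ln has_derivative (\<lambda>v. v * inverse x)) (at x)" if "x \<in> {0<..}" for x :: real
    using that DERIV_ln[of x] by (simp add: has_field_derivative_def mult_commute_abs)
qed (auto intro!: smooth_intros smooth_on_inverse)

lemma dd_linear:
  assumes "smooth_on S f" "open S" "x \<in> S"
  shows "linear (\<lambda>v. dd v f x)"
  using smooth_on_has_derivative[OF assms] by (rule has_derivative_linear)

lemma dd_cong:
  assumes "open S" "x \<in> S" "\<And>y. y \<in> S \<Longrightarrow> f y = g y" 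
  shows "dd v f x = dd v g x"
proof -
  have "(f has_derivative D) (at x) \<longleftrightarrow> (g has_derivative D) (at x)" for D
    using assms by (metis has_derivative_transform_within_open)
  then show ?thesis unfolding dd_def frechet_derivative_def by simp
qed

lemma dd_line:
  assumes "smooth_on S f" "open S" "x + t *\<^sub>R a \<in> S"
  shows "((\<lambda>t. f (x + t *\<^sub>R a)) has_vector_derivative dd a f (x + t *\<^sub>R a)) (at t within X)"
proof -
  have "((\<lambda>t. x + t *\<^sub>R a) has_derivative (\<lambda>h. h *\<^sub>R a)) (at t)"
    by (auto intro!: derivative_eq_intros)
  from has_derivative_compose[OF this smooth_on_has_derivative[OF assms]]
  have "((\<lambda>t. f (x + t *\<^sub>R a)) has_derivative (\<lambda>h. dd (h *\<^sub>R a) f (x + t *\<^sub>R a))) (at t)" .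
  moreover have "dd (h *\<^sub>R a) f (x + t *\<^sub>R a) = h *\<^sub>R dd a f (x + t *\<^sub>R a)" for h
    using dd_linear[OF assms] by (rule linear_scale)
  ultimately show ?thesis by (simp add: has_vector_derivative_def has_derivative_at_withinI)
qed

text \<open>The left-hand side is symmetric in \<open>a\<close> and \<open>b\<close>; applying this in both orders and letting \<open>h\<close>
  tend to zero gives the symmetry of second derivatives.\<close>

lemma second_difference_mvt:
  fixes f :: "'a::euclidean_space \<Rightarrow> real"
  assumes f: "smooth_on S f" "open S" and h: "h > 0"
    and sq: "\<And>s t. 0 \<le> s \<Longrightarrow> s \<le> h \<Longrightarrow> 0 \<le> t \<Longrightarrow> t \<le> h \<Longrightarrow> x + s *\<^sub>R a + t *\<^sub>R b \<in> S"
  shows "\<exists>s t. 0 \<le> s \<and> s \<le> h \<and> 0 \<le> t \<and> t \<le> h \<and>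
     f (x + h *\<^sub>R a + h *\<^sub>R b) - f (x + h *\<^sub>R a) - f (x + h *\<^sub>R b) + f x
         = h * h * dd b (dd a f) (x + s *\<^sub>R a + t *\<^sub>R b)"
proof -
  define u where "u s = f (x + h *\<^sub>R b + s *\<^sub>R a) - f (x + s *\<^sub>R a)" for s
  have du: "(u has_real_derivative dd a f (x + h *\<^sub>R b + s *\<^sub>R a) - dd a f (x + s *\<^sub>R a)) (at s)"
    if "0 \<le> s" "s \<le> h" for s
    unfolding u_def has_real_derivative_iff_has_vector_derivative
    using sq[OF that, of 0] sq[OF that, of h] h f
    by (intro has_vector_derivative_diff dd_line[OF f]) (auto simp: algebra_simps)
  obtain s where s: "0 < s" "s < h" "u h - u 0
      = h * (dd a f (x + h *\<^sub>R b + s *\<^sub>R a) - dd a f (x + s *\<^sub>R a))"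
    using MVT2[OF h du] by auto
  define w where "w t = dd a f (x + s *\<^sub>R a + t *\<^sub>R b)" for t
  have dw: "(w has_real_derivative dd b (dd a f) (x + s *\<^sub>R a + t *\<^sub>R b)) (at t)" if "0 \<le> t" "t \<le> h"
      for t
    unfolding w_def has_real_derivative_iff_has_vector_derivative
    using sq[of s t] that s f by (intro dd_line[where S=S] smooth_on_dd) auto
  obtain t where t: "0 < t" "t < h" "w h - w 0 = h * dd b (dd a f) (x + s *\<^sub>R a + t *\<^sub>R b)"
    using MVT2[OF h dw] by auto
  have "u h - u 0 = h * (w h - w 0)" using s(3) by (simp add: w_def algebra_simps)
  then have "f (x + h *\<^sub>R a + h *\<^sub>R b) - f (x + h *\<^sub>R a) - f (x + h *\<^sub>R b) + f x
     = h * h * dd b (dd a f) (x + s *\<^sub>R a + t *\<^sub>R b)"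
    using t(3) by (simp add: u_def algebra_simps)
  then show ?thesis using s t by (intro exI[of _ s] exI[of _ t]) auto
qed

lemma dd_commute_real:
  fixes f :: "'a::euclidean_space \<Rightarrow> real"
  assumes f: "smooth_on S f" "open S" and x: "x \<in> S"
  shows "dd a (dd b f) x = dd b (dd a f) x"
proof (rule ccontr)
  let ?p = "dd a (dd b f)" and ?q = "dd b (dd a f)"
  assume ne: "?p x \<noteq> ?q x"
  define e where "e = \<bar>?p x - ?q x\<bar> / 2"
  have e: "e > 0" using ne by (simp add: e_def)
  have cp: "isCont ?p x" and cq: "isCont ?q x"
    using smooth_on_continuous[OF smooth_on_dd[OF smooth_on_dd[OF f(1)]]] f(2) x
    by (auto simp: continuous_on_eq_continuous_at)
  obtain r where r: "r > 0" "ball x r \<subseteq> S" using f(2) x open_contains_ball by blast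
  obtain r1 where r1: "r1 > 0" "\<And>y. dist y x < r1 \<Longrightarrow> \<bar>?p y - ?p x\<bar> < e"
    using cp e unfolding continuous_at_eps_delta dist_real_def by metis
  obtain r2 where r2: "r2 > 0" "\<And>y. dist y x < r2 \<Longrightarrow> \<bar>?q y - ?q x\<bar> < e"
    using cq e unfolding continuous_at_eps_delta dist_real_def by metis
  define d where "d = min r (min r1 r2)"
  have d: "d > 0" using r r1 r2 by (simp add: d_def)
  define h where "h = d / (2 * (norm a + norm b + 1))"
  have h: "h > 0" using d by (simp add: h_def add_nonneg_pos)
  have near: "dist (x + s *\<^sub>R a + t *\<^sub>R b) x < d" if "0 \<le> s" "s \<le> h" "0 \<le> t" "t \<le> h" for s t
  proof -
    have "dist (x + s *\<^sub>R a + t *\<^sub>R b) x = norm (s *\<^sub>R a + t *\<^sub>R b)"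
      by (simp add: dist_norm algebra_simps)
    also have "\<dots> \<le> s * norm a + t * norm b" using that norm_triangle_ineq[of "s *\<^sub>R a" "t *\<^sub>R b"] by simp
    also have "\<dots> \<le> h * norm a + h * norm b" using that by (intro add_mono mult_right_mono) auto
    also have "\<dots> \<le> h * (norm a + norm b + 1)" using h by (simp add: algebra_simps)
    also have "\<dots> = d / 2"
    proof -
      have "norm a + norm b + 1 > 0" by (simp add: add_nonneg_pos)
      then show ?thesis by (simp add: h_def field_simps)
    qed
    finally show ?thesis using d by simp
  qed
  have inS: "x + s *\<^sub>R a + t *\<^sub>R b \<in> S" if "0 \<le> s" "s \<le> h" "0 \<le> t" "t \<le> h" for s t
    using near[OF that] r(2) by (auto simp: d_def dist_commute)
  have inS': "x + s *\<^sub>R b + t *\<^sub>R a \<in> S" if "0 \<le> s" "s \<le> h" "0 \<le> t" "t \<le> h" for s t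
    using inS[of t s] that by (simp add: add.assoc add.commute[of "s *\<^sub>R b"])
  obtain s t where 1: "0 \<le> s" "s \<le> h" "0 \<le> t" "t \<le> h"
     "f (x + h *\<^sub>R a + h *\<^sub>R b) - f (x + h *\<^sub>R a) - f (x + h *\<^sub>R b) + f x
         = h * h * ?q (x + s *\<^sub>R a + t *\<^sub>R b)"
    using second_difference_mvt[OF f h inS] by blast
  obtain s' t' where 2: "0 \<le> s'" "s' \<le> h" "0 \<le> t'" "t' \<le> h"
     "f (x + h *\<^sub>R b + h *\<^sub>R a) - f (x + h *\<^sub>R b) - f (x + h *\<^sub>R a) + f x
         = h * h * ?p (x + s' *\<^sub>R b + t' *\<^sub>R a)"
    using second_difference_mvt[OF f h inS'] by blast
  have "h * h * ?q (x + s *\<^sub>R a + t *\<^sub>R b) = h * h * ?p (x + s' *\<^sub>R b + t' *\<^sub>R a)"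
    using 1(5) 2(5) by (simp add: algebra_simps)
  then have "?q (x + s *\<^sub>R a + t *\<^sub>R b) = ?p (x + t' *\<^sub>R a + s' *\<^sub>R b)" using h
    by (simp add: algebra_simps)
  moreover have "\<bar>?q (x + s *\<^sub>R a + t *\<^sub>R b) - ?q x\<bar> < e" using r2 near[OF 1(1-4)] by (simp add: d_def)
  moreover have "\<bar>?p (x + t' *\<^sub>R a + s' *\<^sub>R b) - ?p x\<bar> < e" using r1 near[OF 2(3,4,1,2)]
    by (simp add: d_def)
  ultimately show False unfolding e_def by (simp add: abs_if split: if_splits)
qed

lemma dd_bounded_linear:
  assumes "smooth_on S f" "open S" "x \<in> S" "bounded_linear L"
  shows "dd a (\<lambda>x. L (f x)) x = L (dd a f x)"
  by (rule dd_eqI) (use bounded_linear.has_derivative[OF assms(4) smooth_on_has_derivative[OF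
      assms(1-3)]] in simp)

lemma dd_commute:
  fixes f :: "'a::euclidean_space \<Rightarrow> 'b::euclidean_space"
  assumes f: "smooth_on S f" "open S" and x: "x \<in> S"
  shows "dd a (dd b f) x = dd b (dd a f) x"
proof (rule euclidean_eqI)
  fix i :: 'b assume i: "i \<in> Basis"
  have *: "dd a (dd b f) x \<bullet> i = dd a (dd b (\<lambda>x. f x \<bullet> i)) x" for a b
  proof -
    have "dd a (dd b (\<lambda>x. f x \<bullet> i)) x = dd a (\<lambda>x. dd b f x \<bullet> i) x"
      using f x by (intro dd_cong[where S=S] dd_bounded_linear bounded_linear_inner_left) auto
    also have "\<dots> = dd a (dd b f) x \<bullet> i"
      using f x by (intro dd_bounded_linear[where S=S] bounded_linear_inner_left smooth_on_dd) auto
    finally show ?thesis by simp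
  qed
  have "smooth_on S (\<lambda>x. f x \<bullet> i)" by (rule smooth_on_linear[OF bounded_linear_inner_left f(2,1)])
  from dd_commute_real[OF this f(2) x] show "dd a (dd b f) x \<bullet> i = dd b (dd a f) x \<bullet> i"
    by (simp add: *)
qed

lemma dd_const [simp]: "dd v (\<lambda>x. c) = (\<lambda>x. 0)"
  by (rule ext) (rule dd_eqI, simp)
lemma dd_add:
  assumes "smooth_on S f" "smooth_on S g" "open S" "x \<in> S"
  shows "dd v (\<lambda>x. f x + g x) x = dd v f x + dd v g x"
  by (rule dd_eqI) (use has_derivative_add[OF smooth_on_has_derivative[OF assms(1,3,4)]
      smooth_on_has_derivative[OF assms(2,3,4)]] in simp)
lemma dd_diff:
  assumes "smooth_on S f" "smooth_on S g" "open S" "x \<in> S"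
  shows "dd v (\<lambda>x. f x - g x) x = dd v f x - dd v g x"
  by (rule dd_eqI) (use has_derivative_diff[OF smooth_on_has_derivative[OF assms(1,3,4)]
      smooth_on_has_derivative[OF assms(2,3,4)]] in simp)
lemma dd_cmult:
  fixes f :: "'a::euclidean_space \<Rightarrow> real"
  assumes "smooth_on S f" "open S" "x \<in> S"
  shows "dd v (\<lambda>x. c * f x) x = c * dd v f x"
  by (rule dd_bounded_linear[OF assms bounded_linear_mult_right])
lemma dd_mult:
  fixes f g :: "'a::euclidean_space \<Rightarrow> real"
  assumes "smooth_on S f" "smooth_on S g" "open S" "x \<in> S"
  shows "dd v (\<lambda>x. f x * g x) x = f x * dd v g x + dd v f x * g x"
  by (rule dd_eqI) (use has_derivative_mult[OF smooth_on_has_derivative[OF assms(1,3,4)]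
      smooth_on_has_derivative[OF assms(2,3,4)]] in simp)

section \<open>Smooth periodic functions\<close>

text \<open>Periodicity with respect to the lattice spanned by the standard basis.\<close>

definition periodic :: "('a::euclidean_space \<Rightarrow> 'b) \<Rightarrow> bool" where
  "periodic f \<longleftrightarrow> (\<forall>x. \<forall>b\<in>Basis. f (x + b) = f x)"

lemma periodic_of_int:
  assumes "periodic f" "b \<in> Basis"
  shows "f (x + of_int k *\<^sub>R b) = f x"
proof -
  have n: "f (y + of_nat n *\<^sub>R b) = f y" for n y
  proof (induction n)
    case (Suc n)
    have "f (y + of_nat (Suc n) *\<^sub>R b) = f ((y + of_nat n *\<^sub>R b) + b)" by (simp add: algebra_simps)
    then show ?case using Suc assms by (simp add: periodic_def)
  qed simp
  show ?thesis
  proof (cases k)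
    case (nonneg n)
    then show ?thesis using n[of x n] by simp
  next
    case (neg n)
    then have 0: "real_of_int k + of_nat (Suc n) = 0" by simp
    have "x + of_int k *\<^sub>R b + of_nat (Suc n) *\<^sub>R b = x + (real_of_int k + of_nat (Suc n)) *\<^sub>R b"
      by (simp only: scaleR_left_distrib add.assoc)
    also have "\<dots> = x" by (simp only: 0) simp
    finally have "x + of_int k *\<^sub>R b + of_nat (Suc n) *\<^sub>R b = x" .
    then show ?thesis using n[of "x + of_int k *\<^sub>R b" "Suc n"] by (simp only:)
  qed
qed

lemma periodic_lattice:
  assumes "periodic f" "\<And>b. b \<in> Basis \<Longrightarrow> m \<bullet> b \<in> \<int>"
  shows "f (x + m) = f x"
proof -
  have "f (x + (\<Sum>b\<in>B. (m \<bullet> b) *\<^sub>R b)) = f x" if "finite B" "B \<subseteq> Basis" for B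
    using that
  proof (induction B rule: finite_induct)
    case (insert b B)
    obtain k where k: "m \<bullet> b = of_int k" using insert.prems assms(2)[of b] by (auto simp: Ints_def)
    have "f (x + (\<Sum>b\<in>insert b B. (m \<bullet> b) *\<^sub>R b)) = f ((x + (\<Sum>b\<in>B. (m \<bullet> b) *\<^sub>R b)) + of_int k *\<^sub>R b)"
      using insert by (simp add: k algebra_simps)
    also have "\<dots> = f (x + (\<Sum>b\<in>B. (m \<bullet> b) *\<^sub>R b))"
      using insert assms(1) by (intro periodic_of_int) auto
    finally show ?case using insert by auto
  qed simp
  from this[of Basis] show ?thesis by (simp add: euclidean_representation)
qed

lemma periodic_fundamental_domain:
  fixes x :: "'a::euclidean_space"
  obtains y where "y \<in> cbox 0 One" "\<And>f :: 'a \<Rightarrow> 'b. periodic f \<Longrightarrow> f x = f y"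
proof -
  let ?m = "\<Sum>b\<in>Basis. - of_int \<lfloor>x \<bullet> b\<rfloor> *\<^sub>R b"
  have i: "?m \<bullet> b = - of_int \<lfloor>x \<bullet> b\<rfloor>" if "b \<in> Basis" for b
    using that by (simp only: inner_sum_left inner_scaleR_left)
        (simp add: inner_Basis if_distrib sum.delta cong: if_cong)
  have "x + ?m \<in> cbox 0 One"
    unfolding mem_box using i by (auto simp: inner_add_left; linarith)
  moreover have "f x = f (x + ?m)" if "periodic f" for f :: "'a \<Rightarrow> 'b"
    using periodic_lattice[OF that, of ?m x] i by auto
  ultimately show ?thesis using that by blast
qed

lemma periodic_bounded:
  fixes f :: "'a::euclidean_space \<Rightarrow> real"
  assumes "continuous_on UNIV f" "periodic f"
  obtains B where "B \<ge> 0" "\<And>x. \<bar>f x\<bar> \<le> B"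
proof -
  have "compact (f ` cbox 0 One)"
    using assms(1) by (intro compact_continuous_image) (auto intro: continuous_on_subset)
  then obtain B where B: "\<And>y. y \<in> cbox 0 One \<Longrightarrow> \<bar>f y\<bar> \<le> B"
    unfolding bounded_iff using compact_imp_bounded[of "f ` cbox 0 One"] by (auto simp: bounded_iff)
  have "\<bar>f x\<bar> \<le> max 0 B" for x
    using periodic_fundamental_domain[of x] B assms(2) by (metis max.coboundedI2)
  then show ?thesis using that[of "max 0 B"] by auto
qed

definition smooth_periodic :: "('a::euclidean_space \<Rightarrow> real) \<Rightarrow> bool" where
  "smooth_periodic f \<longleftrightarrow> smooth f \<and> periodic f"

lemma smooth_periodicD: 
  assumes "smooth_periodic f"
  shows "smooth f" "periodic f" "continuous_on S f"
  using assms smooth_on_continuous continuous_on_subset[of UNIV f S] unfolding smooth_periodic_def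
    by auto

lemma periodic_dd:
  assumes "periodic f" "smooth f"
  shows "periodic (dd v f)"
  unfolding periodic_def
proof (intro allI ballI)
  fix x b :: 'a assume b: "b \<in> Basis"
  have "((\<lambda>y. y + b) has_derivative (\<lambda>v. v)) (at x)" by (auto intro!: derivative_eq_intros)
  from has_derivative_compose[OF this, of f "\<lambda>v. dd v f (x + b)"]
  have "((\<lambda>y. f (y + b)) has_derivative (\<lambda>v. dd v f (x + b))) (at x)"
    using smooth_on_has_derivative[OF assms(2)] by simp
  moreover have "(\<lambda>y. f (y + b)) = f" using assms(1) b by (auto simp: periodic_def)
  ultimately show "dd v f (x + b) = dd v f x" by (simp add: dd_eqI)
qed

lemma smooth_periodic_dd: "smooth_periodic f \<Longrightarrow> smooth_periodic (dd v f)"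
  by (simp add: smooth_periodic_def smooth_on_dd periodic_dd)

lemma smooth_periodic_const: "smooth_periodic (\<lambda>x. c)"
  by (simp add: smooth_periodic_def periodic_def)
lemma smooth_periodic_add: "smooth_periodic f \<Longrightarrow> smooth_periodic g \<Longrightarrow> smooth_periodic (\<lambda>x. f x + g x)"
  by (simp add: smooth_periodic_def periodic_def smooth_on_add)
lemma smooth_periodic_diff: "smooth_periodic f \<Longrightarrow> smooth_periodic g \<Longrightarrow> smooth_periodic (\<lambda>x. f x - g x)"
  by (simp add: smooth_periodic_def periodic_def smooth_on_diff)
lemma smooth_periodic_mult: "smooth_periodic f \<Longrightarrow> smooth_periodic g \<Longrightarrow> smooth_periodic (\<lambda>x. f x * g x)"
  by (simp add: smooth_periodic_def periodic_def smooth_on_mult)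
lemma smooth_periodic_cmult: "smooth_periodic f \<Longrightarrow> smooth_periodic (\<lambda>x. c * f x)"
  by (simp add: smooth_periodic_mult smooth_periodic_const)
lemma smooth_periodic_uminus: "smooth_periodic f \<Longrightarrow> smooth_periodic (\<lambda>x. - f x)"
  using smooth_periodic_cmult[of f "-1"] by simp
lemmas smooth_periodic_intros = smooth_periodic_dd smooth_periodic_const smooth_periodic_add
  smooth_periodic_diff smooth_periodic_mult smooth_periodic_uminus

lemma smooth_dd_expand:
  assumes "smooth f"
  shows "dd v f x = (\<Sum>b\<in>Basis. (v \<bullet> b) *\<^sub>R dd b f x)"
proof -
  have lin: "linear (\<lambda>v. dd v f x)" using dd_linear[OF assms] by simp
  have "dd v f x = dd (\<Sum>b\<in>Basis. (v \<bullet> b) *\<^sub>R b) f x" by (simp only: euclidean_representation)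
  also have "\<dots> = (\<Sum>b\<in>Basis. (v \<bullet> b) *\<^sub>R dd b f x)"
    by (simp only: linear_sum[OF lin] linear_scale[OF lin])
  finally show ?thesis .
qed

text \<open>Uniformity in the direction \<open>v\<close> is what differentiation of a series in the Frechet sense
  requires.\<close>

lemma smooth_periodic_dd_bound:
  assumes "smooth_periodic f"
  obtains C where "C \<ge> 0" "\<And>v x. \<bar>dd v f x\<bar> \<le> C * norm v"
proof -
  have "\<forall>b. \<exists>B. B \<ge> 0 \<and> (\<forall>x. \<bar>dd b f x\<bar> \<le> B)"
    using periodic_bounded smooth_periodicD[OF smooth_periodic_dd[OF assms]] by metis
  then obtain B where B: "\<And>b. B b \<ge> 0" "\<And>b x. \<bar>dd b f x\<bar> \<le> B b" by metis
  have "\<bar>dd v f x\<bar> \<le> (\<Sum>b\<in>Basis. B b) * norm v" for v x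
  proof -
    have "\<bar>dd v f x\<bar> = \<bar>\<Sum>b\<in>Basis. (v \<bullet> b) *\<^sub>R dd b f x\<bar>"
      using smooth_dd_expand smooth_periodicD(1)[OF assms] by metis
    also have "\<dots> \<le> (\<Sum>b\<in>Basis. \<bar>(v \<bullet> b) *\<^sub>R dd b f x\<bar>)" by (rule sum_abs)
    also have "\<dots> \<le> (\<Sum>b\<in>Basis. norm v * B b)"
      by (intro sum_mono) (auto simp: abs_mult Basis_le_norm B intro!: mult_mono)
    finally show ?thesis by (simp add: sum_distrib_left mult.commute)
  qed
  then show ?thesis using that[of "\<Sum>b\<in>Basis. B b"] B by (simp add: sum_nonneg)
qed

section \<open>Convolution along a line\<close>

text \<open>For \<open>f\<close> with period \<open>e\<close> this is a convolution on the circle in direction \<open>e\<close>, the other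
  variables being parameters.\<close>

definition conv :: "(real \<Rightarrow> real) \<Rightarrow> 'a::euclidean_space \<Rightarrow> ('a \<Rightarrow> real) \<Rightarrow> 'a \<Rightarrow> real" where
  "conv k e f x = integral {0..1} (\<lambda>s. k s * f (x + s *\<^sub>R e))"

lemma continuous_on_line:
  fixes f :: "'a::euclidean_space \<Rightarrow> 'b::topological_space"
  assumes "continuous_on UNIV f" shows "continuous_on S (\<lambda>s. f (x + s *\<^sub>R e))"
  by (rule continuous_on_compose2[OF assms, of _ "\<lambda>s. x + s *\<^sub>R e"]) (auto intro!: continuous_intros)

lemma conv_integrable:
  fixes f :: "'a::euclidean_space \<Rightarrow> real"
  assumes "continuous_on UNIV k" "continuous_on UNIV f"
  shows "(\<lambda>s. k s * f (x + s *\<^sub>R e)) integrable_on {0..1}"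
  by (intro integrable_continuous_real continuous_on_mult continuous_on_line assms
      continuous_on_subset[OF assms(1)]) auto

text \<open>Differentiation under the integral sign; the derivative of \<open>f\<close> is assembled from the partial
  derivatives to obtain a continuous map into bounded linear functions.\<close>

lemma conv_has_derivative:
  assumes f: "smooth f" and k: "continuous_on UNIV k"
  shows "(conv k e f has_derivative (\<lambda>v. conv k e (dd v f) x)) (at x)"
proof -
  define D where "D y = (\<Sum>b\<in>Basis. dd b f y *\<^sub>R blinfun_inner_left b)" for y
  have D: "blinfun_apply (D y) v = dd v f y" for y v
    unfolding smooth_dd_expand[OF f, of v y] D_def
    by (simp add: blinfun.sum_left blinfun.scaleR_left inner_commute mult.commute)
  have contD: "continuous_on UNIV D"
    unfolding D_def using smooth_on_continuous[OF smooth_on_dd[OF f]] by (intro continuous_intros) auto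
  have cont: "continuous_on UNIV f" using f smooth_on_continuous by blast
  define E where "E y s = k s *\<^sub>R D (y + s *\<^sub>R e)" for y s
  have "((\<lambda>y. integral (cbox 0 1) (\<lambda>s. k s * f (y + s *\<^sub>R e))) has_derivative
     blinfun_apply (integral (cbox 0 1) (E x))) (at x within UNIV)"
  proof (rule leibniz_rule)
    fix y :: 'a and s :: real
    have "((\<lambda>y. f (y + s *\<^sub>R e)) has_derivative (\<lambda>v. dd v f (y + s *\<^sub>R e))) (at y)"
      using has_derivative_compose[where f="\<lambda>y. y + s *\<^sub>R e" and f'="\<lambda>v. v" and g=f]
        smooth_on_has_derivative[OF f, of "y + s *\<^sub>R e"]
      by (fastforce intro!: derivative_eq_intros)
    then have "((\<lambda>y. k s * f (y + s *\<^sub>R e)) has_derivative (\<lambda>v. k s * dd v f (y + s *\<^sub>R e))) (at y)"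
      by (rule has_derivative_mult_right)
    then show "((\<lambda>y. k s * f (y + s *\<^sub>R e)) has_derivative blinfun_apply (E y s)) (at y within UNIV)"
      by (simp add: E_def blinfun.scaleR_left[abs_def] D)
  next
    show "(\<lambda>s. k s * f (y + s *\<^sub>R e)) integrable_on cbox 0 1" for y
      using conv_integrable[OF k cont] by simp
    show "continuous_on (UNIV \<times> cbox 0 1) (\<lambda>(y, s). E y s)"
      unfolding E_def split_beta
      by (intro continuous_on_scaleR continuous_on_compose2[OF contD] continuous_on_compose2[OF k])
        (auto intro!: continuous_intros)
  qed auto
  moreover
  have "blinfun_apply (integral (cbox 0 1) (E x)) v = conv k e (dd v f) x" for v
  proof -
    have "E x integrable_on cbox 0 1"
      unfolding E_def
      by (intro integrable_continuous continuous_on_scaleR continuous_on_compose2[OF contD]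
          continuous_on_compose2[OF k])
        (auto intro!: continuous_intros)
    then have "blinfun_apply (integral (cbox 0 1) (E x)) v
        = integral (cbox 0 1) (\<lambda>s. blinfun_apply (E x s) v)"
      by (rule blinfun_apply_integral)
    then show ?thesis by (simp add: conv_def E_def blinfun.scaleR_left D)
  qed
  then have "blinfun_apply (integral (cbox 0 1) (E x)) = (\<lambda>v. conv k e (dd v f) x)" by blast
  ultimately show ?thesis by (simp add: conv_def[abs_def])
qed

lemma dd_conv:
  assumes "smooth f" "continuous_on UNIV k"
  shows "dd v (conv k e f) = conv k e (dd v f)"
  by (rule ext) (rule dd_eqI[OF conv_has_derivative[OF assms]])

lemma smooth_conv:
  assumes "smooth f" "continuous_on UNIV k"
  shows "smooth (conv k e f)"
proof -
  have "Ck_on j UNIV (conv k e f)" for j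
    using assms(1)
  proof (induction j arbitrary: f)
    case 0
    have "isCont (conv k e f) x" for x
      using has_derivative_continuous[OF conv_has_derivative[OF 0 assms(2)]] .
    then show ?case by (simp add: continuous_at_imp_continuous_on)
  next
    case (Suc j)
    show ?case
      by (rule Ck_on_SucI[OF _ conv_has_derivative[OF Suc.prems assms(2)]])
        (auto intro!: Suc.IH smooth_on_dd Suc.prems)
  qed
  then show ?thesis by (simp add: smooth_on_def)
qed

lemma periodic_conv: "periodic f \<Longrightarrow> periodic (conv k e f)"
  unfolding periodic_def conv_def
proof (intro allI ballI)
  fix x b :: 'a assume p: "\<forall>x. \<forall>b\<in>Basis. f (x + b) = f x" and b: "b \<in> Basis"
  have "f (x + b + s *\<^sub>R e) = f (x + s *\<^sub>R e)" for s
    using p b by (metis add.assoc add.commute)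
  then show "integral {0..1} (\<lambda>s. k s * f (x + b + s *\<^sub>R e))
      = integral {0..1} (\<lambda>s. k s * f (x + s *\<^sub>R e))"
    by simp
qed

lemma smooth_periodic_conv: "smooth_periodic f \<Longrightarrow> continuous_on UNIV k \<Longrightarrow> smooth_periodic (conv k e f)"
  by (simp add: smooth_periodic_def smooth_conv periodic_conv)

lemma conv_mono:
  assumes "continuous_on UNIV k" "continuous_on UNIV f" "continuous_on UNIV g"
    "\<And>s. s \<in> {0..1} \<Longrightarrow> 0 \<le> k s" "\<And>x. f x \<le> g x"
  shows "conv k e f x \<le> conv k e g x"
  unfolding conv_def using assms
  by (intro integral_le conv_integrable mult_left_mono) auto

lemma conv_const: "conv k e (\<lambda>x. c) x = integral {0..1} k * c"
  by (simp add: conv_def)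

lemma conv_lincomb:
  assumes "continuous_on UNIV k" "continuous_on UNIV f" "continuous_on UNIV g"
  shows "conv k e (\<lambda>x. f x + c * g x) x = conv k e f x + c * conv k e g x"
proof -
  have "conv k e (\<lambda>x. f x + c * g x) x
      = integral {0..1} (\<lambda>s. k s * f (x + s *\<^sub>R e) + c * (k s * g (x + s *\<^sub>R e)))"
    by (simp add: conv_def algebra_simps)
  also have "\<dots> = conv k e f x + c * conv k e g x"
    unfolding conv_def
    by (subst integral_add) (auto intro!: integrable_on_mult_right conv_integrable assms)
  finally show ?thesis .
qed

lemma conv_cmult: "conv k e (\<lambda>x. c * g x) x = c * conv k e g x"
  unfolding conv_def by (simp add: mult.left_commute)

lemma conv_bound:
  assumes k: "continuous_on UNIV k" and f: "continuous_on UNIV f" "\<And>x. \<bar>f x\<bar> \<le> B"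
  shows "\<bar>conv k e f x\<bar> \<le> integral {0..1} (\<lambda>s. \<bar>k s\<bar>) * B"
proof -
  have ik: "(\<lambda>s. \<bar>k s\<bar>) integrable_on {0..1}"
    by (intro integrable_continuous_real continuous_on_rabs continuous_on_subset[OF k]) auto
  have "\<bar>conv k e f x\<bar> \<le> integral {0..1} (\<lambda>s. \<bar>k s\<bar> * B)"
    unfolding conv_def real_norm_def[symmetric]
    using f(2) by (intro integral_norm_bound_integral conv_integrable[OF k f(1)]
        integrable_on_mult_left ik)
      (auto simp: abs_mult ik intro!: mult_left_mono)
  then show ?thesis by simp
qed

lemma conv_by_parts:
  assumes f: "smooth f" and per: "\<And>x. f (x + e) = f x"
    and k: "\<And>s. (k has_real_derivative k' s) (at s)" "continuous_on UNIV k'"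
  shows "conv k e (dd e f) x = (k 1 - k 0) * f x - conv k' e f x"
proof -
  have ck: "continuous_on UNIV k" using k(1) DERIV_isCont continuous_at_imp_continuous_on by blast
  have d: "((\<lambda>s. f (x + s *\<^sub>R e)) has_real_derivative dd e f (x + s *\<^sub>R e)) (at s)" for s
    unfolding has_real_derivative_iff_has_vector_derivative by (rule dd_line[OF f]) auto
  have "((\<lambda>s. k s * f (x + s *\<^sub>R e)) has_real_derivative
      k' s * f (x + s *\<^sub>R e) + k s * dd e f (x + s *\<^sub>R e)) (at s within {0..1})" for s
    by (rule DERIV_subset) (auto intro!: derivative_eq_intros k d)
  then have "((\<lambda>s. k' s * f (x + s *\<^sub>R e) + k s * dd e f (x + s *\<^sub>R e)) has_integral
     (k 1 * f (x + 1 *\<^sub>R e) - k 0 * f (x + 0 *\<^sub>R e))) {0..1}"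
    by (intro fundamental_theorem_of_calculus) (auto simp: has_real_derivative_iff_has_vector_derivative)
  then have "integral {0..1} (\<lambda>s. k' s * f (x + s *\<^sub>R e) + k s * dd e f (x + s *\<^sub>R e))
      = (k 1 - k 0) * f x"
    using per[of x] by (simp add: integral_unique left_diff_distrib)
  moreover have "integral {0..1} (\<lambda>s. k' s * f (x + s *\<^sub>R e) + k s * dd e f (x + s *\<^sub>R e))
     = conv k' e f x + conv k e (dd e f) x"
    unfolding conv_def using f k ck
    by (intro integral_add conv_integrable) (auto intro: smooth_on_continuous smooth_on_dd)
  ultimately show ?thesis by simp
qed

text \<open>Two integrations by parts. Only the jump of \<open>k'\<close> across the period contributes a boundary
  term, so a kernel whose derivative jumps by \<open>1\<close> and that satisfies \<open>k'' = m\<^sup>2 k\<close> inverts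
  \<open>m\<^sup>2 - d\<^sup>2/ds\<^sup>2\<close>.\<close>

lemma conv_dd_dd:
  assumes f: "smooth_periodic f" and e: "e \<in> Basis"
    and k: "\<And>s. (k has_real_derivative k' s) (at s)" "\<And>s. (k' has_real_derivative k'' s) (at s)" 
      "continuous_on UNIV k''" and k01: "k 0 = k 1"
  shows "conv k e (dd e (dd e f)) x = - (k' 1 - k' 0) * f x + conv k'' e f x"
proof -
  note s = smooth_periodicD[OF f] smooth_periodicD[OF smooth_periodic_dd[OF f, of e]]
  have ck': "continuous_on UNIV k'" using k(2) DERIV_isCont continuous_at_imp_continuous_on by blast
  have "conv k e (dd e (dd e f)) x = - conv k' e (dd e f) x"
    using conv_by_parts[OF s(4) _ k(1) ck', of e x] s(5) e k01 by (simp add: periodic_def)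
  also have "conv k' e (dd e f) x = (k' 1 - k' 0) * f x - conv k'' e f x"
    using conv_by_parts[OF s(1) _ k(2,3), of e x] s(2) e by (simp add: periodic_def)
  finally show ?thesis by (simp add: algebra_simps)
qed

text \<open>The Green function of \<open>m\<^sup>2 - d\<^sup>2/ds\<^sup>2\<close> on the circle of length \<open>1\<close>.\<close>

definition green :: "real \<Rightarrow> real \<Rightarrow> real" where
  "green m s = cosh (m * (s - 1/2)) / (2 * m * sinh (m / 2))"

definition green' :: "real \<Rightarrow> real \<Rightarrow> real" where
  "green' m s = sinh (m * (s - 1/2)) / (2 * sinh (m / 2))"

lemma green_facts:
  assumes "m > 0"
  shows "(green m has_real_derivative green' m s) (at s)"
    and "(green' m has_real_derivative m\<^sup>2 * green m s) (at s)"
    and "green m 0 = green m 1" and "green' m 1 - green' m 0 = 1" and "green m s > 0"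
    and "continuous_on S (green m)" and "integral {0..1} (green m) = 1 / m\<^sup>2"
proof -
  have sh: "sinh (m / 2) > 0" using assms by (simp add: sinh_real_pos_iff)
  show 1: "(green m has_real_derivative green' m s) (at s)" for s
    unfolding green_def[abs_def] green'_def using assms sh
    by (auto intro!: derivative_eq_intros simp: field_simps)
  show 2: "(green' m has_real_derivative m\<^sup>2 * green m s) (at s)" for s
    unfolding green'_def[abs_def] green_def using assms sh
    by (auto intro!: derivative_eq_intros simp: field_simps power2_eq_square)
  show "green m 0 = green m 1" by (simp add: green_def)
  show 3: "green' m 1 - green' m 0 = 1" using sh by (simp add: green'_def field_simps)
  show "green m s > 0" using assms sh by (simp add: green_def)
  show "continuous_on S (green m)"
    using 1 DERIV_isCont continuous_at_imp_continuous_on by blast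
  have "((\<lambda>s. m\<^sup>2 * green m s) has_integral green' m 1 - green' m 0) {0..1}"
    by (intro fundamental_theorem_of_calculus)
      (auto simp: has_real_derivative_iff_has_vector_derivative[symmetric] intro: DERIV_subset 2)
  from integral_unique[OF this] have "m\<^sup>2 * integral {0..1} (green m) = 1" using 3 by simp
  then show "integral {0..1} (green m) = 1 / m\<^sup>2" using assms by (simp add: field_simps)
qed

lemma conv_green:
  assumes f: "smooth_periodic f" and e: "e \<in> Basis" and m: "m > 0"
  shows "conv (green m) e (dd e (dd e f)) x = m\<^sup>2 * conv (green m) e f x - f x"
  using conv_dd_dd[OF f e green_facts(1,2)[OF m] _ green_facts(3)[OF m], of x] green_facts(4,6)[OF m]
  by (simp add: continuous_on_mult_left conv_def mult.assoc)

text \<open>The substitute for \<open>green m\<close> at \<open>m = 0\<close>, where constants have to be projected out: a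
  Bernoulli polynomial.\<close>

definition green0 :: "real \<Rightarrow> real" where "green0 s = (s\<^sup>2 - s) / 2"

lemma continuous_green0: "continuous_on S green0"
  unfolding green0_def[abs_def] by (intro continuous_intros) auto

lemma conv_green0:
  assumes f: "smooth_periodic f" and e: "e \<in> Basis"
  shows "conv green0 e (dd e (dd e f)) x = conv (\<lambda>s. 1) e f x - f x"
proof -
  have "(green0 has_real_derivative (s - 1/2)) (at s)" for s
    unfolding green0_def[abs_def] by (auto intro!: derivative_eq_intros)
  moreover have "((\<lambda>s. s - 1/2) has_real_derivative 1) (at s)" for s :: real
    by (auto intro!: derivative_eq_intros)
  ultimately show ?thesis
    using conv_dd_dd[OF f e, of green0 "\<lambda>s. s - 1/2" "\<lambda>s. 1" x] by (simp add: green0_def)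
qed

lemma conv_mean_dd:
  assumes f: "smooth_periodic f" and e: "e \<in> Basis"
  shows "conv (\<lambda>s. 1) e (dd e f) x = 0"
  using conv_by_parts[OF smooth_periodicD(1)[OF f], of e "\<lambda>s. 1" "\<lambda>s. 0" x] smooth_periodicD(2)[OF f] e
  by (simp add: periodic_def conv_def)

text \<open>The index is shifted because the constant mode is always treated apart.\<close>

abbreviation freq :: "nat \<Rightarrow> real" where "freq n \<equiv> 2 * pi * real (Suc n)"

abbreviation cosine :: "nat \<Rightarrow> real \<Rightarrow> real" where "cosine n \<equiv> \<lambda>s. 2 * cos (freq n * s)"

lemma conv_cos:
  assumes f: "smooth_periodic f" and e: "e \<in> Basis"
  shows "conv (cosine n) e (dd e (dd e f)) x =
     - (freq n)\<^sup>2 * conv (cosine n) e f x"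
proof -
  define m where "m = freq n"
  have c: "cos m = 1" "sin m = 0"
    unfolding m_def by (metis cos_int_2pin of_int_of_nat_eq, metis sin_int_2pin of_int_of_nat_eq)
  have "conv (\<lambda>s. 2 * cos (m * s)) e (dd e (dd e f)) x = conv (\<lambda>s. - m\<^sup>2 * (2 * cos (m * s))) e f x"
    using c by (subst conv_dd_dd[OF f e, where k'="\<lambda>s. - 2 * m * sin (m * s)" and k''="\<lambda>s. - m\<^sup>2 *
        (2 * cos (m * s))"])
      (auto intro!: derivative_eq_intros continuous_intros simp: power2_eq_square)
  also have "\<dots> = - m\<^sup>2 * conv (\<lambda>s. 2 * cos (m * s)) e f x"
    unfolding conv_def by (simp add: mult.assoc)
  finally show ?thesis by (simp only: m_def)
qed

section \<open>Translation-invariant operators\<close>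

text \<open>Operators on smooth periodic functions that behave like convolutions. Because they commute
  with all derivatives, the bound in the supremum norm is inherited by every derivative.\<close>

definition smooth_operator :: "real \<Rightarrow> (('a::euclidean_space \<Rightarrow> real) \<Rightarrow> 'a \<Rightarrow> real) \<Rightarrow> bool" where
  "smooth_operator M T \<longleftrightarrow>
     (\<forall>f. smooth_periodic f \<longrightarrow> smooth_periodic (T f) \<and> (\<forall>v. dd v (T f) = T (dd v f)) \<and>
        (\<forall>B. (\<forall>x. \<bar>f x\<bar> \<le> B) \<longrightarrow> (\<forall>x. \<bar>T f x\<bar> \<le> M * B))) \<and>
     (\<forall>f g c x. smooth_periodic f \<longrightarrow> smooth_periodic g \<longrightarrow> T (\<lambda>x. f x + c * g x) x = T f x + c * T g x)"

lemma smooth_operatorD: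
  assumes "smooth_operator M T" "smooth_periodic f"
  shows "smooth_periodic (T f)" "dd v (T f) = T (dd v f)" "(\<And>x. \<bar>f x\<bar> \<le> B) \<Longrightarrow> \<bar>T f x\<bar> \<le> M * B"
    "smooth_periodic g \<Longrightarrow> T (\<lambda>x. f x + c * g x) x = T f x + c * T g x"
  using assms unfolding smooth_operator_def by auto

lemma smooth_operator_linear:
  assumes "smooth_operator M T" "smooth_periodic f" "smooth_periodic g"
  shows "T (\<lambda>x. f x + g x) x = T f x + T g x" "T (\<lambda>x. f x - g x) x = T f x - T g x"
    "T (\<lambda>x. c * f x) x = c * T f x" "T (\<lambda>x. 0) x = 0"
proof -
  show "T (\<lambda>x. f x + g x) x = T f x + T g x"
    using smooth_operatorD(4)[OF assms, of 1 x] by simp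
  show "T (\<lambda>x. f x - g x) x = T f x - T g x"
    using smooth_operatorD(4)[OF assms, of "-1" x] by simp
  have 0: "T (\<lambda>x. 0) x = 0"
    using smooth_operatorD(4)[OF assms(1) smooth_periodic_const smooth_periodic_const, of 0 1 0 x]
      by simp
  then show "T (\<lambda>x. 0) x = 0" .
  show "T (\<lambda>x. c * f x) x = c * T f x"
    using smooth_operatorD(4)[OF assms(1) smooth_periodic_const assms(2), of 0 c x] 0 by simp
qed

lemma smooth_operator_conv:
  assumes k: "continuous_on UNIV k"
  shows "smooth_operator (integral {0..1} (\<lambda>s. \<bar>k s\<bar>)) (conv k e)"
  unfolding smooth_operator_def
proof (intro conjI allI impI)
  fix f :: "'a \<Rightarrow> real" assume f: "smooth_periodic f"
  note s = smooth_periodicD[OF f]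
  show "smooth_periodic (conv k e f)" using f k by (rule smooth_periodic_conv)
  show "dd v (conv k e f) = conv k e (dd v f)" for v using s(1) k by (rule dd_conv)
  show "\<bar>conv k e f x\<bar> \<le> integral {0..1} (\<lambda>s. \<bar>k s\<bar>) * B" if "\<forall>x. \<bar>f x\<bar> \<le> B" for B x
    using conv_bound[OF k s(3)] that by blast
next
  fix f g :: "'a \<Rightarrow> real" and c x assume "smooth_periodic f" "smooth_periodic g"
  then show "conv k e (\<lambda>x. f x + c * g x) x = conv k e f x + c * conv k e g x"
    by (intro conv_lincomb k smooth_periodicD)
qed

lemma smooth_operator_comp:
  assumes S: "smooth_operator M S" and T: "smooth_operator N T"
  shows "smooth_operator (M * N) (\<lambda>f. S (T f))"
  unfolding smooth_operator_def
proof (intro conjI allI impI)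
  fix f :: "'a \<Rightarrow> real" assume f: "smooth_periodic f"
  show "smooth_periodic (S (T f))" using smooth_operatorD(1) S T f by blast
  show "dd v (S (T f)) = S (T (dd v f))" for v using smooth_operatorD(1,2) S T f by metis
  fix B x assume "\<forall>x. \<bar>f x\<bar> \<le> B"
  then have "\<bar>S (T f) x\<bar> \<le> M * (N * B)" using smooth_operatorD(1,3) S T f by metis
  then show "\<bar>S (T f) x\<bar> \<le> M * N * B" by (simp add: mult.assoc)
next
  fix f g :: "'a \<Rightarrow> real" and c x assume f: "smooth_periodic f" "smooth_periodic g"
  have "T (\<lambda>x. f x + c * g x) = (\<lambda>x. T f x + c * T g x)"
    using smooth_operatorD(4)[OF T f] by blast
  then show "S (T (\<lambda>x. f x + c * g x)) x = S (T f) x + c * S (T g) x"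
    using smooth_operatorD(4)[OF S smooth_operatorD(1)[OF T f(1)] smooth_operatorD(1)[OF T f(2)]] by simp
qed

lemma smooth_operator_lincomb:
  assumes S: "smooth_operator M S" and T: "smooth_operator N T"
  shows "smooth_operator (M + \<bar>a\<bar> * N) (\<lambda>f x. S f x + a * T f x)"
  unfolding smooth_operator_def
proof (intro conjI allI impI)
  fix f :: "'a \<Rightarrow> real" assume f: "smooth_periodic f"
  note s = smooth_operatorD[OF S f] and t = smooth_operatorD[OF T f]
  show "smooth_periodic (\<lambda>x. S f x + a * T f x)" 
    using s(1) t(1) by (simp add: smooth_periodic_add smooth_periodic_cmult)
  show "dd v (\<lambda>x. S f x + a * T f x) = (\<lambda>x. S (dd v f) x + a * T (dd v f) x)" for v
    using smooth_periodicD(1)[OF s(1)] smooth_periodicD(1)[OF t(1)] 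
    by (auto simp: dd_add[where S=UNIV] dd_cmult[where S=UNIV] smooth_on_mult s(2)[symmetric]
        t(2)[symmetric])
  fix B x assume B: "\<forall>x. \<bar>f x\<bar> \<le> B"
  have "\<bar>S f x + a * T f x\<bar> \<le> \<bar>S f x\<bar> + \<bar>a\<bar> * \<bar>T f x\<bar>"
    by (simp add: abs_mult[symmetric] abs_triangle_ineq)
  also have "\<dots> \<le> M * B + \<bar>a\<bar> * (N * B)" using s(3) t(3) B by (intro add_mono mult_left_mono) auto
  finally show "\<bar>S f x + a * T f x\<bar> \<le> (M + \<bar>a\<bar> * N) * B" by (simp add: algebra_simps)
next
  fix f g :: "'a \<Rightarrow> real" and c x assume f: "smooth_periodic f" "smooth_periodic g"
  show "S (\<lambda>x. f x + c * g x) x + a * T (\<lambda>x. f x + c * g x) x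
      = S f x + a * T f x + c * (S g x + a * T g x)"
    using smooth_operatorD(4)[OF S f] smooth_operatorD(4)[OF T f] by (simp add: algebra_simps)
qed

lemma series_tail_bound:
  fixes u M :: "nat \<Rightarrow> real"
  assumes "\<And>n. \<bar>u n\<bar> \<le> M n * B" "summable M"
  shows "summable u" "\<bar>suminf u\<bar> \<le> suminf M * B" "\<bar>sum u {..<n} - suminf u\<bar> \<le> (\<Sum>i. M (i + n)) * B"
proof -
  have sM: "summable (\<lambda>n. M n * B)" using assms(2) by (rule summable_mult2)
  have sa: "summable (\<lambda>n. \<bar>u n\<bar>)"
    by (rule summable_comparison_test[OF _ sM]) (use assms(1) in auto)
  then show s: "summable u" by (rule summable_rabs_cancel)
  have "\<bar>suminf u\<bar> \<le> (\<Sum>n. \<bar>u n\<bar>)" by (rule summable_rabs[OF sa])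
  also have "\<dots> \<le> (\<Sum>n. M n * B)" using sa sM assms(1) by (intro suminf_le)
  finally show "\<bar>suminf u\<bar> \<le> suminf M * B" by (simp only: suminf_mult2[OF assms(2)])
  have sa': "summable (\<lambda>i. \<bar>u (i + n)\<bar>)" by (rule summable_ignore_initial_segment[OF sa])
  have sM': "summable (\<lambda>i. M (i + n))" by (rule summable_ignore_initial_segment[OF assms(2)])
  have "sum u {..<n} - suminf u = - (\<Sum>i. u (i + n))"
    using suminf_split_initial_segment[OF s, of n] by simp
  then have "\<bar>sum u {..<n} - suminf u\<bar> \<le> (\<Sum>i. \<bar>u (i + n)\<bar>)" using summable_rabs[OF sa'] by simp
  also have "\<dots> \<le> (\<Sum>i. M (i + n) * B)" using sa' sM' assms(1) by (intro suminf_le summable_mult2)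
  finally show "\<bar>sum u {..<n} - suminf u\<bar> \<le> (\<Sum>i. M (i + n)) * B" by (simp only: suminf_mult2[OF sM'])
qed

text \<open>A single summable bound in the supremum norm permits termwise differentiation to all orders,
  since the derivatives of \<open>T n f\<close> are the values of \<open>T n\<close> at the derivatives of \<open>f\<close>.\<close>

lemma smooth_operator_series:
  fixes T :: "nat \<Rightarrow> ('a::euclidean_space \<Rightarrow> real) \<Rightarrow> 'a \<Rightarrow> real"
  assumes T: "\<And>n. smooth_operator (M n) (T n)" and M: "summable M"
  shows "smooth_operator (suminf M) (\<lambda>f x. \<Sum>n. T n f x)"
proof -
  let ?S = "\<lambda>f x. \<Sum>n. T n f x"
  have bd: "\<bar>T n f x\<bar> \<le> M n * B" if "smooth_periodic f" "\<And>x. \<bar>f x\<bar> \<le> B" for n f x B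
    using smooth_operatorD(3)[OF T that] .
  have summ: "summable (\<lambda>n. T n f x)" if f: "smooth_periodic f" for f x
  proof -
    obtain B where "\<And>x. \<bar>f x\<bar> \<le> B" using periodic_bounded smooth_periodicD[OF f] by metis
    from series_tail_bound(1)[OF bd[OF f this] M] show ?thesis .
  qed
  have der: "(?S f has_derivative (\<lambda>v. ?S (dd v f) x)) (at x)" if f: "smooth_periodic f" for f x
  proof -
    have "\<exists>g. \<forall>x\<in>UNIV. (\<lambda>n. T n f x) sums (g x) \<and> (g
        has_derivative (\<lambda>v. ?S (dd v f) x)) (at x within UNIV)"
    proof (rule has_derivative_series[where x=0 and l="?S f 0"])
      show "(T n f has_derivative (\<lambda>v. T n (dd v f) x)) (at x within UNIV)" for n x
        using smooth_on_has_derivative[OF smooth_periodicD(1)[OF smooth_operatorD(1)[OF T[of n] f]],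
            of x]
          smooth_operatorD(2)[OF T[of n] f]
        by simp
      fix e :: real assume e: "e > 0"
      obtain C where C: "C \<ge> 0" "\<And>v x. \<bar>dd v f x\<bar> \<le> C * norm v" using smooth_periodic_dd_bound[OF f]
        by blast
      have "(\<lambda>n. (\<Sum>i. M (i + n))) \<longlonglongrightarrow> 0" using suminf_exist_split2[OF M] .
      then have "(\<lambda>n. (\<Sum>i. M (i + n)) * C) \<longlonglongrightarrow> 0" by (rule tendsto_mult_left_zero)
      then have "\<forall>\<^sub>F n in sequentially. (\<Sum>i. M (i + n)) * C < e"
        using e by (simp add: order_tendsto_iff)
      then show "\<forall>\<^sub>F n in sequentially. \<forall>x\<in>UNIV. \<forall>h. norm (sum (\<lambda>i. T i (dd h f) x) {..<n} - ?S
          (dd h f) x) \<le> e * norm h"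
      proof eventually_elim
        case (elim n)
        have "\<bar>sum (\<lambda>i. T i (dd h f) x) {..<n} - ?S (dd h f) x\<bar> \<le> e * norm h" for h x
        proof -
          have "\<bar>sum (\<lambda>i. T i (dd h f) x) {..<n} - ?S (dd h f) x\<bar> \<le> (\<Sum>i. M (i + n)) * (C * norm h)"
            using bd[OF smooth_periodic_dd[OF f] C(2)] by (intro series_tail_bound(3)[OF _ M])
          also have "\<dots> \<le> e * norm h" using elim mult_right_mono[of "(\<Sum>i. M (i + n)) * C" e "norm h"]
            by (simp add: mult.assoc)
          finally show ?thesis .
        qed
        then show ?case by simp
      qed
    next
      show "(\<lambda>n. T n f 0) sums ?S f 0" using summ[OF f] by (rule summable_sums)
    qed auto
    then obtain g where g: "\<And>x. (\<lambda>n. T n f x) sums (g x)"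
        "\<And>x. (g has_derivative (\<lambda>v. ?S (dd v f) x)) (at x)" by auto
    have "g = ?S f" using g(1) by (auto simp: sums_iff)
    then show ?thesis using g(2) by simp
  qed
  have sm: "smooth (?S f)" if "smooth_periodic f" for f
  proof -
    have "Ck_on k UNIV (?S f)" for k
      using that
    proof (induction k arbitrary: f)
      case 0
      have "isCont (?S f) x" for x using has_derivative_continuous[OF der[OF 0]] .
      then show ?case by (simp add: continuous_at_imp_continuous_on)
    next
      case (Suc k)
      show ?case by (rule Ck_on_SucI[OF _ der[OF Suc.prems]])
          (auto intro!: Suc.IH smooth_periodic_dd Suc.prems)
    qed
    then show ?thesis by (simp add: smooth_on_def)
  qed
  show ?thesis
    unfolding smooth_operator_def
  proof (intro conjI allI impI)
    fix f :: "'a \<Rightarrow> real" assume f: "smooth_periodic f"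
    have "periodic (?S f)"
      using smooth_periodicD(2)[OF smooth_operatorD(1)[OF T f]] by (simp add: periodic_def)
    then show "smooth_periodic (?S f)" using sm[OF f] by (simp add: smooth_periodic_def)
    show "dd v (?S f) = ?S (dd v f)" for v by (rule ext) (rule dd_eqI[OF der[OF f]])
    fix B x assume "\<forall>x. \<bar>f x\<bar> \<le> B"
    then have "\<And>n. \<bar>T n f x\<bar> \<le> M n * B" using bd[OF f] by blast
    from series_tail_bound(2)[OF this M] show "\<bar>?S f x\<bar> \<le> suminf M * B" .
  next
    fix f g :: "'a \<Rightarrow> real" and c x assume f: "smooth_periodic f" "smooth_periodic g"
    show "?S (\<lambda>x. f x + c * g x) x = ?S f x + c * ?S g x"
      using smooth_operatorD(4)[OF T f] summ[OF f(1)] summ[OF f(2)]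
      by (simp add: suminf_add[symmetric] suminf_mult[symmetric] summable_mult)
  qed
qed

section \<open>Fourier inversion\<close>

text \<open>The Poisson kernel \<open>1 + 2 \<Sum> r\<^sup>n cos (2 \<pi> n s)\<close> of the disc.\<close>

definition poisson :: "real \<Rightarrow> real \<Rightarrow> real" where
  "poisson r s = (1 - r\<^sup>2) / (1 - 2 * r * cos (2 * pi * s) + r\<^sup>2)"

lemma poisson_denominator: "1 - 2 * r * cos t + r\<^sup>2 = (1 - r)\<^sup>2 + 2 * r * (1 - cos t)" for r t :: real
  by (simp add: power2_eq_square algebra_simps)

lemma poisson_denominator_pos:
  assumes "0 \<le> r" "r < 1"
  shows "1 - 2 * r * cos t + r\<^sup>2 > (0::real)"
proof -
  have "(1 - r)\<^sup>2 > 0" using assms by simp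
  moreover have "2 * r * (1 - cos t) \<ge> 0" using assms by (simp add: cos_le_one)
  ultimately show ?thesis unfolding poisson_denominator by (rule add_pos_nonneg)
qed

lemma poisson_sums:
  assumes r: "0 \<le> r" "r < 1"
  shows "(\<lambda>n. 2 * r ^ Suc n * cos (freq n * s)) sums (poisson r s - 1)"
proof -
  define t where "t = 2 * pi * s"
  define z where "z = of_real r * cis t"
  have nz: "norm z < 1" using r by (simp add: z_def norm_mult)
  then have z1: "z \<noteq> 1" by auto
  have "(\<lambda>n. z * z ^ n) sums (z * (1 / (1 - z)))"
    using geometric_sums[OF nz] by (rule sums_mult)
  then have "(\<lambda>n. Re (2 * z ^ Suc n)) sums Re (2 * (z * (1 / (1 - z))))"
    by (intro sums_Re sums_mult) simp
  moreover have "Re (2 * z ^ Suc n) = 2 * r ^ Suc n * cos (freq n * s)" for n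
  proof -
    have "z ^ Suc n = of_real (r ^ Suc n) * cis (real (Suc n) * t)"
      unfolding z_def power_mult_distrib Complex.DeMoivre by simp
    then have "2 * z ^ Suc n = of_real (2 * r ^ Suc n) * cis (real (Suc n) * t)" by simp
    then have "Re (2 * z ^ Suc n) = 2 * r ^ Suc n * cos (real (Suc n) * t)"
      by (simp only: times_complex.sel Re_complex_of_real Im_complex_of_real cis.sel mult_zero_left
          diff_zero)
    moreover have "real (Suc n) * t = freq n * s" by (simp add: t_def)
    ultimately show ?thesis by (simp only:)
  qed
  moreover have "Re (2 * (z * (1 / (1 - z)))) = poisson r s - 1"
  proof -
    have d: "(1 - r * cos t)\<^sup>2 + (r * sin t)\<^sup>2 = 1 - 2 * r * cos t + r\<^sup>2"
    proof -
      have "(1 - r * cos t)\<^sup>2 + (r * sin t)\<^sup>2 = 1 - 2 * r * cos t + r\<^sup>2 * ((sin t)\<^sup>2 + (cos t)\<^sup>2)"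
        by (simp add: power2_eq_square algebra_simps del: sin_cos_squared_add sin_cos_squared_add2
            sin_cos_squared_add3)
      then show ?thesis by (simp only: sin_cos_squared_add mult_1_right)
    qed
    have "Re (z / (1 - z)) = (r * cos t * (1 - r * cos t) - (r * sin t) * (r * sin t)) / ((1
        - r * cos t)\<^sup>2 + (r * sin t)\<^sup>2)"
      by (simp add: z_def Re_divide)
    also have "r * cos t * (1 - r * cos t) - (r * sin t) * (r * sin t) = r * cos t - r\<^sup>2"
    proof -
      have "r * cos t * (1 - r * cos t) - (r * sin t) * (r * sin t)
          = r * cos t - r\<^sup>2 * ((sin t)\<^sup>2 + (cos t)\<^sup>2)"
        by (simp add: power2_eq_square algebra_simps del: sin_cos_squared_add sin_cos_squared_add2
            sin_cos_squared_add3)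
      then show ?thesis by (simp only: sin_cos_squared_add mult_1_right)
    qed
    finally have "Re (z / (1 - z)) = (r * cos t - r\<^sup>2) / (1 - 2 * r * cos t + r\<^sup>2)" by (simp add: d)
    moreover have "poisson r s - 1 = 2 * ((r * cos t - r\<^sup>2) / (1 - 2 * r * cos t + r\<^sup>2))"
      using poisson_denominator_pos[OF r, of t] unfolding poisson_def t_def by (simp add: field_simps)
    moreover have "Re (2 * w) = 2 * Re w" for w by simp
    from this[of "z * (1 / (1 - z))"] have "Re (2 * (z * (1 / (1 - z)))) = 2 * Re (z / (1 - z))" by simp
    ultimately show ?thesis by (simp only:)
  qed
  ultimately show ?thesis by simp
qed

lemma poisson_nonneg: "0 \<le> r \<Longrightarrow> r < 1 \<Longrightarrow> poisson r s \<ge> 0"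
  unfolding poisson_def using poisson_denominator_pos[of r "2 * pi * s"]
  by (intro divide_nonneg_pos) (auto simp: power_le_one)

lemma poisson_continuous: "0 \<le> r \<Longrightarrow> r < 1 \<Longrightarrow> continuous_on S (poisson r)"
  unfolding poisson_def[abs_def] using poisson_denominator_pos[of r]
  by (intro continuous_intros) (auto simp: less_imp_neq[symmetric] dest: less_imp_neq)

text \<open>Since the kernel is nonnegative with integral \<open>1\<close>, this bound shows that its mass
  concentrates at the period as \<open>r\<close> tends to \<open>1\<close>: \<open>1 - cos (2 \<pi> s)\<close> vanishes only there.\<close>

lemma poisson_concentrates:
  assumes "0 < r" "r < 1"
  shows "poisson r s * (1 - cos (2 * pi * s)) \<le> (1 - r\<^sup>2) / (2 * r)"
proof -
  define t where "t = 2 * pi * s"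
  have p: "1 - 2 * r * cos t + r\<^sup>2 > 0" using poisson_denominator_pos[of r t] assms by simp
  have "2 * r * (1 - cos t) \<le> 1 - 2 * r * cos t + r\<^sup>2" unfolding poisson_denominator by simp
  then have "(1 - r\<^sup>2) * (2 * r * (1 - cos t)) \<le> (1 - r\<^sup>2) * (1 - 2 * r * cos t + r\<^sup>2)"
    using assms by (intro mult_left_mono) (auto simp: power_le_one)
  then show ?thesis unfolding poisson_def t_def[symmetric] using p assms by (simp add: field_simps)
qed

lemma integral_poisson:
  assumes r: "0 \<le> r" "r < 1" and h: "continuous_on {0..1} h"
  shows "(\<lambda>n. r ^ Suc n * integral {0..1} (\<lambda>s. 2 * cos (freq n * s) * h s)) sums
     (integral {0..1} (\<lambda>s. poisson r s * h s) - integral {0..1} h)"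
proof -
  obtain B where B: "\<And>s. s \<in> {0..1} \<Longrightarrow> \<bar>h s\<bar> \<le> B"
    using compact_imp_bounded[OF compact_continuous_image[OF h]] unfolding bounded_iff by fastforce
  let ?u = "\<lambda>n s. r ^ Suc n * (2 * cos (freq n * s) * h s)"
  have ul: "uniform_limit {0..1} (\<lambda>n s. \<Sum>i<n. ?u i s) (\<lambda>s. \<Sum>i. ?u i s) sequentially"
  proof (rule Weierstrass_m_test)
    show "norm (?u n s) \<le> r ^ n * (2 * B)" if "s \<in> {0..1}" for n s
    proof -
      have "norm (?u n s) = r ^ Suc n * (2 * \<bar>cos (freq n * s)\<bar> * \<bar>h s\<bar>)"
        using r by (simp add: abs_mult power_abs)
      also have "\<dots> \<le> r ^ n * (2 * 1 * B)"
        using r B[OF that] order.trans[OF abs_ge_zero B[OF that]] power_decreasing[of n "Suc n" r]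
        by (intro mult_mono) (auto simp: abs_cos_le_one)
      finally show ?thesis by simp
    qed
    show "summable (\<lambda>n. r ^ n * (2 * B))" using r by (intro summable_mult2 summable_geometric) auto
  qed
  have lim: "(\<Sum>i. ?u i s) = poisson r s * h s - h s" for s
    using sums_mult2[OF poisson_sums[OF r, of s], of "h s"]
    by (simp add: sums_iff mult.assoc mult.left_commute left_diff_distrib)
  have cu: "continuous_on {0..1} (?u i)" for i by (intro continuous_intros h)
  obtain I J where IJ: "\<And>n. ((\<lambda>s. \<Sum>i<n. ?u i s) has_integral I n) {0..1}"
    "((\<lambda>s. \<Sum>i. ?u i s) has_integral J) {0..1}" "I \<longlonglongrightarrow> J"
    using uniform_limit_integral[OF ul continuous_on_sum[OF cu] sequentially_bot] by blast
  have "I n = (\<Sum>i<n. r ^ Suc i * integral {0..1} (\<lambda>s. 2 * cos (2 * pi * real (Suc i) * s) * h s))" for n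
  proof -
    have "I n = integral {0..1} (\<lambda>s. \<Sum>i<n. ?u i s)" by (rule integral_unique[OF IJ(1)[of n], symmetric])
    also have "\<dots> = (\<Sum>i<n. integral {0..1} (?u i))"
      using cu integrable_continuous_real by (intro integral_sum) auto
    finally show ?thesis by simp
  qed
  moreover have "J = integral {0..1} (\<lambda>s. poisson r s * h s) - integral {0..1} h"
  proof -
    have "J = integral {0..1} (\<lambda>s. poisson r s * h s - h s)"
      using integral_unique[OF IJ(2)] by (simp only: lim)
    also have "\<dots> = integral {0..1} (\<lambda>s. poisson r s * h s) - integral {0..1} h"
      by (intro integral_diff integrable_continuous_real continuous_on_mult h poisson_continuous[OF r])
    finally show ?thesis .
  qed
  moreover from calculation(1)
  have "I = (\<lambda>n. \<Sum>i<n. r ^ Suc i * integral {0..1} (\<lambda>s. 2 * cos (2 * pi * real (Suc i) * s) * h s))"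
    by (rule ext)
  ultimately show ?thesis using IJ(3) unfolding sums_def by (simp only:)
qed

lemma integral_cos_period: "integral {0..1} (cosine n) = 0"
proof -
  define m where "m = freq n"
  have m: "m > 0" by (simp add: m_def)
  have c: "sin m = 0" unfolding m_def by (metis sin_int_2pin of_int_of_nat_eq)
  have "((\<lambda>s. 2 * cos (m * s)) has_integral (2 / m * sin (m * 1) - 2 / m * sin (m * 0))) {0..1}"
    using m by (intro fundamental_theorem_of_calculus)
      (auto simp: has_real_derivative_iff_has_vector_derivative[symmetric] intro!: derivative_eq_intros)
  from integral_unique[OF this] show ?thesis using c by (simp only: m_def) simp
qed

lemma integral_poisson_1:
  assumes r: "0 \<le> r" "r < 1"
  shows "integral {0..1} (poisson r) = 1"
proof -
  have "(\<lambda>n. 0) sums (integral {0..1} (poisson r) - 1)"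
    using integral_poisson[OF r, of "\<lambda>s. 1"] by (simp only: mult_1_right integral_cos_period) simp
  then show ?thesis by (simp add: sums_iff)
qed

lemma cos_away_from_period:
  assumes "0 \<le> d" "d \<le> s" "s \<le> 1 - d"
  shows "cos (2 * pi * s) \<le> cos (2 * pi * d)"
proof (cases "s \<le> 1/2")
  case True
  then show ?thesis using assms by (intro cos_monotone_0_pi_le) auto
next
  case False
  have "cos (2 * pi * s) = cos (2 * pi * (1 - s))" by (simp add: right_diff_distrib cos_diff)
  also have "\<dots> \<le> cos (2 * pi * d)" using assms False by (intro cos_monotone_0_pi_le) auto
  finally show ?thesis .
qed

text \<open>By continuity \<open>\<bar>g - g 0\<bar>\<close> is at most \<open>e + C (1 - cos (2 \<pi> s))\<close>, and the integral of the
  second term against the kernel is controlled by \<open>poisson_concentrates\<close>.\<close>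

lemma poisson_approximates:
  assumes g: "continuous_on {0..1} g" "g 0 = g 1" and e: "e > 0"
  obtains C where "C \<ge> 0" "\<And>r. 0 < r \<Longrightarrow> r < 1 \<Longrightarrow>
      \<bar>integral {0..1} (\<lambda>s. poisson r s * g s) - g 0\<bar> \<le> e + C * (1 - r\<^sup>2) / (2 * r)"
proof -
  obtain B where B: "\<And>s. s \<in> {0..1} \<Longrightarrow> \<bar>g s - g 0\<bar> \<le> B"
    using compact_imp_bounded[OF compact_continuous_image[OF continuous_on_diff[OF g(1)
        continuous_on_const]]]
    unfolding bounded_iff by fastforce
  have B0: "B \<ge> 0" using B[of 0] by simp
  obtain d0 where d0: "d0 > 0" "\<And>s. s \<in> {0..1} \<Longrightarrow> \<bar>s - 0\<bar> < d0 \<Longrightarrow> \<bar>g s - g 0\<bar> < e"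
    using g(1) e unfolding continuous_on_iff dist_real_def
      by (metis atLeastAtMost_iff order_refl zero_le_one)
  obtain d1 where d1: "d1 > 0" "\<And>s. s \<in> {0..1} \<Longrightarrow> \<bar>s - 1\<bar> < d1 \<Longrightarrow> \<bar>g s - g 1\<bar> < e"
    using g(1) e unfolding continuous_on_iff dist_real_def
      by (metis atLeastAtMost_iff order_refl zero_le_one)
  define d where "d = min (1/4) (min d0 d1)"
  have d: "0 < d" "d \<le> 1/4" "d \<le> d0" "d \<le> d1" using d0 d1 by (auto simp: d_def)
  have cd: "cos (2 * pi * d) < 1"
  proof -
    have "cos (2 * pi * d) < cos 0" using d by (intro cos_monotone_0_pi) auto
    then show ?thesis by simp
  qed
  define C where "C = B / (1 - cos (2 * pi * d))"
  have C0: "C \<ge> 0" using B0 cd by (simp add: C_def)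
  have pt: "\<bar>g s - g 0\<bar> \<le> e + C * (1 - cos (2 * pi * s))" if s: "s \<in> {0..1}" for s
  proof (cases "s < d \<or> s > 1 - d")
    case True
    then have "\<bar>g s - g 0\<bar> < e" using d0(2)[OF s] d1(2)[OF s] d s g(2) by auto
    moreover have "C * (1 - cos (2 * pi * s)) \<ge> 0" using C0 by simp
    ultimately show ?thesis by linarith
  next
    case False
    then have "cos (2 * pi * s) \<le> cos (2 * pi * d)" using d by (intro cos_away_from_period) auto
    then have "C * (1 - cos (2 * pi * d)) \<le> C * (1 - cos (2 * pi * s))" using C0
      by (intro mult_left_mono) auto
    moreover have "C * (1 - cos (2 * pi * d)) = B" using cd by (simp add: C_def)
    ultimately show ?thesis using B[OF s] e by linarith
  qed
  have "\<bar>integral {0..1} (\<lambda>s. poisson r s * g s) - g 0\<bar> \<le> e + C * (1 - r\<^sup>2) / (2 * r)" if r: "0 < r"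
      "r < 1" for r
  proof -
    have cp: "continuous_on {0..1} (poisson r)" using r by (intro poisson_continuous) auto
    have "integral {0..1} (\<lambda>s. poisson r s * g s) - g 0
        = integral {0..1} (\<lambda>s. poisson r s * g s) - integral {0..1} (\<lambda>s. poisson r s * g 0)"
      using integral_poisson_1[of r] r by simp
    also have "\<dots> = integral {0..1} (\<lambda>s. poisson r s * (g s - g 0))"
      unfolding right_diff_distrib by (subst integral_diff) (auto intro!: integrable_continuous_real
          continuous_intros cp g)
    finally have "\<bar>integral {0..1} (\<lambda>s. poisson r s * g s) - g 0\<bar>
        = norm (integral {0..1} (\<lambda>s. poisson r s * (g s - g 0)))"
      by simp
    also have "\<dots> \<le> integral {0..1} (\<lambda>s. poisson r s * e + C * (1 - r\<^sup>2) / (2 * r))"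
    proof (rule integral_norm_bound_integral)
      fix s :: real assume s: "s \<in> {0..1}"
      have p: "poisson r s \<ge> 0" using r by (intro poisson_nonneg) auto
      have "norm (poisson r s * (g s - g 0)) = poisson r s * \<bar>g s - g 0\<bar>" using p by (simp add: abs_mult)
      also have "\<dots> \<le> poisson r s * (e + C * (1 - cos (2 * pi * s)))" using p pt[OF s]
        by (intro mult_left_mono)
      also have "\<dots> = poisson r s * e + C * (poisson r s * (1 - cos (2 * pi * s)))"
        by (simp add: algebra_simps)
      also have "\<dots> \<le> poisson r s * e + C * ((1 - r\<^sup>2) / (2 * r))"
        using C0 poisson_concentrates[OF r, of s] by (intro add_left_mono mult_left_mono)
      finally show "norm (poisson r s * (g s - g 0)) \<le> poisson r s * e + C * (1 - r\<^sup>2) / (2 * r)" by simp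
    qed (auto intro!: integrable_continuous_real continuous_intros cp g)
    also have "\<dots> = e + C * (1 - r\<^sup>2) / (2 * r)"
      using integral_poisson_1[of r] r
      by (subst integral_add) (auto intro!: integrable_continuous_real continuous_intros cp)
    finally show ?thesis .
  qed
  then show ?thesis using that C0 by blast
qed

lemma poisson_limit:
  assumes g: "continuous_on {0..1} g" "g 0 = g 1"
  shows "((\<lambda>r. integral {0..1} (\<lambda>s. poisson r s * g s)) \<longlongrightarrow> g 0) (at_left 1)"
proof (rule tendstoI)
  fix e :: real assume e: "e > 0"
  obtain C where C: "C \<ge> 0" "\<And>r. 0 < r \<Longrightarrow> r < 1 \<Longrightarrow>
      \<bar>integral {0..1} (\<lambda>s. poisson r s * g s) - g 0\<bar> \<le> e / 2 + C * (1 - r\<^sup>2) / (2 * r)"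
    using poisson_approximates[OF g half_gt_zero[OF e]] by blast
  have "((\<lambda>r. e / 2 + C * (1 - r\<^sup>2) / (2 * r)) \<longlongrightarrow> e / 2 + C * (1 - 1\<^sup>2) / (2 * 1)) (at_left 1)"
    by (intro tendsto_intros) auto
  then have "\<forall>\<^sub>F r in at_left 1. e / 2 + C * (1 - r\<^sup>2) / (2 * r) < e"
    using e by (simp add: order_tendsto_iff)
  moreover have "\<forall>\<^sub>F r in at_left 1. r \<in> {0<..<1::real}"
    by (rule eventually_at_left_real) simp
  ultimately show "\<forall>\<^sub>F r in at_left 1. dist (integral {0..1} (\<lambda>s. poisson r s * g s)) (g 0) < e"
  proof eventually_elim
    case (elim r)
    then show ?case using C(2)[of r] by (simp add: dist_real_def)
  qed
qed

text \<open>Abel summation: for \<open>r < 1\<close> the weighted series is a Poisson integral, whose limit is known,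
  and absolute summability allows the limit \<open>r \<rightarrow> 1\<close> to be taken termwise. Cosines suffice because
  the series is evaluated at the base point only.\<close>

lemma fourier_inversion:
  assumes g: "continuous_on {0..1} g" "g 0 = g 1"
    and c: "\<And>n. c n = integral {0..1} (\<lambda>s. 2 * cos (freq n * s) * g s)"
    and summ: "summable (\<lambda>n. \<bar>c n\<bar>)"
  shows "c sums (g 0 - integral {0..1} g)"
proof -
  have ev: "\<forall>\<^sub>F r in at_left 1. r \<in> {0<..<1::real}"
    by (rule eventually_at_left_real) simp
  have "((\<lambda>r. \<Sum>n. r ^ Suc n * c n) \<longlongrightarrow> (\<Sum>n. 1 ^ Suc n * c n)) (at_left 1)"
  proof (rule tannerys_theorem[THEN conjunct2, THEN conjunct2])
    show "((\<lambda>r. r ^ Suc n * c n) \<longlongrightarrow> 1 ^ Suc n * c n) (at_left (1::real))" for n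
      by (intro tendsto_intros)
    show "\<forall>\<^sub>F (n, r) in at_top \<times>\<^sub>F at_left (1::real). norm (r ^ Suc n * c n) \<le> \<bar>c n\<bar>"
    proof -
      have "\<forall>\<^sub>F x in at_top \<times>\<^sub>F at_left (1::real). snd x \<in> {0<..<1} \<and> (fst x :: nat) \<ge> 0"
        by (rule eventually_mono[OF eventually_prodI[OF eventually_ge_at_top[of "0::nat"] ev]]) auto
      then show ?thesis
      proof (rule eventually_mono)
        fix x :: "nat \<times> real" assume "snd x \<in> {0<..<1} \<and> fst x \<ge> 0"
        then show "case x of (n, r) \<Rightarrow> norm (r ^ Suc n * c n) \<le> \<bar>c n\<bar>"
          by (cases x) (auto simp: abs_mult power_abs intro!: mult_left_le_one_le power_le_one
              mult_le_one)
      qed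
    qed
  qed (use summ in \<open>auto simp: trivial_limit_at_left_real\<close>)
  then have 1: "((\<lambda>r. \<Sum>n. r ^ Suc n * c n) \<longlongrightarrow> suminf c) (at_left 1)" by simp
  have 2: "((\<lambda>r. integral {0..1} (\<lambda>s. poisson r s * g s) - integral {0..1} g) \<longlongrightarrow> g 0
      - integral {0..1} g) (at_left 1)"
    by (intro tendsto_intros poisson_limit g)
  have "\<forall>\<^sub>F r in at_left 1. integral {0..1} (\<lambda>s. poisson r s * g s) - integral {0..1} g
      = (\<Sum>n. r ^ Suc n * c n)"
    using ev
  proof eventually_elim
    case (elim r)
    then show ?case using integral_poisson[of r g] g(1) by (simp add: sums_iff c)
  qed
  from tendsto_cong[OF this] 2 have "((\<lambda>r. \<Sum>n. r ^ Suc n * c n) \<longlongrightarrow> g 0 - integral {0..1} g)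
      (at_left 1)" by simp
  then have "suminf c = g 0 - integral {0..1} g"
    using 1 tendsto_unique trivial_limit_at_left_real by blast
  then show ?thesis using summable_sums[OF summable_rabs_cancel[OF summ]] by simp
qed

text \<open>Two integrations by parts give coefficients of order \<open>n\<^sup>-\<^sup>2\<close>, so the series converges
  absolutely.\<close>

lemma fourier_inversion_line:
  assumes f: "smooth_periodic f" and a: "a \<in> Basis"
  shows "(\<lambda>n. conv (cosine n) a f x) sums (f x - conv (\<lambda>s. 1) a f x)"
proof -
  let ?k = "\<lambda>n s. 2 * cos (freq n * s)"
  note f2 = smooth_periodic_dd[OF smooth_periodic_dd[OF f, of a], of a]
  obtain B where B: "B \<ge> 0" "\<And>x. \<bar>dd a (dd a f) x\<bar> \<le> B"
    using periodic_bounded smooth_periodicD[OF f2] by metis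
  have bd: "\<bar>conv (?k n) a f x\<bar> \<le> 1 / (real (Suc n))\<^sup>2 * (2 * B)" for n
  proof -
    have ck: "continuous_on UNIV (?k n)" by (intro continuous_intros)
    define m where "m = freq n"
    have m: "m \<ge> real (Suc n)" using pi_gt3 by (simp add: m_def)
    have "m\<^sup>2 * \<bar>conv (?k n) a f x\<bar> = \<bar>conv (?k n) a (dd a (dd a f)) x\<bar>"
      by (simp only: conv_cos[OF f a] m_def abs_mult abs_minus_cancel) simp
    also have "\<dots> \<le> integral {0..1} (\<lambda>s. \<bar>?k n s\<bar>) * B"
      using B(2) by (intro conv_bound ck smooth_periodicD(3)[OF f2])
    also have "integral {0..1} (\<lambda>s. \<bar>?k n s\<bar>) \<le> integral {0..1} (\<lambda>s::real. 2::real)"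
      by (rule integral_le) (auto simp: abs_mult intro!: integrable_continuous_real continuous_intros)
    then have "integral {0..1} (\<lambda>s. \<bar>?k n s\<bar>) * B \<le> 2 * B" using B(1) by (intro mult_right_mono) auto
    finally have 1: "m\<^sup>2 * \<bar>conv (?k n) a f x\<bar> \<le> 2 * B" .
    have "(real (Suc n))\<^sup>2 * \<bar>conv (?k n) a f x\<bar> \<le> m\<^sup>2 * \<bar>conv (?k n) a f x\<bar>"
      using m by (intro mult_right_mono power_mono) auto
    with 1 have "(real (Suc n))\<^sup>2 * \<bar>conv (?k n) a f x\<bar> \<le> 2 * B" by linarith
    then show ?thesis by (simp add: field_simps)
  qed
  have "summable (\<lambda>n. \<bar>conv (?k n) a f x\<bar>)"
  proof (rule summable_comparison_test)
    show "summable (\<lambda>n. 1 / (real (Suc n))\<^sup>2 * (2 * B))"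
      using inverse_squares_sums by (intro summable_mult2) (auto simp: sums_iff add.commute)
  qed (use bd in auto)
  then show ?thesis
    using fourier_inversion[of "\<lambda>s. f (x + s *\<^sub>R a)" "\<lambda>n. conv (?k n) a f x"] smooth_periodicD[OF f] a
    by (simp add: conv_def continuous_on_line periodic_def)
qed

section \<open>The Laplacian on a two-dimensional subtorus\<close>

definition mean2 :: "'a::euclidean_space \<Rightarrow> 'a \<Rightarrow> ('a \<Rightarrow> real) \<Rightarrow> 'a \<Rightarrow> real" where
  "mean2 a b f = conv (\<lambda>s. 1) b (conv (\<lambda>s. 1) a f)"

text \<open>On the mode of frequency \<open>m\<close> in direction \<open>a\<close> the Laplacian \<open>dd a (dd a f) + dd b (dd b f)\<close>
  is \<open>dd b (dd b f) - m\<^sup>2 f\<close>, which \<open>- green m\<close> inverts; the zero mode is inverted by \<open>- green0\<close>.\<close>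

definition laplace_inv :: "'a::euclidean_space \<Rightarrow> 'a \<Rightarrow> ('a \<Rightarrow> real) \<Rightarrow> 'a \<Rightarrow> real" where
  "laplace_inv a b f x =
     - conv green0 b (conv (\<lambda>s. 1) a f) x +
     - 1 * (\<Sum>n. conv (green (freq n)) b (conv (cosine n) a f) x)"

lemma smooth_operator_mean2: "\<exists>M. smooth_operator M (mean2 a b)"
proof -
  have "continuous_on UNIV (\<lambda>s::real. 1::real)" by simp
  from smooth_operator_comp[OF smooth_operator_conv[OF this] smooth_operator_conv[OF this]]
  show ?thesis unfolding mean2_def[abs_def] by blast
qed

lemma smooth_operator_laplace_term:
  "smooth_operator (1 / (freq n)\<^sup>2 * integral {0..1} (\<lambda>s. \<bar>2 * cos (freq n * s)\<bar>))
     (\<lambda>f. conv (green (freq n)) b (conv (cosine n) a f))"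
proof -
  have m: "freq n > 0" by simp
  have "(\<lambda>s. \<bar>green (freq n) s\<bar>) = green (freq n)"
    using green_facts(5)[OF m] by (auto simp: abs_of_pos)
  then have g: "smooth_operator (1 / (freq n)\<^sup>2) (conv (green (freq n)) b)"
    using smooth_operator_conv[OF green_facts(6)[OF m], of b] green_facts(7)[OF m] by simp
  have "continuous_on UNIV (\<lambda>s::real. 2 * cos (freq n * s))" by (intro continuous_intros)
  from smooth_operator_comp[OF g smooth_operator_conv[OF this]] show ?thesis .
qed

text \<open>The integral of \<open>green m\<close> is \<open>1/m\<^sup>2\<close>: the series converges without any decay of the Fourier
  coefficients.\<close>

lemma laplace_term_summable:
  "summable (\<lambda>n. 1 / (freq n)\<^sup>2 * integral {0..1} (\<lambda>s. \<bar>2 * cos (freq n * s)\<bar>))"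
proof (rule summable_comparison_test)
  show "summable (\<lambda>n. 1 / (real (Suc n))\<^sup>2 * 2)"
    using inverse_squares_sums by (intro summable_mult2) (auto simp: sums_iff add.commute)
  have "norm (1 / (freq n)\<^sup>2 * integral {0..1} (\<lambda>s. \<bar>2 * cos (freq n * s)\<bar>))
      \<le> 1 / (real (Suc n))\<^sup>2 * 2" for n
  proof -
    have 1: "integral {0..1} (\<lambda>s. \<bar>2 * cos (freq n * s)\<bar>) \<le> integral {0..1} (\<lambda>s::real. 2::real)"
      by (rule integral_le) (auto simp: abs_mult intro!: integrable_continuous_real continuous_intros)
    have 2: "0 \<le> integral {0..1} (\<lambda>s. \<bar>2 * cos (freq n * s)\<bar>)"
      by (intro integral_nonneg integrable_continuous_real continuous_intros) auto
    have "real (Suc n) \<le> freq n" using pi_gt3 by simp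
    then have 3: "1 / (freq n)\<^sup>2 \<le> 1 / (real (Suc n))\<^sup>2"
      by (intro divide_left_mono power_mono) auto
    have "1 / (freq n)\<^sup>2 * integral {0..1} (\<lambda>s. \<bar>2 * cos (freq n * s)\<bar>)
       \<le> 1 / (real (Suc n))\<^sup>2 * 2" using 1 2 3 by (intro mult_mono) auto
    moreover have "0 \<le> 1 / (freq n)\<^sup>2 * integral {0..1} (\<lambda>s. \<bar>2 * cos (freq n * s)\<bar>)"
      using 2 by simp
    ultimately show ?thesis by simp
  qed
  then show "\<exists>N. \<forall>n\<ge>N. norm (1 / (freq n)\<^sup>2 * integral {0..1} (\<lambda>s. \<bar>2 * cos (freq n * s)\<bar>))
      \<le> 1 / (real (Suc n))\<^sup>2 * 2" by blast
qed

lemma smooth_operator_laplace_inv: "\<exists>M. smooth_operator M (laplace_inv a b)"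
proof -
  have z: "smooth_operator 0 (\<lambda>f x. 0)" by (simp add: smooth_operator_def smooth_periodic_const)
  have k: "continuous_on UNIV (\<lambda>s::real. 1::real)" by simp
  have "\<exists>M. smooth_operator M (\<lambda>f x. (0 + - 1 * conv green0 b (conv (\<lambda>s. 1) a f) x) +
     - 1 * (\<Sum>n. conv (green (freq n)) b (conv (cosine n) a f) x))"
    by (rule exI, rule smooth_operator_lincomb[OF smooth_operator_lincomb[OF z
        smooth_operator_comp[OF smooth_operator_conv[OF continuous_green0] smooth_operator_conv[OF k]]]
        smooth_operator_series[OF smooth_operator_laplace_term laplace_term_summable]])
  then show ?thesis by (simp add: laplace_inv_def[abs_def])
qed

lemma laplace_inv:
  assumes f: "smooth_periodic f" and a: "a \<in> Basis" and b: "b \<in> Basis"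
  shows "laplace_inv a b (dd a (dd a f)) x + laplace_inv a b (dd b (dd b f)) x = f x - mean2 a b f x"
proof -
  let ?k = "\<lambda>n s. 2 * cos (freq n * s)"
  let ?m = "\<lambda>n. freq n"
  let ?T = "\<lambda>n f. conv (green (?m n)) b (conv (?k n) a f)"
  have ck: "continuous_on UNIV (?k n)" for n by (intro continuous_intros)
  have c1: "continuous_on UNIV (\<lambda>s::real. 1::real)" by simp
  note fa = smooth_periodic_dd[OF smooth_periodic_dd[OF f, of a], of a]
  note fb = smooth_periodic_dd[OF smooth_periodic_dd[OF f, of b], of b]
  have tm: "?T n (dd a (dd a f)) x + ?T n (dd b (dd b f)) x = - conv (?k n) a f x" for n
  proof -
    define m where "m = ?m n"
    define k where "k = ?k n"
    have m: "m > 0" by (simp add: m_def)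
    have ckk: "continuous_on UNIV k" using ck by (simp add: k_def)
    have g: "smooth_periodic (conv k a f)" using f ckk by (rule smooth_periodic_conv)
    have "conv k a (dd a (dd a f)) = (\<lambda>x. - m\<^sup>2 * conv k a f x)"
      unfolding k_def m_def using conv_cos[OF f a] by blast
    then have 1: "conv (green m) b (conv k a (dd a (dd a f))) x
        = - m\<^sup>2 * conv (green m) b (conv k a f) x"
      by (simp only: conv_cmult)
    have "conv k a (dd b (dd b f)) = dd b (dd b (conv k a f))"
      using smooth_periodicD(1)[OF f] ckk by (simp add: dd_conv smooth_on_dd)
    then have 2: "conv (green m) b (conv k a (dd b (dd b f))) x
        = m\<^sup>2 * conv (green m) b (conv k a f) x - conv k a f x"
      using conv_green[OF g b m] by simp
    show ?thesis using 1 2 unfolding m_def k_def by simp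
  qed
  have summ: "summable (\<lambda>n. ?T n h x)" if h: "smooth_periodic h" for h
  proof -
    obtain B where B: "\<And>x. \<bar>h x\<bar> \<le> B" using periodic_bounded smooth_periodicD[OF h] by metis
    show ?thesis
      by (rule series_tail_bound(1)[OF smooth_operatorD(3)[OF smooth_operator_laplace_term h B]
          laplace_term_summable])
  qed
  have "(\<Sum>n. ?T n (dd a (dd a f)) x) + (\<Sum>n. ?T n (dd b (dd b f)) x) = (\<Sum>n. - conv (?k n) a f x)"
    using suminf_add[OF summ[OF fa] summ[OF fb]] by (simp only: tm)
  also have "\<dots> = - (f x - conv (\<lambda>s. 1) a f x)"
    using sums_minus[OF fourier_inversion_line[OF f a, of x]] by (simp add: sums_iff)
  finally have S: "(\<Sum>n. ?T n (dd a (dd a f)) x) + (\<Sum>n. ?T n (dd b (dd b f)) x)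
      = - (f x - conv (\<lambda>s. 1) a f x)" .
  have "conv (\<lambda>s. 1) a (dd a (dd a f)) = (\<lambda>x. 0)"
    using conv_mean_dd[OF smooth_periodic_dd[OF f] a] by blast
  then have Z1: "conv green0 b (conv (\<lambda>s. 1) a (dd a (dd a f))) x = 0" by (simp add: conv_def)
  have "conv (\<lambda>s. 1) a (dd b (dd b f)) = dd b (dd b (conv (\<lambda>s. 1) a f))"
    using smooth_periodicD(1)[OF f] by (simp add: dd_conv smooth_on_dd)
  then have Z2: "conv green0 b (conv (\<lambda>s. 1) a (dd b (dd b f))) x = mean2 a b f x - conv (\<lambda>s. 1) a f x"
    using conv_green0[OF smooth_periodic_conv[OF f c1] b] by (simp add: mean2_def)
  show ?thesis using S Z1 Z2 unfolding laplace_inv_def by simp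
qed

lemma mean2_dd:
  assumes f: "smooth_periodic f" and ab: "a \<in> Basis" "b \<in> Basis"
  shows "mean2 a b (dd a f) x = 0" "mean2 a b (dd b f) x = 0"
proof -
  have "conv (\<lambda>s. 1) a (dd a f) = (\<lambda>x. 0)" using conv_mean_dd[OF f ab(1)] by blast
  then show "mean2 a b (dd a f) x = 0" by (simp add: mean2_def conv_def)
  have "conv (\<lambda>s. 1) a (dd b f) = dd b (conv (\<lambda>s. 1) a f)" using smooth_periodicD(1)[OF f]
    by (simp add: dd_conv)
  then show "mean2 a b (dd b f) x = 0"
    using conv_mean_dd[OF smooth_periodic_conv[OF f] ab(2)] by (simp add: mean2_def)
qed

section \<open>A periodic equation with attractive singularity\<close>

lemma smooth_real_derivative:
  fixes f :: "real \<Rightarrow> real"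
  assumes "smooth f"
  shows "(f has_real_derivative dd 1 f x) (at x)"
  using dd_line[OF assms, of 0 x 1 UNIV] by (simp add: has_real_derivative_iff_has_vector_derivative)

lemma dd_real_eqI:
  fixes f :: "real \<Rightarrow> real"
  assumes "(f has_real_derivative d) (at x)"
  shows "dd v f x = d * v"
  by (rule dd_eqI) (use assms in \<open>simp add: has_field_derivative_def\<close>)

lemma smooth_real_antiderivative:
  fixes f :: "real \<Rightarrow> real"
  assumes "\<And>x. (F has_real_derivative f x) (at x)" "smooth f"
  shows "smooth F"
  by (rule smooth_onI[where f'="\<lambda>x v. f x * v"])
    (use assms in \<open>auto simp: has_field_derivative_def intro!: smooth_intros\<close>)

lemma smooth_on_divide:
  fixes f g :: "'a::euclidean_space \<Rightarrow> real"
  assumes "open S" "smooth_on S f" "smooth_on S g" "\<And>x. x \<in> S \<Longrightarrow> g x > 0"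
  shows "smooth_on S (\<lambda>x. f x / g x)"
proof -
  have "smooth_on S (\<lambda>x. inverse (g x))"
    using assms by (intro smooth_on_compose[OF smooth_on_inverse]) auto
  from smooth_on_mult[OF assms(1,2) this] show ?thesis by (simp add: divide_inverse)
qed

lemma continuous_antiderivative:
  fixes f :: "real \<Rightarrow> real"
  assumes "continuous_on UNIV f"
  obtains F where "\<And>x. (F has_real_derivative f x) (at x)"
proof -
  define F where "F x = (if 0 \<le> x then integral {0..x} f else - integral {x..0} f)" for x
  have "(F has_real_derivative f x) (at x)" for x
  proof -
    define R where "R = \<bar>x\<bar> + 1"
    have int: "f integrable_on {a..b}" for a b
      using assms by (intro integrable_continuous_real) (auto intro: continuous_on_subset)
    have F: "F y = integral {-R..y} f - integral {-R..0} f" if "y \<in> {-R<..<R}" for y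
    proof (cases "0 \<le> y")
      case True
      have "integral {-R..0} f + integral {0..y} f = integral {-R..y} f"
        using True that by (intro Henstock_Kurzweil_Integration.integral_combine int) (auto simp: R_def)
      then show ?thesis using True by (simp add: F_def)
    next
      case False
      have "integral {-R..y} f + integral {y..0} f = integral {-R..0} f"
        using False that by (intro Henstock_Kurzweil_Integration.integral_combine int) auto
      then show ?thesis using False by (simp add: F_def)
    qed
    have "((\<lambda>y. integral {-R..y} f) has_real_derivative f x) (at x within {-R..R})"
      using assms by (intro integral_has_real_derivative) (auto intro: continuous_on_subset simp: R_def)
    moreover have "x \<in> interior {-R..R}" by (auto simp: R_def)
    ultimately have "((\<lambda>y. integral {-R..y} f) has_real_derivative f x) (at x)"
      by (metis at_within_interior)
    then have "((\<lambda>y. integral {-R..y} f - integral {-R..0} f) has_real_derivative f x) (at x)"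
      by (auto intro!: derivative_eq_intros)
    then show ?thesis
      by (rule has_field_derivative_transform_within_open[of _ _ _ "{-R<..<R}"]) (auto simp: F R_def)
  qed
  then show ?thesis using that by blast
qed

text \<open>The fixed point found below is a priori only continuous, so derivatives cannot be moved to
  \<open>g\<close>. The exponentials in the kernel separate: with antiderivatives \<open>E\<close> and \<open>H\<close> of
  \<open>exp (m t) g t\<close> and \<open>exp (- m t) g t\<close> the convolution becomes an explicit combination of
  differences over one period.\<close>

lemma green_operator_ode:
  fixes g :: "real \<Rightarrow> real"
  assumes g: "continuous_on UNIV g" "periodic g" and m: "m > 0"
  obtains p' where "\<And>x. (conv (green m) 1 g has_real_derivative p' x) (at x)"
    "\<And>x. (p' has_real_derivative (m\<^sup>2 * conv (green m) 1 g x - g x)) (at x)"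
proof -
  have g1: "g (x + 1) = g x" for x using g(2) by (simp add: periodic_def)
  obtain E where E: "\<And>t. (E has_real_derivative exp (m * t) * g t) (at t)"
    by (rule continuous_antiderivative[of "\<lambda>t. exp (m * t) * g t"])
        (intro continuous_intros g(1), rule that)
  obtain H where H: "\<And>t. (H has_real_derivative exp (- m * t) * g t) (at t)"
    by (rule continuous_antiderivative[of "\<lambda>t. exp (- m * t) * g t"])
        (intro continuous_intros g(1), rule that)
  define S where "S = sinh (m / 2)"
  have S: "S > 0" "S = (exp (m / 2) - exp (- m / 2)) / 2" using m
    by (auto simp: S_def sinh_real_pos_iff sinh_field_def)
  define C where "C = 1 / (4 * m * S)"
  define U where "U x = exp (- m * (x + 1/2)) * (E (x + 1) - E x)" for x
  define V where "V x = exp (m * (x + 1/2)) * (H (x + 1) - H x)" for x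
  have green: "green m s = C * (exp (m * (s - 1/2)) + exp (- m * (s - 1/2)))" for s
    using S(1) m by (simp add: green_def C_def S_def cosh_field_def field_simps)
  have p: "conv (green m) 1 g x = C * (U x + V x)" for x
  proof -
    define W where "W s = C * (exp (- m * (x + 1/2)) * E (x + s) + exp (m * (x + 1/2)) * H (x + s))"
        for s
    have "((\<lambda>s. green m s * g (x + s)) has_integral (W 1 - W 0)) {0..1}"
    proof (rule fundamental_theorem_of_calculus)
      fix s :: real
      have e1: "exp (m * (s - 1/2)) = exp (- m * (x + 1/2)) * exp (m * (x + s))"
        unfolding exp_add[symmetric] by (simp add: algebra_simps)
      have e2: "exp (- m * (s - 1/2)) = exp (m * (x + 1/2)) * exp (- m * (x + s))"
        unfolding exp_add[symmetric] by (simp add: algebra_simps)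
      have "((\<lambda>s. E (x + s)) has_real_derivative exp (m * (x + s)) * g (x + s)) (at s)"
        using E[of "x + s"] by (simp add: DERIV_shift add.commute)
      moreover have "((\<lambda>s. H (x + s)) has_real_derivative exp (- m * (x + s)) * g (x + s)) (at s)"
        using H[of "x + s"] by (simp add: DERIV_shift add.commute)
      ultimately have "(W has_real_derivative C * (exp (- m * (x + 1/2)) * (exp (m * (x + s)) * g (x
          + s))
          + exp (m * (x + 1/2)) * (exp (- m * (x + s)) * g (x + s)))) (at s)"
        unfolding W_def by (intro DERIV_cmult DERIV_add)
      also have "C * (exp (- m * (x + 1/2)) * (exp (m * (x + s)) * g (x + s))
          + exp (m * (x + 1/2)) * (exp (- m * (x + s)) * g (x + s))) = green m s * g (x + s)"
        unfolding green e1 e2 by (simp only: distrib_left distrib_right mult.assoc)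
      finally show "(W has_vector_derivative green m s * g (x + s)) (at s within {0..1})"
        by (simp add: has_real_derivative_iff_has_vector_derivative has_vector_derivative_at_within)
    qed simp
    then show ?thesis by (simp add: conv_def integral_unique W_def U_def V_def right_diff_distrib
        algebra_simps)
  qed
  have dU: "(U has_real_derivative (- m * U x + 2 * S * g x)) (at x)" for x
  proof -
    have 1: "((\<lambda>x. E (x + 1) - E x) has_real_derivative exp (m * (x + 1)) * g (x + 1) - exp
        (m * x) * g x) (at x)"
      using E[of "x + 1"] E[of x] by (intro DERIV_diff) (simp_all add: DERIV_shift)
    have 2: "((\<lambda>x. exp (- m * (x + 1/2))) has_real_derivative - m * exp (- m * (x + 1/2))) (at x)"
      by (auto intro!: derivative_eq_intros)
    have "exp (- m * (x + 1/2)) * exp (m * (x + 1)) = exp (m / 2)"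
        "exp (- m * (x + 1/2)) * exp (m * x) = exp (- m / 2)"
      unfolding exp_add[symmetric] by (simp_all add: field_simps)
    then have "exp (- m * (x + 1/2)) * (exp (m * (x + 1)) * g (x + 1) - exp (m * x) * g x) = 2 * S * g x"
      by (simp only: right_diff_distrib mult.assoc[symmetric] g1 S(2)) (simp add: left_diff_distrib)
    then have 3: "- m * exp (- m * (x + 1/2)) * (E (x + 1) - E x)
        + (exp (m * (x + 1)) * g (x + 1) - exp (m * x) * g x) * exp (- m * (x + 1/2))
            = - m * U x + 2 * S * g x"
      unfolding U_def by algebra
    show ?thesis using DERIV_mult[OF 2 1] unfolding 3 U_def[abs_def, symmetric] .
  qed
  have dV: "(V has_real_derivative (m * V x - 2 * S * g x)) (at x)" for x
  proof -
    have 1: "((\<lambda>x. H (x + 1) - H x) has_real_derivative exp (- m * (x + 1)) * g (x + 1) - exp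
        (- m * x) * g x) (at x)"
      using H[of "x + 1"] H[of x] by (intro DERIV_diff) (simp_all add: DERIV_shift)
    have 2: "((\<lambda>x. exp (m * (x + 1/2))) has_real_derivative m * exp (m * (x + 1/2))) (at x)"
      by (auto intro!: derivative_eq_intros)
    have "exp (m * (x + 1/2)) * exp (- m * (x + 1)) = exp (- m / 2)"
        "exp (m * (x + 1/2)) * exp (- m * x) = exp (m / 2)"
      unfolding exp_add[symmetric] by (simp_all add: field_simps)
    then have "exp (m * (x + 1/2)) * (exp (- m * (x + 1)) * g (x + 1) - exp (- m * x) * g x)
        = - 2 * S * g x"
      by (simp only: right_diff_distrib mult.assoc[symmetric] g1 S(2)) (simp add: left_diff_distrib)
    then have 3: "m * exp (m * (x + 1/2)) * (H (x + 1) - H x)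
        + (exp (- m * (x + 1)) * g (x + 1) - exp (- m * x) * g x) * exp (m * (x + 1/2))
            = m * V x - 2 * S * g x"
      unfolding V_def by algebra
    show ?thesis using DERIV_mult[OF 2 1] unfolding 3 V_def[abs_def, symmetric] .
  qed
  define p' where "p' x = C * m * (V x - U x)" for x
  have "(conv (green m) 1 g has_real_derivative p' x) (at x)" for x
    unfolding p[abs_def] p'_def using dU[of x] dV[of x]
    by (auto intro!: derivative_eq_intros simp: algebra_simps)
  moreover have "(p' has_real_derivative (m\<^sup>2 * conv (green m) 1 g x - g x)) (at x)" for x
  proof -
    have c: "C * m * (4 * S) = 1" using S(1) m by (simp add: C_def)
    have "(p' has_real_derivative C * m * ((m * V x - 2 * S * g x) - (- m * U x + 2 * S * g x))) (at x)"
      unfolding p'_def using dU[of x] dV[of x] by (intro DERIV_cmult DERIV_diff)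
    also have "C * m * ((m * V x - 2 * S * g x) - (- m * U x + 2 * S * g x))
        = m\<^sup>2 * (C * (U x + V x)) - (C * m * (4 * S)) * g x"
      by (simp add: power2_eq_square algebra_simps)
    finally show ?thesis by (simp add: p c)
  qed
  ultimately show ?thesis using that by blast
qed

lemma conv_green0_ode:
  fixes B :: "real \<Rightarrow> real"
  assumes B: "smooth_periodic B"
  shows "smooth_periodic (conv green0 1 B)"
    "dd 1 (dd 1 (conv green0 1 B)) x = integral {0..1} B - B x"
proof -
  show "smooth_periodic (conv green0 1 B)" using B continuous_green0 by (rule smooth_periodic_conv)
  have "dd 1 (dd 1 (conv green0 1 B)) = conv green0 1 (dd 1 (dd 1 B))"
    using smooth_periodicD(1)[OF B] by (simp add: dd_conv continuous_green0 smooth_on_dd)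
  then have "dd 1 (dd 1 (conv green0 1 B)) x = conv (\<lambda>s. 1) 1 B x - B x" using conv_green0[OF B] by simp
  also have "conv (\<lambda>s. 1) 1 B x = conv (\<lambda>s. 1) 1 B 0"
  proof -
    have "(conv (\<lambda>s. 1) 1 B has_real_derivative 0) (at y)" for y
      using smooth_real_derivative[OF smooth_periodicD(1)[OF smooth_periodic_conv[OF B, of "\<lambda>s. 1"
          1]], of y]
        conv_mean_dd[OF B, of 1 y] smooth_periodicD(1)[OF B] by (simp add: dd_conv)
    then show ?thesis by (intro DERIV_isconst_all) auto
  qed
  also have "\<dots> = integral {0..1} B" by (simp add: conv_def)
  finally show "dd 1 (dd 1 (conv green0 1 B)) x = integral {0..1} B - B x" .
qed

text \<open>The mean over a period does not depend on the base point: both sides are read off from the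
  second derivative of \<open>conv green0 1 B\<close>.\<close>

lemma integral_shift_periodic:
  fixes B :: "real \<Rightarrow> real"
  assumes B: "smooth_periodic B"
  shows "integral {0..1} (\<lambda>s. B (x + s)) = integral {0..1} B"
proof -
  have "dd 1 (dd 1 (conv green0 1 B)) x = conv green0 1 (dd 1 (dd 1 B)) x"
    using smooth_periodicD(1)[OF B] by (simp add: dd_conv continuous_green0 smooth_on_dd)
  also have "\<dots> = conv (\<lambda>s. 1) 1 B x - B x" using conv_green0[OF B] by simp
  finally show ?thesis using conv_green0_ode(2)[OF B, of x] by (simp add: conv_def)
qed

text \<open>The slope \<open>k / a\<^sup>2\<close> is the largest that \<open>s \<mapsto> - k / s\<close> takes to the right of \<open>a\<close>. Adding it
  makes the nonlinearity increasing on \<open>[a, b]\<close>, with a Lipschitz constant strictly below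
  \<open>k / a\<^sup>2\<close>.\<close>

lemma monotone_nonlinearity:
  fixes a b k s t :: real
  assumes "0 < a" "a \<le> s" "s \<le> t" "t \<le> b" "k > 0"
  defines "N \<equiv> \<lambda>s. (k / a\<^sup>2) * s + k / s"
  shows "N s \<le> N t" "N t - N s \<le> (k / a\<^sup>2 - k / b\<^sup>2) * (t - s)"
proof -
  have st: "s > 0" "t > 0" "b > 0" using assms by auto
  have e: "N t - N s = (t - s) * (k / a\<^sup>2 - k / (s * t))"
  proof -
    have "k / s - k / t = k / (s * t) * (t - s)" using st by (simp add: field_simps)
    moreover have "N t - N s = k / a\<^sup>2 * (t - s) - (k / s - k / t)"
      by (simp add: N_def algebra_simps diff_divide_distrib)
    ultimately show ?thesis by (simp add: algebra_simps)
  qed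
  have "a * a \<le> s * t" using assms st by (intro mult_mono) auto
  then have 1: "k / (s * t) \<le> k / a\<^sup>2" using assms st
    by (intro divide_left_mono) (auto simp: power2_eq_square)
  have "s * t \<le> b * b" using assms st by (intro mult_mono) auto
  then have 2: "k / b\<^sup>2 \<le> k / (s * t)" using assms st
    by (intro divide_left_mono) (auto simp: power2_eq_square)
  have "N t - N s \<ge> 0" unfolding e using 1 assms by simp
  then show "N s \<le> N t" by simp
  show "N t - N s \<le> (k / a\<^sup>2 - k / b\<^sup>2) * (t - s)"
    unfolding e using 2 assms by (simp add: mult.commute mult_left_mono)
qed

lemma lipschitz_nonlinearity:
  fixes a b k s t :: real
  assumes "0 < a" "a \<le> s" "s \<le> b" "a \<le> t" "t \<le> b" "k > 0"
  shows "\<bar>((k / a\<^sup>2) * s + k / s) - ((k / a\<^sup>2) * t + k / t)\<bar> \<le> (k / a\<^sup>2 - k / b\<^sup>2) * \<bar>s - t\<bar>"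
proof (cases "s \<le> t")
  case True
  from monotone_nonlinearity[OF assms(1,2) True assms(5,6)] True show ?thesis
    by (simp only: abs_minus_commute[of s t] abs_minus_commute[of "k / a\<^sup>2 * s
        + k / s"] abs_of_nonneg diff_ge_0_iff_ge)
next
  case False
  then have "t \<le> s" by simp
  from monotone_nonlinearity[OF assms(1,4) this assms(3,6)] this show ?thesis
    by (simp only: abs_of_nonneg diff_ge_0_iff_ge)
qed

text \<open>The operator \<open>T f = conv (green m) 1 (m\<^sup>2 f + k / f - B)\<close> is increasing, maps the functions
  between \<open>a\<close> and \<open>\<beta>\<close> to themselves because \<open>a\<close> is a subsolution and \<open>\<beta>\<close> a supersolution, and is a
  contraction: the integral of the kernel is \<open>1 / m\<^sup>2\<close>, while the Lipschitz constant of the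
  nonlinearity is smaller than \<open>m\<^sup>2\<close>.\<close>

lemma singular_fixed_point:
  fixes B \<beta> :: "real \<Rightarrow> real"
  assumes B: "continuous_on UNIV B" "periodic B" and \<beta>: "continuous_on UNIV \<beta>" "periodic \<beta>"
    and k: "k > 0" and a: "a > 0" and ab: "\<And>x. a \<le> \<beta> x" "\<And>x. \<beta> x \<le> b"
    and m: "m > 0" "m\<^sup>2 = k / a\<^sup>2"
    and sub: "\<And>x. B x \<le> k / a"
    and super: "\<And>x. conv (green m) 1 (\<lambda>x. m\<^sup>2 * \<beta> x + k / \<beta> x - B x) x \<le> \<beta> x"
  obtains p where "continuous_on UNIV p" "periodic p" "\<And>x. a \<le> p x"
    "\<And>x. p x = conv (green m) 1 (\<lambda>x. m\<^sup>2 * p x + k / p x - B x) x"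
proof -
  define N where "N f x = m\<^sup>2 * f x + k / f x - B x" for f :: "real \<Rightarrow> real" and x
  define adm where "adm f \<longleftrightarrow> continuous_on UNIV f \<and> periodic f \<and> (\<forall>x. a \<le> f x \<and> f x \<le> \<beta> x)"
      for f :: "real \<Rightarrow> real"
  have b: "a \<le> b" using ab[of 0] by linarith
  have N_cont: "continuous_on UNIV (N f)" if "adm f" for f
    unfolding N_def using that a B by (auto simp: adm_def intro!: continuous_intros) (metis not_less)
  have N_per: "periodic (N f)" if "adm f" for f
    using that B(2) by (simp add: adm_def periodic_def N_def)
  have cg: "continuous_on UNIV (green m)" "\<And>s. green m s \<ge> 0" "integral {0..1} (green m) = 1 / m\<^sup>2"
    using green_facts(5,6,7)[OF m(1)] less_imp_le by auto
  have adm_const: "adm (\<lambda>x. a)" and adm_beta: "adm \<beta>" using ab \<beta> by (auto simp: adm_def periodic_def)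
  define T where "T f = conv (green m) 1 (N f)" for f
  have T_mono: "T f x \<le> T g x" if "adm f" "adm g" "\<And>x. f x \<le> g x" for f g x
    unfolding T_def
  proof (rule conv_mono[OF cg(1) N_cont N_cont cg(2)])
    show "N f y \<le> N g y" for y
      using monotone_nonlinearity(1)[of a "f y" "g y" b k] that a k ab(2)[of y]
      by (auto simp: N_def m(2) adm_def dest!: spec[of _ y])
  qed (use that in auto)
  have T_adm: "adm (T f)" if f: "adm f" for f
    unfolding adm_def
  proof (intro conjI allI)
    obtain p' where p': "\<And>x. (T f has_real_derivative p' x) (at x)"
      and "\<And>x. (p' has_real_derivative (m\<^sup>2 * T f x - N f x)) (at x)"
      by (rule green_operator_ode[OF N_cont[OF f] N_per[OF f] m(1), folded T_def]) (rule that)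
    show "continuous_on UNIV (T f)"
      by (intro continuous_at_imp_continuous_on ballI DERIV_isCont[OF p'])
    show "periodic (T f)" unfolding T_def using N_per[OF f] by (rule periodic_conv)
    fix x :: real
    have "a = conv (green m) 1 (\<lambda>x. m\<^sup>2 * a) x" using cg(3) m(1) by (simp add: conv_const)
    also have "\<dots> \<le> T (\<lambda>x. a) x"
      unfolding T_def using sub by (intro conv_mono cg N_cont adm_const) (auto simp: N_def)
    also have "\<dots> \<le> T f x" using T_mono[OF adm_const f] f by (auto simp: adm_def)
    finally show "a \<le> T f x" .
    have "T f x \<le> T \<beta> x" using T_mono[OF f adm_beta] f by (auto simp: adm_def)
    also have "\<dots> \<le> \<beta> x" using super[of x] by (simp add: T_def N_def[abs_def])
    finally show "T f x \<le> \<beta> x" .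
  qed
  have bc: "f \<in> bcontfun" if "adm f" for f
  proof (rule bcontfun_normI[of _ b])
    show "continuous_on UNIV f" using that by (simp add: adm_def)
    show "norm (f x) \<le> b" for x
    proof -
      have "a \<le> f x" "f x \<le> \<beta> x" using that by (auto simp: adm_def)
      then show ?thesis using ab(2)[of x] a by (simp add: abs_le_iff)
    qed
  qed
  let ?S = "{F :: real \<Rightarrow>\<^sub>C real. adm (apply_bcontfun F)}"
  let ?T = "\<lambda>F. Bcontfun (T (apply_bcontfun F))"
  have app: "apply_bcontfun (?T F) = T (apply_bcontfun F)" if "F \<in> ?S" for F
    using bc[OF T_adm] that by (simp add: Bcontfun_inverse)
  define c where "c = (m\<^sup>2 - k / b\<^sup>2) / m\<^sup>2"
  have m2: "m\<^sup>2 > 0" using m(1) by simp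
  have kb: "0 < k / b\<^sup>2" "k / b\<^sup>2 \<le> m\<^sup>2"
    using a b k unfolding m(2) by (auto intro!: divide_left_mono power_mono)
  have "\<exists>!F\<in>?S. ?T F = F"
  proof (rule Banach_fix[where c=c])
    have "?S = PiC UNIV (\<lambda>x. {a..\<beta> x}) \<inter> {F. \<forall>x. apply_bcontfun F (x + 1) = apply_bcontfun F x}"
      by (auto simp: adm_def mem_PiC_iff periodic_def Pi_iff)
    moreover have "closed (PiC UNIV (\<lambda>x. {a..\<beta> x}))" by (rule closed_PiC) auto
    moreover have "closed {F :: real \<Rightarrow>\<^sub>C real. \<forall>x. apply_bcontfun F (x + 1) = apply_bcontfun F x}"
    proof (intro closed_Collect_all closed_Collect_eq)
      have "continuous_on UNIV (\<lambda>F :: real \<Rightarrow>\<^sub>C real. apply_bcontfun F y)" for y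
        unfolding continuous_on_iff using dist_fun_lt_imp_dist_val_lt by blast
      then show "continuous_on UNIV (\<lambda>F :: real \<Rightarrow>\<^sub>C real. apply_bcontfun F (x + 1))"
        "continuous_on UNIV (\<lambda>F :: real \<Rightarrow>\<^sub>C real. apply_bcontfun F x)" for x by auto
    qed
    ultimately show "complete ?S" by (simp add: complete_eq_closed closed_Int)
    show "?S \<noteq> {}" using bc[OF adm_const] adm_const
      by (auto simp: Bcontfun_inverse intro!: exI[of _ "Bcontfun (\<lambda>x. a)"])
    show "0 \<le> c" using kb m2 by (simp add: c_def)
    show "c < 1" using kb m2 by (simp add: c_def)
    show "?T ` ?S \<subseteq> ?S" using app T_adm by auto
    fix F G assume F: "F \<in> ?S" and G: "G \<in> ?S"
    let ?f = "apply_bcontfun F" and ?g = "apply_bcontfun G"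
    have f: "adm ?f" and g: "adm ?g" using F G by auto
    have Nd: "\<bar>N ?f y + -1 * N ?g y\<bar> \<le> (m\<^sup>2 - k / b\<^sup>2) * dist F G" for y
    proof -
      have "\<bar>N ?f y - N ?g y\<bar> \<le> (m\<^sup>2 - k / b\<^sup>2) * \<bar>?f y - ?g y\<bar>"
      proof -
        have "a \<le> ?f y" "?f y \<le> b" "a \<le> ?g y" "?g y \<le> b"
          using f g ab(2)[of y] by (auto simp: adm_def intro: order.trans)
        from lipschitz_nonlinearity[OF a this k] show ?thesis by (simp add: N_def m(2))
      qed
      also have "\<dots> \<le> (m\<^sup>2 - k / b\<^sup>2) * dist F G"
        using dist_bounded[of F y G] kb by (intro mult_left_mono) (auto simp: dist_real_def)
      finally show ?thesis by simp
    qed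
    have "dist (?T F) (?T G) \<le> 1 / m\<^sup>2 * ((m\<^sup>2 - k / b\<^sup>2) * dist F G)"
    proof (rule dist_bound)
      fix x
      have "dist (?T F x) (?T G x) = \<bar>T ?f x + -1 * T ?g x\<bar>"
        by (simp only: app[OF F] app[OF G]) (simp add: dist_real_def)
      also have "T ?f x + -1 * T ?g x = conv (green m) 1 (\<lambda>x. N ?f x + -1 * N ?g x) x"
        unfolding T_def by (rule conv_lincomb[OF cg(1) N_cont[OF f] N_cont[OF g], symmetric])
      also have "\<bar>\<dots>\<bar> \<le> integral {0..1} (\<lambda>s. \<bar>green m s\<bar>) * ((m\<^sup>2 - k / b\<^sup>2) * dist F G)"
        using Nd by (intro conv_bound cg continuous_intros N_cont f g)
      also have "(\<lambda>s. \<bar>green m s\<bar>) = green m" using cg(2) by auto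
      finally show "dist (?T F x) (?T G x) \<le> 1 / m\<^sup>2 * ((m\<^sup>2 - k / b\<^sup>2) * dist F G)"
        by (simp only: cg(3))
    qed
    then show "dist (?T F) (?T G) \<le> c * dist F G" by (simp add: c_def)
  qed
  then obtain F where F: "F \<in> ?S" "?T F = F" by blast
  have "T (apply_bcontfun F) = apply_bcontfun F" using app[OF F(1)] unfolding F(2) by (rule sym)
  then have fixed: "apply_bcontfun F x = conv (green m) 1 (\<lambda>x. m\<^sup>2 * apply_bcontfun F x
      + k / apply_bcontfun F x - B x) x" for x
    unfolding T_def N_def[abs_def] by (rule fun_cong[OF sym])
  show ?thesis
  proof (rule that[of "apply_bcontfun F"])
    show "continuous_on UNIV (apply_bcontfun F)" "periodic (apply_bcontfun F)"
        "a \<le> apply_bcontfun F x" for x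
      using F(1) unfolding adm_def by blast+
  qed (rule fixed)
qed


text \<open>A constant that is small enough is a subsolution. The supersolution is \<open>\<beta> = Q + 1 - p0\<close> with
  \<open>\<beta>'' = B - k\<close>: it exists since \<open>B\<close> has mean \<open>k\<close>, and \<open>\<beta> \<ge> 1\<close> gives \<open>\<beta>'' \<le> B - k / \<beta>\<close>.
  Integration of the equation over a period then yields the integral of \<open>1 / p\<close>.\<close>

theorem singular_ode_periodic:
  fixes B :: "real \<Rightarrow> real"
  assumes B: "smooth_periodic B" and k: "k > 0" and mean: "integral {0..1} B = k"
  obtains p where "smooth_periodic p" "\<And>x. p x > 0" "\<And>x. dd 1 (dd 1 p) x = B x - k / p x"
    "integral {0..1} (\<lambda>x. 1 / p x) = 1"
proof -
  define p0 where "p0 = conv green0 1 B"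
  have p0: "smooth_periodic p0" "\<And>x. dd 1 (dd 1 p0) x = k - B x"
    using conv_green0_ode[OF B] mean by (auto simp: p0_def)
  obtain S where S: "S \<ge> 0" "\<And>x. \<bar>B x\<bar> \<le> S" using periodic_bounded smooth_periodicD[OF B] by metis
  obtain Q where Q: "Q \<ge> 0" "\<And>x. \<bar>p0 x\<bar> \<le> Q" using periodic_bounded smooth_periodicD[OF p0(1)] by metis
  define \<beta> where "\<beta> x = (Q + 1) - p0 x" for x
  have \<beta>: "smooth_periodic \<beta>" unfolding \<beta>_def by (intro smooth_periodic_intros p0)
  have \<beta>1: "\<beta> x \<ge> 1" "\<beta> x \<le> 2 * Q + 1" for x using Q(2)[of x] by (auto simp: \<beta>_def)
  have dd\<beta>: "dd 1 (dd 1 \<beta>) x = B x - k" for x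
  proof -
    have "dd 1 \<beta> = (\<lambda>x. - dd 1 p0 x)"
      unfolding \<beta>_def[abs_def] using dd_diff[of UNIV "\<lambda>x. Q + 1" p0] smooth_periodicD(1)[OF p0(1)]
        by auto
    then have "dd 1 (dd 1 \<beta>) x = - 1 * dd 1 (dd 1 p0) x"
      using dd_cmult[of UNIV "dd 1 p0" x 1 "-1"] smooth_periodicD(1)[OF smooth_periodic_dd[OF
          p0(1)]] by simp
    then show ?thesis using p0(2) by simp
  qed
  define a where "a = min 1 (k / (S + 1))"
  have a: "a > 0" "a \<le> 1" "a \<le> k / (S + 1)" using S(1) k by (auto simp: a_def)
  have ka: "S + 1 \<le> k / a" using a S(1) by (simp add: field_simps)
  \<comment> \<open>\<open>m\<^sup>2\<close> is the slope that \<open>monotone_nonlinearity\<close> asks for.\<close>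
  define m where "m = sqrt k / a"
  have m: "m > 0" "m\<^sup>2 = k / a\<^sup>2" using a k by (auto simp: m_def power_divide)
  have cg: "continuous_on UNIV (green m)" "\<And>s. green m s \<ge> 0"
    using green_facts(5,6)[OF m(1)] less_imp_le by auto
  have super: "conv (green m) 1 (\<lambda>x. m\<^sup>2 * \<beta> x + k / \<beta> x - B x) x \<le> \<beta> x" for x
  proof -
    have c\<beta>: "continuous_on UNIV \<beta>" using smooth_periodicD(3)[OF \<beta>] .
    have "conv (green m) 1 (\<lambda>x. m\<^sup>2 * \<beta> x + k / \<beta> x - B x) x
        \<le> conv (green m) 1 (\<lambda>x. dd 1 (dd 1 \<beta>) x * -1 + m\<^sup>2 * \<beta> x) x"
    proof (rule conv_mono[OF cg(1) _ _ cg(2)])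
      show "continuous_on UNIV (\<lambda>x. m\<^sup>2 * \<beta> x + k / \<beta> x - B x)"
        using \<beta>1(1) smooth_periodicD(3)[OF B] c\<beta>
          by (intro continuous_intros) (auto, metis not_one_le_zero)
      show "continuous_on UNIV (\<lambda>x. dd 1 (dd 1 \<beta>) x * -1 + m\<^sup>2 * \<beta> x)"
        using c\<beta> smooth_periodicD(3)[OF B] unfolding dd\<beta> by (intro continuous_intros)
      have "k / \<beta> y \<le> k" for y using \<beta>1(1)[of y] k by (simp add: field_simps)
      then show "m\<^sup>2 * \<beta> y + k / \<beta> y - B y \<le> dd 1 (dd 1 \<beta>) y * -1 + m\<^sup>2 * \<beta> y" for y
        unfolding dd\<beta> by (simp add: add.commute)
    qed
    also have "\<dots> = conv (green m) 1 (\<lambda>x. - dd 1 (dd 1 \<beta>) x) x + m\<^sup>2 * conv (green m) 1 \<beta> x"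
      using smooth_periodicD(3)[OF smooth_periodic_dd[OF smooth_periodic_dd[OF \<beta>]]] c\<beta>
      by (subst conv_lincomb[OF cg(1)]) (auto intro!: continuous_intros)
    also have "\<dots> = \<beta> x"
      using conv_green[OF \<beta> _ m(1), of 1 x] conv_cmult[of "green m" 1 "-1" "dd 1 (dd 1 \<beta>)" x] by simp
    finally show ?thesis .
  qed
  have a\<beta>: "a \<le> \<beta> x" for x using a(2) \<beta>1(1)[of x] by linarith
  have Bk: "B x \<le> k / a" for x using S(2)[of x] ka by linarith
  obtain p where p: "continuous_on UNIV p" "periodic p" "\<And>x. a \<le> p x"
    "\<And>x. p x = conv (green m) 1 (\<lambda>x. m\<^sup>2 * p x + k / p x - B x) x"
    by (rule singular_fixed_point[OF smooth_periodicD(3)[OF B] smooth_periodicD(2)[OF B]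
        smooth_periodicD(3)[OF \<beta>]
      smooth_periodicD(2)[OF \<beta>] k a(1) a\<beta> \<beta>1(2) m Bk super]) (rule that)
  have pos: "p x > 0" for x using p(3)[of x] a by linarith
  let ?g = "\<lambda>x. m\<^sup>2 * p x + k / p x - B x"
  have g: "continuous_on UNIV ?g" "periodic ?g"
    using pos p(1,2) smooth_periodicD(2,3)[OF B]
    by (auto intro!: continuous_intros simp: less_imp_neq[symmetric] periodic_def)
  have fixed: "conv (green m) 1 ?g = p" using p(4) by (rule ext[OF sym])
  obtain p' where
    p': "\<And>x. (p has_real_derivative p' x) (at x)"
        "\<And>x. (p' has_real_derivative (m\<^sup>2 * p x - ?g x)) (at x)"
    by (rule green_operator_ode[OF g m(1), unfolded fixed]) (rule that)
  then have p'': "(p' has_real_derivative (B x - k / p x)) (at x)" for x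
    using p'(2)[of x] by simp
  have "Ck_on n UNIV p" for n
  proof (induction n)
    case 0
    then show ?case using p(1) by simp
  next
    case (Suc n)
    have "Ck_on n UNIV (\<lambda>x. inverse (p x))"
      using Suc pos smooth_on_inverse
      by (intro Ck_on_compose[where T="{0<..}" and f=p and g=inverse]) (auto simp: smooth_on_def)
    then have "Ck_on n UNIV (\<lambda>x. B x + (- k) * inverse (p x))"
      using smooth_periodicD(1)[OF B]
      by (intro Ck_on_add Ck_on_bounded_linear[OF bounded_linear_mult_right]) (auto simp: smooth_on_def)
    then have "Ck_on n UNIV (\<lambda>x. B x - k / p x)" by (simp add: divide_inverse)
    then have "Ck_on (Suc n) UNIV p'" using p''
      by (intro Ck_on_realI[of _ p' "\<lambda>x. B x - k / p x"]) (auto simp: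
          has_real_derivative_iff_has_vector_derivative)
    then have "Ck_on (Suc (Suc n)) UNIV p" using p'(1)
      by (intro Ck_on_realI[of _ p p']) (auto simp: has_real_derivative_iff_has_vector_derivative)
    then show ?case by (rule Ck_on_SucD)
  qed
  then have sp: "smooth_periodic p" using p(2) by (simp add: smooth_periodic_def smooth_on_def)
  have "dd 1 p = p'" using dd_real_eqI[OF p'(1)] by auto
  then have ode: "dd 1 (dd 1 p) x = B x - k / p x" for x using dd_real_eqI[OF p'', of 1 x] by simp
  have ip: "(\<lambda>x. 1 / p x) integrable_on {0..1}"
    using pos p(1) by (intro integrable_continuous_real continuous_intros)
        (auto intro: continuous_on_subset simp: less_imp_neq[symmetric])
  have "integral {0..1} (\<lambda>x. B x + (- k) * (1 / p x)) = 0"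
    using conv_mean_dd[OF smooth_periodic_dd[OF sp, of 1], of 1 0] by (simp add: conv_def ode)
  moreover have "integral {0..1} (\<lambda>x. B x + (- k) * (1 / p x))
      = integral {0..1} B + (- k) * integral {0..1} (\<lambda>x. 1 / p x)"
    by (simp only: integral_add[OF integrable_continuous_real[OF smooth_periodicD(3)[OF B]]
        integrable_on_mult_right[OF ip]]
        integral_mult_right)
  ultimately have "integral {0..1} (\<lambda>x. 1 / p x) = 1" using mean k by simp
  then show ?thesis using that[OF sp pos ode] by blast
qed

text \<open>Solutions form the family \<open>l + q - q x0\<close>, where \<open>q\<close> is minimal at \<open>x0\<close>. The integral of the
  reciprocal is at most \<open>1\<close> for \<open>l = 1\<close> and, because \<open>q\<close> grows at most quadratically at its
  minimum, at least \<open>1\<close> for small \<open>l\<close>; the intermediate value theorem does the rest.\<close>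

theorem degenerate_ode_periodic:
  fixes B :: "real \<Rightarrow> real"
  assumes B: "smooth_periodic B" and mean: "integral {0..1} B = 0"
  obtains p where "smooth_periodic p" "\<And>x. p x > 0" "\<And>x. dd 1 (dd 1 p) x = B x"
    "integral {0..1} (\<lambda>x. 1 / p x) = 1"
proof -
  define q where "q x = - conv green0 1 B x" for x
  have q: "smooth_periodic q" unfolding q_def by (intro smooth_periodic_intros conv_green0_ode B)
  have dq: "dd 1 (dd 1 q) x = B x" for x
  proof -
    note s = smooth_periodicD(1)[OF conv_green0_ode(1)[OF B]]
    have "dd 1 q = (\<lambda>x. - 1 * dd 1 (conv green0 1 B) x)"
      unfolding q_def[abs_def] using dd_cmult[OF s, of _ 1 "-1"] by auto
    then have "dd 1 (dd 1 q) x = - 1 * dd 1 (dd 1 (conv green0 1 B)) x"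
      using dd_cmult[OF smooth_on_dd[OF s], of x 1 "-1"] by simp
    then show ?thesis using conv_green0_ode(2)[OF B] mean by simp
  qed
  note sq = smooth_periodicD(1)[OF q]
  obtain x0 where x0: "\<And>x. q x0 \<le> q x"
  proof -
    obtain x0 where "x0 \<in> cbox 0 1" "\<And>x. x \<in> cbox 0 1 \<Longrightarrow> q x0 \<le> q x"
      using continuous_attains_inf[of "cbox 0 1" q] smooth_periodicD(3)[OF q] by auto
    moreover have "\<exists>y\<in>cbox 0 1. q x = q y" for x
    proof -
      obtain y where "y \<in> cbox 0 One" "\<And>f :: real \<Rightarrow> real. periodic f \<Longrightarrow> f x = f y"
        by (rule periodic_fundamental_domain[of x]) (rule that)
      then show ?thesis using smooth_periodicD(2)[OF q] by (intro bexI[of _ y]) auto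
    qed
    ultimately show ?thesis using that by metis
  qed
  obtain M where M: "M \<ge> 0" "\<And>x. \<bar>B x\<bar> \<le> M" using periodic_bounded smooth_periodicD[OF B] by metis
  have q_near: "q (x0 + s) - q x0 \<le> M * s\<^sup>2" if s: "s > 0" for s
  proof -
    have d0: "dd 1 q x0 = 0"
      using DERIV_local_min[OF smooth_real_derivative[OF sq], of 1 x0] x0 by auto
    obtain t where t: "x0 < t" "t < x0 + s" "q (x0 + s) - q x0 = s * dd 1 q t"
      using MVT2[of x0 "x0 + s" q "dd 1 q"] smooth_real_derivative[OF sq] s by auto
    obtain r where r: "x0 < r" "r < t" "dd 1 q t - dd 1 q x0 = (t - x0) * B r"
      using MVT2[of x0 t "dd 1 q" B] smooth_real_derivative[OF smooth_on_dd[OF sq, of 1]] t(1) dq by auto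
    have "dd 1 q t \<le> s * M"
    proof -
      have "(t - x0) * B r \<le> (t - x0) * M" using t M(2)[of r] by (intro mult_left_mono) auto
      also have "\<dots> \<le> s * M" using t M(1) by (intro mult_right_mono) auto
      finally have "(t - x0) * B r \<le> s * M" .
      then show ?thesis using r(3) d0 by simp
    qed
    then have "s * dd 1 q t \<le> s * (s * M)" using s by (intro mult_left_mono) auto
    then show ?thesis using t(3) by (simp add: power2_eq_square mult.commute mult.left_commute)
  qed
  define I where "I l = integral {0..1} (\<lambda>x. 1 / (l + q x - q x0))" for l
  \<comment> \<open>Then \<open>d\<^sup>2 + M d\<^sup>2 = d\<close>, so for \<open>l = d\<^sup>2\<close> an interval of length \<open>d\<close> contributes at least \<open>1\<close>.\<close>
  define d where "d = 1 / (1 + M)"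
  have d: "0 < d" "d \<le> 1" "d * (1 + M) = 1" using M(1) by (auto simp: d_def)
  have pos: "l + q x - q x0 > 0" if "l > 0" for l x using x0[of x] that by linarith
  have sp: "smooth_periodic (\<lambda>x. l + q x - q x0)" for l by (intro smooth_periodic_intros q)
  have spi: "smooth_periodic (\<lambda>x. 1 / (l + q x - q x0))" if "l > 0" for l
    using sp[of l] pos[OF that] unfolding smooth_periodic_def
    by (auto intro!: smooth_on_divide simp: periodic_def)
  have Id: "I (d\<^sup>2) \<ge> 1"
  proof -
    let ?w = "\<lambda>x. 1 / (d\<^sup>2 + q x - q x0)"
    have w: "smooth_periodic ?w" using d by (intro spi) simp
    have iw: "(\<lambda>s. ?w (x0 + s)) integrable_on {u..v}" for u v
    proof (rule integrable_continuous_real)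
      have "continuous_on {u..v} (\<lambda>s. x0 + s)" by (intro continuous_intros)
      then show "continuous_on {u..v} (\<lambda>s. ?w (x0 + s))"
        by (rule continuous_on_compose2[OF smooth_periodicD(3)[OF w, of UNIV]]) simp
    qed
    have "1 = integral {0..d} (\<lambda>s. 1 / (d\<^sup>2 + M * d\<^sup>2))"
    proof -
      have "d\<^sup>2 + M * d\<^sup>2 = d * (d * (1 + M))" by (simp add: power2_eq_square algebra_simps)
      then have "d\<^sup>2 + M * d\<^sup>2 = d" using d(3) by simp
      then show ?thesis using d by simp
    qed
    also have "\<dots> \<le> integral {0..d} (\<lambda>s. ?w (x0 + s))"
    proof (rule integral_le[OF _ iw])
      fix s assume s: "s \<in> {0..d}"
      have "q (x0 + s) - q x0 \<le> M * s\<^sup>2" using q_near[of s] s by (cases "s = 0") auto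
      also have "\<dots> \<le> M * d\<^sup>2" using s M(1) by (intro mult_left_mono power_mono) auto
      finally show "1 / (d\<^sup>2 + M * d\<^sup>2) \<le> ?w (x0 + s)"
        using pos[of "d\<^sup>2" "x0 + s"] d M(1)
          by (intro divide_left_mono mult_pos_pos) (auto simp: add_pos_nonneg)
    qed (rule integrable_const_ivl)
    also have "\<dots> \<le> integral {0..1} (\<lambda>s. ?w (x0 + s))"
      using d pos[of "d\<^sup>2"] by (intro integral_subset_le iw) (auto simp: less_imp_le)
    also have "\<dots> = I (d\<^sup>2)" unfolding I_def by (rule integral_shift_periodic[OF w])
    finally show ?thesis .
  qed
  have I1: "I 1 \<le> 1"
  proof -
    have "1 / (1 + q x - q x0) \<le> 1" for x using x0[of x] by simp
    then have "I 1 \<le> integral {0..1} (\<lambda>x::real. 1)"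
      unfolding I_def using smooth_periodicD(3)[OF spi[of 1]]
      by (intro integral_le integrable_continuous_real) auto
    then show ?thesis by simp
  qed
  have cI: "continuous_on {d\<^sup>2..1} I"
  proof -
    have "continuous_on ({d\<^sup>2..1} \<times> cbox 0 1) (\<lambda>(l, x). 1 / (l + q x - q x0))"
      unfolding split_beta
    proof (intro continuous_intros)
      show "continuous_on ({d\<^sup>2..1} \<times> cbox 0 1) (\<lambda>z. q (snd z))"
        by (rule continuous_on_compose2[OF smooth_periodicD(3)[OF q, of UNIV]])
            (auto intro!: continuous_intros)
      show "\<forall>z\<in>{d\<^sup>2..1} \<times> cbox 0 1. fst z + q (snd z) - q x0 \<noteq> 0"
      proof
        fix z assume "z \<in> {d\<^sup>2..1} \<times> cbox 0 (1::real)"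
        then have "fst z \<ge> d\<^sup>2" by auto
        moreover have "d\<^sup>2 > 0" using d by simp
        ultimately have "fst z > 0" by linarith
        from pos[OF this, of "snd z"] show "fst z + q (snd z) - q x0 \<noteq> 0" by simp
      qed
    qed
    from integral_continuous_on_param[OF this] show ?thesis by (simp add: I_def[abs_def])
  qed
  have "d\<^sup>2 \<le> 1" using d by (simp add: power_le_one)
  then obtain l where l: "d\<^sup>2 \<le> l" "l \<le> 1" "I l = 1"
    using IVT2'[of I 1 1 "d\<^sup>2"] Id I1 cI by auto
  have l0: "l > 0" using l(1) d by (smt (verit) zero_less_power)
  define p where "p x = l + q x - q x0" for x
  have "dd 1 p = dd 1 q"
  proof
    fix x
    have "(p has_real_derivative dd 1 q x) (at x)"
      unfolding p_def using smooth_real_derivative[OF sq, of x] by (auto intro!: derivative_eq_intros)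
    from dd_real_eqI[OF this, of 1] show "dd 1 p x = dd 1 q x" by simp
  qed
  then show ?thesis using that[of p] sp pos[OF l0] dq l(3) by (simp add: p_def[abs_def] I_def)
qed

text \<open>The function \<open>g\<close> is the antiderivative of \<open>1 / p\<close> and \<open>k\<close> its inverse. They commute with the
  unit translation since \<open>1 / p\<close> has mean \<open>1\<close>, so \<open>k y - y\<close> is periodic; the additive constant in
  \<open>g\<close> is chosen such that its mean vanishes, which makes the antiderivative \<open>\<psi>\<close> periodic.\<close>

lemma legendre_change_of_variable:
  fixes p :: "real \<Rightarrow> real"
  assumes p: "smooth_periodic p" "\<And>x. p x > 0" and mean: "integral {0..1} (\<lambda>x. 1 / p x) = 1"
  obtains \<psi> k g where "smooth_periodic \<psi>" "\<And>y. (\<psi> has_real_derivative (k y - y)) (at y)"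
    "\<And>y. (k has_real_derivative p (k y)) (at y)" "\<And>x. (g has_real_derivative 1 / p x) (at x)"
    "\<And>x. k (g x) = x" "\<And>y. g (k y) = y"
proof -
  have p1: "p (x + 1) = p x" for x using smooth_periodicD(2)[OF p(1)] by (simp add: periodic_def)
  have cp: "continuous_on UNIV (\<lambda>x. 1 / p x)"
    using p(2) smooth_periodicD(3)[OF p(1)]
      by (intro continuous_intros) (auto simp: less_imp_neq[symmetric])
  obtain G where G: "\<And>x. (G has_real_derivative 1 / p x) (at x)"
    using continuous_antiderivative[OF cp] by blast
  define g0 where "g0 x = G x - G 0" for x
  have dg0: "(g0 has_real_derivative 1 / p x) (at x)" for x
    unfolding g0_def using G[of x] by (auto intro!: derivative_eq_intros)
  have g01: "g0 1 = 1"
  proof -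
    have "((\<lambda>x. 1 / p x) has_integral (g0 1 - g0 0)) {0..1}"
      using dg0 by (intro fundamental_theorem_of_calculus)
        (auto simp: has_real_derivative_iff_has_vector_derivative[symmetric] intro: DERIV_subset)
    then show ?thesis using mean by (simp add: integral_unique g0_def)
  qed
  have g0p: "g0 (x + 1) = g0 x + 1" for x
  proof -
    have "((\<lambda>x. g0 (x + 1) - g0 x) has_real_derivative 0) (at x)" for x
    proof -
      have "((\<lambda>x. g0 (x + 1)) has_real_derivative 1 / p (x + 1)) (at x)"
        using dg0[of "x + 1"] by (simp only: DERIV_shift)
      from DERIV_diff[OF this dg0[of x]] show ?thesis by (simp add: p1)
    qed
    then have "g0 (x + 1) - g0 x = g0 (0 + 1) - g0 0" by (rule DERIV_isconst_all[rule_format])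
    then show ?thesis using g01 by (simp add: g0_def)
  qed
  have mono: "strict_mono g0"
    by (rule strict_monoI) (meson DERIV_pos_imp_increasing dg0 divide_pos_pos p(2) zero_less_one)
  have g0n: "g0 (real n) = real n" "g0 (- real n) = - real n" for n
  proof (induction n)
    case (Suc n)
    { case 1 then show ?case using Suc(1) g0p[of "real n"] by (simp add: add.commute) }
    { case 2
      have e: "- real (Suc n) = - real n - 1" by simp
      show ?case unfolding e using Suc(2) g0p[of "- real n - 1"] by simp }
  qed (auto simp: g0_def)
  have cont: "isCont g0 x" for x using dg0 DERIV_isCont by blast
  have surj: "\<exists>x. g0 x = y" for y
  proof -
    obtain n where n: "\<bar>y\<bar> \<le> real n" using real_arch_simple by blast
    then have "\<exists>x. - real n \<le> x \<and> x \<le> real n \<and> g0 x = y"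
      using cont by (intro IVT) (auto simp: g0n)
    then show ?thesis by blast
  qed
  define k0 where "k0 = inv g0"
  have inj: "inj g0" using mono by (rule strict_mono_imp_inj_on)
  have k0: "g0 (k0 y) = y" "k0 (g0 x) = x" for x y
    using surj inj by (auto simp: k0_def f_inv_into_f[of y g0 UNIV] surj_def) (metis f_inv_into_f rangeI)
  have ck0: "isCont k0 y" for y
  proof -
    have "isCont k0 (g0 (k0 y))"
      by (rule isCont_inverse_function[of 1 "k0 y" k0 g0]) (auto simp: k0 cont)
    then show ?thesis by (simp add: k0)
  qed
  have dk0: "(k0 has_real_derivative p (k0 y)) (at y)" for y
  proof -
    have "(k0 has_real_derivative inverse (1 / p (k0 y))) (at y)"
      by (rule DERIV_inverse_function[where f=g0 and g=k0 and a="y - 1" and b="y + 1"])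
        (use dg0 p(2)[of "k0 y"] k0 ck0 in \<open>auto simp: \<close>)
    then show ?thesis by simp
  qed
  have k0p: "k0 (y + 1) = k0 y + 1" for y
    using k0 g0p by metis
  have sk0: "smooth k0"
    by (rule smooth_on_autonomous[where F=p and T=UNIV]) (use dk0 smooth_periodicD(1)[OF p(1)] in auto)
  define e where "e t = k0 t - t" for t
  have e: "smooth_periodic e"
    using k0p smooth_on_diff[OF open_UNIV sk0 smooth_on_id]
    by (auto simp: smooth_periodic_def e_def[abs_def] periodic_def)
  \<comment> \<open>Translating \<open>k0\<close> by the mean of \<open>e\<close> removes the mean of \<open>k y - y\<close>.\<close>
  define b where "b = integral {0..1} e"
  define k where "k y = k0 (y - b)" for y
  define w where "w y = e (y - b) - b" for y
  have w: "k y - y = w y" for y by (simp add: k_def w_def e_def)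
  have sw: "smooth w"
    unfolding w_def using smooth_periodicD(1)[OF e]
    by (intro smooth_intros smooth_on_compose[of UNIV e UNIV "\<lambda>y. y - b"]) auto
  have w1: "w (y + 1) = w y" for y
  proof -
    have "e ((y - b) + 1) = e (y - b)" using smooth_periodicD(2)[OF e] by (simp add: periodic_def)
    moreover have "(y - b) + 1 = y + 1 - b" by simp
    ultimately show ?thesis unfolding w_def by (simp only:)
  qed
  obtain \<psi> where \<psi>: "\<And>y. (\<psi> has_real_derivative w y) (at y)"
    using continuous_antiderivative[OF smooth_on_continuous[OF sw]] by blast
  have \<psi>1: "\<psi> 1 = \<psi> 0"
  proof -
    have "(w has_integral (\<psi> 1 - \<psi> 0)) {0..1}"
      using \<psi> by (intro fundamental_theorem_of_calculus)
        (auto simp: has_real_derivative_iff_has_vector_derivative[symmetric] intro: DERIV_subset)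
    moreover have "integral {0..1} w = integral {0..1} (\<lambda>s. e (- b + s)) - integral {0..1} (\<lambda>s::real. b)"
    proof -
      have "continuous_on {0..1} (\<lambda>s. - b + s)" by (intro continuous_intros)
      then have "continuous_on {0..1} (\<lambda>s. e (- b + s))"
        by (rule continuous_on_compose2[OF smooth_periodicD(3)[OF e, of UNIV]]) simp
      from integral_diff[OF integrable_continuous_real[OF this] integrable_const_ivl, of b]
      show ?thesis by (simp add: w_def[abs_def])
    qed
    ultimately show ?thesis using integral_shift_periodic[OF e, of "-b"]
      by (simp add: integral_unique b_def)
  qed
  have "\<psi> (y + 1) = \<psi> y" for y
  proof -
    have "((\<lambda>x. \<psi> (x + 1) - \<psi> x) has_real_derivative 0) (at x)" for x
    proof -
      have "((\<lambda>x. \<psi> (x + 1)) has_real_derivative w (x + 1)) (at x)"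
        using \<psi>[of "x + 1"] by (simp only: DERIV_shift)
      from DERIV_diff[OF this \<psi>[of x]] show ?thesis by (simp add: w1)
    qed
    then have "\<psi> (y + 1) - \<psi> y = \<psi> (0 + 1) - \<psi> 0" by (rule DERIV_isconst_all[rule_format])
    then show ?thesis using \<psi>1 by simp
  qed
  then have s\<psi>: "smooth_periodic \<psi>"
    using smooth_real_antiderivative[OF \<psi> sw] by (simp add: smooth_periodic_def periodic_def)
  define g where "g x = g0 x + b" for x
  show ?thesis
  proof (rule that[OF s\<psi>, of k g])
    show "(\<psi> has_real_derivative k y - y) (at y)" for y using \<psi> by (simp add: w)
    show "(k has_real_derivative p (k y)) (at y)" for y
      using dk0[of "y - b"] DERIV_shift[of k0 _ y "-b"] by (simp add: k_def[abs_def])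
    show "(g has_real_derivative 1 / p x) (at x)" for x
      unfolding g_def using dg0[of x] by (auto intro!: derivative_eq_intros)
  qed (auto simp: k_def g_def k0)
qed

section \<open>The form of second derivatives that represents curvature\<close>

abbreviation J :: "complex^2 \<Rightarrow> complex^2" where "J a \<equiv> \<i> *s a"

lemma J_J: "J (J a) = - a"
  by (simp add: vec_eq_iff)

text \<open>For a local weight \<open>w = ln h\<close> of a metric this is the curvature divided by \<open>\<i>\<close>, see
  \<open>ext_deriv1_del\<close>. It is the real (1,1)-form \<open>\<i> \<partial> \<partial>-bar w\<close>.\<close>

definition levi :: "(complex^2 \<Rightarrow> real) \<Rightarrow> complex^2 \<Rightarrow> complex^2 \<Rightarrow> complex^2 \<Rightarrow> real" where
  "levi w a b z = (dd b (dd (J a) w) z - dd a (dd (J b) w) z) / 2"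

lemma dd_minus:
  assumes "smooth_on S f" "open S" "z \<in> S"
  shows "dd (- v) f z = - dd v f z"
  using linear_neg[OF dd_linear[OF assms]] .

lemma dd_uminus:
  fixes f :: "'a::euclidean_space \<Rightarrow> real"
  assumes "smooth_on S f" "open S" "z \<in> S"
  shows "dd v (\<lambda>z. - f z) z = - dd v f z"
  using dd_cmult[OF assms, of v "-1"] by simp

lemma levi_cong:
  assumes "open S" "z \<in> S" "\<And>y. y \<in> S \<Longrightarrow> f y = g y"
  shows "levi f a b z = levi g a b z"
proof -
  have "dd u (dd v f) z = dd u (dd v g) z" for u v
    using assms by (intro dd_cong[OF assms(1,2)] dd_cong) auto
  then show ?thesis by (simp add: levi_def)
qed

lemma smooth_on_levi:
  assumes "smooth_on S w" "open S"
  shows "smooth_on S (levi w a b)"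
  unfolding levi_def[abs_def] divide_inverse
  using assms by (intro smooth_on_mult smooth_on_diff smooth_on_dd) auto

lemma dd_half_diff:
  fixes f g :: "'a::euclidean_space \<Rightarrow> real"
  assumes "smooth_on S f" "smooth_on S g" "open S" "z \<in> S"
  shows "dd v (\<lambda>z. (f z - g z) / 2) z = (dd v f z - dd v g z) / 2"
proof -
  have "dd v (\<lambda>z. (f z - g z) / 2) z = dd v (\<lambda>z. (1/2) * (f z - g z)) z" by simp
  also have "\<dots> = (1/2) * (dd v f z - dd v g z)"
    using assms by (subst dd_cmult[where S=S]) (auto simp: dd_diff[where S=S] smooth_on_diff)
  finally show ?thesis by simp
qed

lemma dd_levi:
  assumes w: "smooth_on S w" "open S" "z \<in> S"
  shows "dd v (levi w a b) z = levi (dd v w) a b z"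
proof -
  have c: "dd v (dd p (dd q w)) z = dd p (dd q (dd v w)) z" for p q
  proof -
    have "dd v (dd p (dd q w)) z = dd p (dd v (dd q w)) z"
      using w by (intro dd_commute[where S=S] smooth_on_dd)
    also have "\<dots> = dd p (dd q (dd v w)) z"
      using w by (intro dd_cong[where S=S] dd_commute[where S=S]) auto
    finally show ?thesis .
  qed
  have "dd v (levi w a b) z = (dd v (dd b (dd (J a) w)) z - dd v (dd a (dd (J b) w)) z) / 2"
    unfolding levi_def[abs_def] using w by (intro dd_half_diff[where S=S] smooth_on_dd)
  then show ?thesis by (simp add: c levi_def)
qed

lemma levi_half_diff:
  assumes "smooth_on S f" "smooth_on S g" "open S" "z \<in> S"
  shows "levi (\<lambda>z. (f z - g z) / 2) a b z = (levi f a b z - levi g a b z) / 2"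
proof -
  have d: "dd u (dd v (\<lambda>z. (f z - g z) / 2)) z = (dd u (dd v f) z - dd u (dd v g) z) / 2" for u v
  proof -
    have "dd u (dd v (\<lambda>z. (f z - g z) / 2)) z = dd u (\<lambda>z. (dd v f z - dd v g z) / 2) z"
      using assms by (intro dd_cong[where S=S] dd_half_diff[where S=S]) auto
    also have "\<dots> = (dd u (dd v f) z - dd u (dd v g) z) / 2"
      using assms by (intro dd_half_diff[where S=S] smooth_on_dd)
    finally show ?thesis .
  qed
  show ?thesis unfolding levi_def d by (simp add: field_simps)
qed

lemma levi_add:
  assumes "smooth_on S f" "smooth_on S g" "open S" "z \<in> S"
  shows "levi (\<lambda>z. f z + g z) a b z = levi f a b z + levi g a b z"
proof -
  have d: "dd u (dd v (\<lambda>z. f z + g z)) z = dd u (dd v f) z + dd u (dd v g) z" for u v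
  proof -
    have "dd u (dd v (\<lambda>z. f z + g z)) z = dd u (\<lambda>z. dd v f z + dd v g z) z"
      using assms by (intro dd_cong[where S=S] dd_add[where S=S]) auto
    also have "\<dots> = dd u (dd v f) z + dd u (dd v g) z"
      using assms by (intro dd_add[where S=S] smooth_on_dd)
    finally show ?thesis .
  qed
  show ?thesis unfolding levi_def d by (simp add: field_simps)
qed

lemma levi_cmult:
  assumes "smooth_on S f" "open S" "z \<in> S"
  shows "levi (\<lambda>z. c * f z) a b z = c * levi f a b z"
proof -
  have d: "dd u (dd v (\<lambda>z. c * f z)) z = c * dd u (dd v f) z" for u v
  proof -
    have "dd u (dd v (\<lambda>z. c * f z)) z = dd u (\<lambda>z. c * dd v f z) z"
      using assms by (intro dd_cong[where S=S] dd_cmult[where S=S]) auto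
    also have "\<dots> = c * dd u (dd v f) z"
      using assms by (intro dd_cmult[where S=S] smooth_on_dd)
    finally show ?thesis .
  qed
  show ?thesis unfolding levi_def d by (simp add: algebra_simps)
qed

text \<open>Constant coefficient operators commute.\<close>

lemma levi_levi_commute:
  assumes w: "smooth_on S w" "open S" "z \<in> S"
  shows "levi (levi w a b) c d z = levi (levi w c d) a b z"
proof -
  have e: "dd u (dd v (levi w a b)) z = levi (dd u (dd v w)) a b z" for u v
  proof -
    have "dd u (dd v (levi w a b)) z = dd u (levi (dd v w) a b) z"
      using w by (intro dd_cong[where S=S] dd_levi[where S=S]) auto
    also have "\<dots> = levi (dd u (dd v w)) a b z"
      using w by (intro dd_levi[where S=S] smooth_on_dd)
    finally show ?thesis .
  qed
  have "levi (levi w a b) c d z = (levi (dd d (dd (J c) w)) a b z - levi (dd c (dd (J d) w)) a b z) / 2"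
    unfolding levi_def[of "levi w a b"] e ..
  also have "\<dots> = levi (levi w c d) a b z"
    unfolding levi_def[of w c d, abs_def] using w
    by (intro levi_half_diff[where S=S, symmetric] smooth_on_dd)
  finally show ?thesis .
qed

lemma ext_deriv1_dd: "ext_deriv1 \<eta> z a b = dd a (\<lambda>w. \<eta> w b) z - dd b (\<lambda>w. \<eta> w a) z"
  by (simp add: ext_deriv1_def dd_def)

lemma del_real:
  assumes "smooth_on S w" "open S" "z \<in> S"
  shows "del (\<lambda>y. of_real (w y)) z a = (of_real (dd a w z) - \<i> * of_real (dd (J a) w z)) / 2"
proof -
  have "dd v (\<lambda>y. complex_of_real (w y)) z = of_real (dd v w z)" for v
    by (rule dd_bounded_linear[OF assms bounded_linear_of_real])
  then show ?thesis by (simp add: del_def dd_def[symmetric])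
qed

lemma dd_complex_combination:
  fixes f g :: "'a::euclidean_space \<Rightarrow> real"
  assumes "smooth_on S f" "smooth_on S g" "open S" "z \<in> S"
  shows "dd v (\<lambda>y. (of_real (f y) - \<i> * of_real (g y)) / 2) z
      = (of_real (dd v f z) - \<i> * of_real (dd v g z)) / 2"
proof (rule dd_eqI)
  have f: "((\<lambda>y. complex_of_real (f y)) has_derivative (\<lambda>v. of_real (dd v f z))) (at z)"
    by (rule bounded_linear.has_derivative[OF bounded_linear_of_real smooth_on_has_derivative[OF
        assms(1,3,4)]])
  have g: "((\<lambda>y. complex_of_real (g y)) has_derivative (\<lambda>v. of_real (dd v g z))) (at z)"
    by (rule bounded_linear.has_derivative[OF bounded_linear_of_real smooth_on_has_derivative[OF
        assms(2,3,4)]])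
  show "((\<lambda>y. (of_real (f y) - \<i> * of_real (g y)) / 2) has_derivative
      (\<lambda>v. (of_real (dd v f z) - \<i> * of_real (dd v g z)) / 2)) (at z)"
    using bounded_linear.has_derivative[OF bounded_linear_divide[of "2::complex"]
        has_derivative_diff[OF f has_derivative_mult_right[OF g, of \<i>]]] .
qed

lemma ext_deriv1_del:
  assumes w: "smooth_on S w" "open S" "z \<in> S"
  shows "ext_deriv1 (del (\<lambda>y. of_real (w y))) z a b = \<i> * of_real (levi w a b z)"
proof -
  have d: "dd a (\<lambda>y. del (\<lambda>y. of_real (w y)) y b) z
      = (of_real (dd a (dd b w) z) - \<i> * of_real (dd a (dd (J b) w) z)) / 2" for a b
  proof -
    have "dd a (\<lambda>y. del (\<lambda>y. of_real (w y)) y b) z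
        = dd a (\<lambda>y. (of_real (dd b w y) - \<i> * of_real (dd (J b) w y)) / 2) z"
      using w by (intro dd_cong[where S=S] del_real[where S=S]) auto
    also have "\<dots> = (of_real (dd a (dd b w) z) - \<i> * of_real (dd a (dd (J b) w) z)) / 2"
      using w by (intro dd_complex_combination[where S=S] smooth_on_dd)
    finally show ?thesis .
  qed
  have "dd a (dd b w) z = dd b (dd a w) z" using w by (rule dd_commute)
  then show ?thesis unfolding ext_deriv1_dd d by (simp add: levi_def algebra_simps diff_divide_distrib)
qed

text \<open>The (1,0)-part of \<open>dw\<close> is \<open>\<eta> = dg / g\<close>. As \<open>w\<close> is smooth, the equation \<open>dg = g \<eta>\<close> shows that
  \<open>g\<close> is smooth too; then the symmetry of the second derivatives of \<open>g\<close> says that \<open>\<eta>\<close> is closed.\<close>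

lemma levi_log_holomorphic:
  assumes w: "smooth_on S w" "open S" and g: "holomorphic2_on g S" "\<And>z. z \<in> S \<Longrightarrow> g z \<noteq> 0"
    and wg: "\<And>z. z \<in> S \<Longrightarrow> w z = ln ((cmod (g z))\<^sup>2)" and z: "z \<in> S"
  shows "levi w a b z = 0"
proof -
  define \<eta> where "\<eta> v y = (complex_of_real (dd v w y) - \<i> * of_real (dd (J v) w y)) / 2" for v y
  have dg: "(g has_derivative (\<lambda>v. g y * \<eta> v y)) (at y)" if y: "y \<in> S" for y
  proof -
    obtain D where D: "(g has_derivative D) (at y)" "\<And>c a. D (c *s a) = c * D a"
      using g(1) y unfolding holomorphic2_on_def by blast
    have lin: "linear D" using D(1) by (rule has_derivative_linear)
    have gy: "g y \<noteq> 0" using g(2) y by blast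
    then have n: "(cmod (g y))\<^sup>2 > 0" by simp
    have "((\<lambda>y. Re (g y)) has_derivative (\<lambda>v. Re (D v))) (at y)"
        "((\<lambda>y. Im (g y)) has_derivative (\<lambda>v. Im (D v))) (at y)"
      using bounded_linear.has_derivative[OF bounded_linear_Re D(1)]
          bounded_linear.has_derivative[OF bounded_linear_Im D(1)] .
    from has_derivative_add[OF has_derivative_mult[OF this(1) this(1)]
        has_derivative_mult[OF this(2) this(2)]]
    have "((\<lambda>y. (cmod (g y))\<^sup>2) has_derivative (\<lambda>v. 2 * (Re (g y) * Re (D v) + Im (g y) * Im
        (D v)))) (at y)"
      unfolding cmod_power2 by (simp add: power2_eq_square algebra_simps)
    then have "((\<lambda>y. ln ((cmod (g y))\<^sup>2)) has_derivative
        (\<lambda>v. 2 * (Re (g y) * Re (D v) + Im (g y) * Im (D v)) / (cmod (g y))\<^sup>2)) (at y)"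
      using has_derivative_ln[where g="\<lambda>y. (cmod (g y))\<^sup>2" and x=y and s=UNIV] n
        by (simp add: divide_inverse)
    then have "(w has_derivative (\<lambda>v. 2 * (Re (g y) * Re (D v) + Im (g y) * Im (D v)) / (cmod
        (g y))\<^sup>2)) (at y)"
      by (rule has_derivative_transform_within_open[OF _ w(2) y]) (simp add: wg)
    from dd_eqI[OF this] have dw: "dd v w y = 2 * Re (D v / g y)" for v
      by (simp add: Re_divide cmod_power2 algebra_simps)
    have DJ: "D (J v) / g y = \<i> * (D v / g y)" for v by (simp add: D(2))
    have "(complex_of_real (2 * Re q) - \<i> * of_real (2 * Re (\<i> * q))) / 2 = q" for q
      by (simp add: complex_eq_iff)
    then have "\<eta> v y = D v / g y" for v unfolding \<eta>_def dw DJ .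
    then have "(\<lambda>v. g y * \<eta> v y) = D" using gy by auto
    then show ?thesis using D(1) by simp
  qed
  have s\<eta>: "smooth_on S (\<eta> v)" for v
  proof -
    have "smooth_on S (\<lambda>y. complex_of_real (dd v w y))"
        "smooth_on S (\<lambda>y. complex_of_real (dd (J v) w y))"
      using w by (auto intro!: smooth_on_linear[OF bounded_linear_of_real] smooth_on_dd)
    then show ?thesis unfolding \<eta>_def[abs_def] divide_inverse
      using w(2) by (intro smooth_on_mult smooth_on_diff) auto
  qed
  have sg: "smooth_on S g"
  proof -
    have "Ck_on k S g" for k
    proof (induction k)
      case 0
      show ?case unfolding Ck_on.simps(1)
        by (intro continuous_at_imp_continuous_on ballI has_derivative_continuous[OF dg])
    next
      case (Suc k)
      show ?case
        by (rule Ck_on_SucI[OF w(2) dg])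
          (use Suc s\<eta> w(2) in \<open>auto simp: smooth_on_def intro!: Ck_on_bilinear[OF
              bounded_bilinear_mult]\<close>)
    qed
    then show ?thesis by (simp add: smooth_on_def)
  qed
  have dd2: "dd a (dd b g) z = g z * dd a (\<eta> b) z + g z * \<eta> a z * \<eta> b z" for a b
  proof -
    have "dd a (dd b g) z = dd a (\<lambda>y. g y * \<eta> b y) z"
      using w z dg by (intro dd_cong[where S=S] dd_eqI) auto
    also have "\<dots> = g z * dd a (\<eta> b) z + g z * \<eta> a z * \<eta> b z"
      by (rule dd_eqI) (rule has_derivative_mult[OF dg[OF z] smooth_on_has_derivative[OF s\<eta> w(2) z]])
    finally show ?thesis .
  qed
  have "dd a (dd b g) z = dd b (dd a g) z" using sg w(2) z by (rule dd_commute)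
  then have "dd a (\<eta> b) z = dd b (\<eta> a) z"
    using g(2)[OF z] by (simp add: dd2 mult.commute mult.left_commute)
  moreover have "dd a (\<eta> b) z = (of_real (dd a (dd b w) z) - \<i> * of_real (dd a (dd (J b) w) z)) / 2"
      for a b
    unfolding \<eta>_def[abs_def] using w z by (intro dd_complex_combination[where S=S] smooth_on_dd)
  ultimately have "dd a (dd (J b) w) z = dd b (dd (J a) w) z"
    by (simp add: complex_eq_iff)
  then show ?thesis by (simp add: levi_def)
qed

section \<open>Coordinate directions\<close>

abbreviation e1 :: "complex^2" where "e1 \<equiv> axis 1 1"
abbreviation f1 :: "complex^2" where "f1 \<equiv> axis 1 \<i>"
abbreviation e2 :: "complex^2" where "e2 \<equiv> axis 2 1"
abbreviation f2 :: "complex^2" where "f2 \<equiv> axis 2 \<i>"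

lemma J_axis: "J e1 = f1" "J f1 = - e1" "J e2 = f2" "J f2 = - e2"
  by (auto simp: vec_eq_iff axis_def)

lemma Basis_complex2: "(Basis :: (complex^2) set) = {e1, f1, e2, f2}"
  by (auto simp: Basis_vec_def UNIV_2 Basis_complex_def)

lemma coordinate_Basis: "e1 \<in> Basis" "f1 \<in> Basis" "e2 \<in> Basis" "f2 \<in> Basis"
  by (auto simp: Basis_complex2)

lemma lattice_periodic_iff: "lattice_periodic f \<longleftrightarrow> periodic f"
proof
  assume "lattice_periodic f"
  moreover have "(Basis :: (complex^2) set) \<subseteq> lattice"
    by (auto simp: Basis_complex2 lattice_def axis_def)
  ultimately show "periodic f" by (auto simp: lattice_periodic_def periodic_def)
next
  assume p: "periodic f"
  have "l \<bullet> b \<in> \<int>" if "l \<in> lattice" "b \<in> Basis" for l b :: "complex^2"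
    using that by (auto simp: Basis_complex2 lattice_def inner_axis)
  then show "lattice_periodic f" using periodic_lattice[OF p] by (auto simp: lattice_periodic_def)
qed

lemma levi_diagonal:
  assumes w: "smooth_on S w" "open S" "z \<in> S"
  shows "levi w a (J a) z = (dd a (dd a w) z + dd (J a) (dd (J a) w) z) / 2"
proof -
  have "dd a (dd (J (J a)) w) z = dd a (\<lambda>y. - dd a w y) z"
    unfolding J_J using w by (intro dd_cong[where S=S] dd_minus[where S=S]) auto
  also have "\<dots> = - dd a (dd a w) z" using w by (intro dd_uminus[where S=S] smooth_on_dd)
  finally show ?thesis by (simp add: levi_def)
qed

lemma levi_J:
  assumes w: "smooth_on S w" "open S" "z \<in> S"
  shows "levi w (J a) (J b) z = levi w a b z"
proof -
  have "dd u (dd (J (J v)) w) z = - dd u (dd v w) z" for u v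
  proof -
    have "dd u (dd (J (J v)) w) z = dd u (\<lambda>y. - dd v w y) z"
      unfolding J_J using w by (intro dd_cong[where S=S] dd_minus[where S=S]) auto
    also have "\<dots> = - dd u (dd v w) z" using w by (intro dd_uminus[where S=S] smooth_on_dd)
    finally show ?thesis .
  qed
  then show ?thesis using dd_commute[OF w, of a "J b"] dd_commute[OF w, of b "J a"]
    by (simp add: levi_def)
qed

lemma levi_neg:
  assumes w: "smooth_on S w" "open S" "z \<in> S"
  shows "levi w a (- b) z = - levi w a b z"
proof -
  have "J (- b) = - J b" by (simp add: vec_eq_iff)
  then have "dd a (dd (J (- b)) w) z = dd a (\<lambda>y. - dd (J b) w y) z"
    using w by (intro dd_cong[where S=S]) (auto simp: dd_minus[where S=S])
  also have "\<dots> = - dd a (dd (J b) w) z" using w by (intro dd_uminus[where S=S] smooth_on_dd)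
  finally show ?thesis using dd_minus[OF smooth_on_dd[OF w(1)] w(2,3), of b "J a"]
    by (simp add: levi_def diff_divide_distrib)
qed

section \<open>Potentials for closed (1,1)-forms\<close>

lemma levi_operator:
  assumes T: "smooth_operator M T" and f: "smooth_periodic f"
  shows "levi (T f) a b z = T (levi f a b) z"
proof -
  note s = smooth_periodic_dd[OF f]
  have d: "dd u (dd v (T f)) = T (dd u (dd v f))" for u v
    using smooth_operatorD(2)[OF T f] smooth_operatorD(2)[OF T s] by simp
  have "T (\<lambda>z. (1/2) * (dd b (dd (J a) f) z - dd a (dd (J b) f) z)) z
      = (1/2) * (T (dd b (dd (J a) f)) z - T (dd a (dd (J b) f)) z)"
    using smooth_periodic_dd[OF s] smooth_operator_linear(2)[OF T smooth_periodic_dd[OF s]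
        smooth_periodic_dd[OF s]]
    by (subst smooth_operator_linear(3)[OF T _ _]) (auto intro: smooth_periodic_diff)
  then show ?thesis by (simp add: levi_def[abs_def] d)
qed

lemma smooth_periodic_levi:
  assumes "smooth_periodic f" shows "smooth_periodic (levi f a b)"
proof -
  have "smooth_periodic (\<lambda>z. (1/2) * (dd b (dd (J a) f) z - dd a (dd (J b) f) z))"
    by (intro smooth_periodic_intros assms)
  then show ?thesis by (simp add: levi_def[abs_def])
qed

lemma laplace_inv_levi:
  assumes f: "smooth_periodic f" and ab: "a \<in> Basis" "J a \<in> Basis"
  shows "laplace_inv a (J a) (levi f a (J a)) z = (f z - mean2 a (J a) f z) / 2"
proof -
  obtain M where T: "smooth_operator M (laplace_inv a (J a))" using smooth_operator_laplace_inv by blast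
  note s = smooth_periodic_dd[OF smooth_periodic_dd[OF f]]
  have "levi f a (J a) = (\<lambda>z. (1/2) * (dd a (dd a f) z + dd (J a) (dd (J a) f) z))"
    using smooth_periodicD(1)[OF f] by (intro ext) (simp add: levi_diagonal[of UNIV f] field_simps)
  then have "laplace_inv a (J a) (levi f a (J a)) z
     = (1/2) * (laplace_inv a (J a) (dd a (dd a f)) z + laplace_inv a (J a) (dd (J a) (dd (J a) f)) z)"
    using smooth_operator_linear(1)[OF T s s] 
    by (simp only:) (subst smooth_operator_linear(3)[OF T], auto intro: smooth_periodic_add s)
  then show ?thesis using laplace_inv[OF f ab] by simp
qed

text \<open>Averaging over all four directions kills every derivative.\<close>

lemma mean_constant:
  assumes f: "smooth_periodic f"
  shows "mean2 e2 f2 (mean2 e1 f1 f) z = mean2 e2 f2 (mean2 e1 f1 f) 0"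
proof -
  obtain M N where T: "smooth_operator M (mean2 e1 f1)" "smooth_operator N (mean2 e2 f2)"
    using smooth_operator_mean2 by blast
  note m1 = smooth_operatorD[OF T(1)] and m2 = smooth_operatorD[OF T(2)]
  let ?F = "mean2 e2 f2 (mean2 e1 f1 f)"
  have s: "smooth_periodic ?F" using f m1(1) m2(1) by blast
  have z: "dd b ?F y = 0" if bB: "b \<in> Basis" for b y
  proof -
    have e: "dd b ?F = mean2 e2 f2 (mean2 e1 f1 (dd b f))" using m1(1,2)[OF f] m2(2) by simp
    have e': "dd b ?F = mean2 e2 f2 (dd b (mean2 e1 f1 f))" using m1(1)[OF f] m2(2) by simp
    consider "b = e1 \<or> b = f1" | "b = e2 \<or> b = f2" using bB unfolding Basis_complex2 by blast
    then show ?thesis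
    proof cases
      case 1
      then have "mean2 e1 f1 (dd b f) = (\<lambda>x. 0)" using mean2_dd[OF f] coordinate_Basis by auto
      then show ?thesis using smooth_operator_linear(4)[OF T(2) f f] unfolding e by simp
    next
      case 2
      then show ?thesis using mean2_dd[OF m1(1)[OF f]] coordinate_Basis unfolding e' by auto
    qed
  qed
  then have "dd v ?F y = 0" for v y
    unfolding smooth_dd_expand[OF smooth_periodicD(1)[OF s], of v y] by simp
  then have "(?F has_derivative (\<lambda>v. 0)) (at y within UNIV)" for y
    using smooth_on_has_derivative[OF smooth_periodicD(1)[OF s], of y] by simp
  then obtain c where c: "\<And>y. y \<in> UNIV \<Longrightarrow> ?F y = c"
    using has_derivative_zero_constant[OF convex_UNIV, of ?F] by blast
  show ?thesis using c[of z] c[of 0] by simp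
qed

text \<open>Closedness enters through the symmetry \<open>comm\<close> alone: it turns \<open>levi (\<Phi> e1 f1) a b\<close>, the term
  that the first summand of \<open>\<phi>\<close> produces, into half the Laplacian of \<open>\<Phi> a b\<close> in the plane of
  \<open>z\<^sub>1\<close>, which \<open>laplace_inv e1 f1\<close> inverts.\<close>

theorem ddbar_lemma:
  assumes \<Phi>: "\<And>a b. smooth_periodic (\<lambda>z. \<Phi> z a b)"
    and comm: "\<And>a b c d z. levi (\<lambda>z. \<Phi> z a b) c d z = levi (\<lambda>z. \<Phi> z c d) a b z"
  obtains \<phi> C where "smooth_periodic \<phi>" "\<And>z a b. \<Phi> z a b + levi \<phi> a b z = C a b"
proof -
  obtain K1 K2 M1 M2 where G1: "smooth_operator K1 (laplace_inv e1 f1)" and G2: "smooth_operator K2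
      (laplace_inv e2 f2)"
    and E1: "smooth_operator M1 (mean2 e1 f1)" and E2: "smooth_operator M2 (mean2 e2 f2)"
    using smooth_operator_mean2 smooth_operator_laplace_inv by metis
  define \<Phi>1 where "\<Phi>1 = (\<lambda>z. \<Phi> z e1 f1)"
  define \<Phi>2 where "\<Phi>2 = (\<lambda>z. \<Phi> z e2 f2)"
  have s: "smooth_periodic \<Phi>1" "smooth_periodic \<Phi>2" using \<Phi> by (auto simp: \<Phi>1_def \<Phi>2_def)
  define u1 where "u1 = laplace_inv e1 f1 \<Phi>1"
  define u2 where "u2 = laplace_inv e2 f2 (mean2 e1 f1 \<Phi>2)"
  have su: "smooth_periodic u1" "smooth_periodic u2"
    unfolding u1_def u2_def using smooth_operatorD(1) G1 G2 E1 s by blast+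
  define \<phi> where "\<phi> z = - 2 * (u1 z + u2 z)" for z
  have s\<phi>: "smooth_periodic \<phi>" unfolding \<phi>_def by (intro smooth_periodic_cmult smooth_periodic_add su)
  have "\<Phi> z a b + levi \<phi> a b z = mean2 e2 f2 (mean2 e1 f1 (\<lambda>z. \<Phi> z a b)) 0" for z a b
  proof -
    let ?f = "\<lambda>z. \<Phi> z a b"
    have L1: "levi \<Phi>1 a b = levi ?f e1 (J e1)" unfolding \<Phi>1_def J_axis by (rule ext) (rule comm)
    have L2: "levi \<Phi>2 a b = levi ?f e2 (J e2)" unfolding \<Phi>2_def J_axis by (rule ext) (rule comm)
    have "levi u1 a b z = laplace_inv e1 f1 (levi \<Phi>1 a b) z"
      unfolding u1_def by (rule levi_operator[OF G1 s(1)])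
    also have "\<dots> = (?f z - mean2 e1 f1 ?f z) / 2"
      unfolding L1 using laplace_inv_levi[OF \<Phi>, of e1 a b z] coordinate_Basis by (simp add: J_axis)
    finally have 1: "levi u1 a b z = (?f z - mean2 e1 f1 ?f z) / 2" .
    have sE: "smooth_periodic (mean2 e1 f1 ?f)" "smooth_periodic (mean2 e1 f1 \<Phi>2)"
      using smooth_operatorD(1)[OF E1] \<Phi> s by auto
    have "levi u2 a b z = laplace_inv e2 f2 (levi (mean2 e1 f1 \<Phi>2) a b) z"
      unfolding u2_def by (rule levi_operator[OF G2 sE(2)])
    also have "levi (mean2 e1 f1 \<Phi>2) a b = levi (mean2 e1 f1 ?f) e2 (J e2)"
      using levi_operator[OF E1 s(2)] levi_operator[OF E1 \<Phi>] by (auto simp: L2)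
    also have "laplace_inv e2 f2 \<dots> z = (mean2 e1 f1 ?f z - mean2 e2 f2 (mean2 e1 f1 ?f) z) / 2"
      using laplace_inv_levi[OF sE(1), of e2 z] coordinate_Basis by (simp add: J_axis)
    finally have 2: "levi u2 a b z = (mean2 e1 f1 ?f z - mean2 e2 f2 (mean2 e1 f1 ?f) z) / 2" .
    have "levi \<phi> a b z = - 2 * (levi u1 a b z + levi u2 a b z)"
      unfolding \<phi>_def[abs_def] using su[THEN smooth_periodicD(1)]
      by (subst levi_cmult[where S=UNIV]) (auto simp: levi_add[where S=UNIV] smooth_on_add)
    moreover have "F + L = M" if "L = - 2 * (p + q)" "p = (F - E) / 2" "q = (E - M) / 2"
        for F L M E p q :: real
      using that by (simp add: field_simps)
    ultimately have "?f z + levi \<phi> a b z = mean2 e2 f2 (mean2 e1 f1 ?f) z" using 1 2 by blast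
    also have "\<dots> = mean2 e2 f2 (mean2 e1 f1 ?f) 0" by (rule mean_constant[OF \<Phi>])
    finally show ?thesis .
  qed
  from that[OF s\<phi>, of "\<lambda>a b. mean2 e2 f2 (mean2 e1 f1 (\<lambda>z. \<Phi> z a b)) 0", OF this] show ?thesis .
qed

section \<open>Integration over the torus\<close>

lemma torus_integral_box: "torus_integral f = integral (cbox 0 One) f"
proof -
  have "(\<chi> j. Complex 1 1) = (One :: complex^2)"
  proof (rule euclidean_eqI)
    fix b :: "complex^2" assume b: "b \<in> Basis"
    then have "(\<chi> j. Complex 1 1) \<bullet> b = 1" by (auto simp: Basis_complex2 inner_axis)
    then show "(\<chi> j. Complex 1 1) \<bullet> b = One \<bullet> b" using b by simp
  qed
  then show ?thesis by (simp add: torus_integral_def)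
qed

lemma continuous_integrable_box:
  fixes f :: "'a::euclidean_space \<Rightarrow> 'b::banach"
  shows "continuous_on UNIV f \<Longrightarrow> f integrable_on cbox a b"
  by (rule integrable_continuous) (rule continuous_on_subset, auto)

text \<open>The translated cube is cut along a hyperplane and one piece is moved back by a period.\<close>

lemma integral_box_shift:
  fixes f :: "'a::euclidean_space \<Rightarrow> real"
  assumes f: "continuous_on UNIV f" "periodic f" and e: "e \<in> Basis" and t: "0 \<le> t" "t \<le> 1"
  shows "integral (cbox 0 One) (\<lambda>x. f (x + t *\<^sub>R e)) = integral (cbox 0 One) f"
proof -
  note int = continuous_integrable_box[OF f(1)]
  have ib: "e \<bullet> b = (if b = e then 1 else 0)" if "b \<in> Basis" for b
    using that e by (simp add: inner_Basis eq_commute)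
  have sp: "(\<forall>i\<in>Basis. P i) \<longleftrightarrow> P e \<and> (\<forall>i\<in>Basis - {e}. P i)" for P using e by blast
  have A: "cbox (t *\<^sub>R e) (One + t *\<^sub>R e) \<inter> {x. x \<bullet> e \<le> 1} = cbox (t *\<^sub>R e) One"
    using e t by (auto simp: mem_box sp inner_add_left ib)
  have B: "cbox (t *\<^sub>R e) (One + t *\<^sub>R e) \<inter> {x. x \<bullet> e \<ge> 1} = cbox (0 + e) ((One + (t - 1) *\<^sub>R e) + e)"
    using e t by (auto simp: mem_box sp inner_add_left ib)
  have C: "cbox 0 One \<inter> {x. x \<bullet> e \<le> t} = cbox 0 (One + (t - 1) *\<^sub>R e)"
    using e t by (auto simp: mem_box sp inner_add_left ib)
  have D: "cbox 0 One \<inter> {x. x \<bullet> e \<ge> t} = cbox (t *\<^sub>R e) One"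
    using e t by (auto simp: mem_box sp inner_add_left ib)
  have "integral (cbox 0 One) (\<lambda>x. f (x + t *\<^sub>R e)) = integral (cbox (t *\<^sub>R e) (One + t *\<^sub>R e)) f"
    using integral_shift_cbox_plus[of 0 One f "t *\<^sub>R e"] by (simp add: o_def add.commute)
  also have "\<dots> = integral (cbox (t *\<^sub>R e) One) f + integral (cbox (0 + e) ((One + (t - 1) *\<^sub>R e) + e)) f"
    using integral_split[OF int[of "t *\<^sub>R e" "One + t *\<^sub>R e"] e, of 1] by (simp only: A B)
  also have "integral (cbox (0 + e) ((One + (t - 1) *\<^sub>R e) + e)) f
      = integral (cbox 0 (One + (t - 1) *\<^sub>R e)) (\<lambda>x. f (x + e))"
    using integral_shift_cbox_plus[of 0 "One + (t - 1) *\<^sub>R e" f e] by (simp add: o_def add.commute)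
  also have "(\<lambda>x. f (x + e)) = f" using f(2) e by (auto simp: periodic_def)
  also have "integral (cbox (t *\<^sub>R e) One) f + integral (cbox 0 (One + (t - 1) *\<^sub>R e)) f
      = integral (cbox 0 One) f"
    using integral_split[OF int[of 0 One] e, of t] by (simp only: C D)
  finally show ?thesis .
qed

text \<open>The integral of a translate does not depend on the translation; differentiate.\<close>

lemma integral_box_dd:
  fixes f :: "'a::euclidean_space \<Rightarrow> real"
  assumes f: "smooth_periodic f"
  shows "integral (cbox 0 One) (dd v f) = 0"
proof -
  note int = continuous_integrable_box[OF smooth_periodicD(3)[OF smooth_periodic_dd[OF f]]]
  have b: "integral (cbox 0 One) (dd e f) = 0" if e: "e \<in> Basis" for e
  proof -
    note sf = smooth_periodicD[OF f] and sd = smooth_periodicD[OF smooth_periodic_dd[OF f, of e]]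
    define I where "I t = integral (cbox 0 One) (\<lambda>x. f (x + t *\<^sub>R e))" for t
    have "(I has_real_derivative integral (cbox 0 One) (\<lambda>x. dd e f (x + (1/2) *\<^sub>R e))) (at
        (1/2) within {0..1})"
      unfolding I_def
    proof (rule leibniz_rule_field_derivative)
      show "((\<lambda>t. f (x + t *\<^sub>R e)) has_field_derivative dd e f (x + t *\<^sub>R e)) (at t within {0..1})"
          for t x
        using dd_line[OF sf(1)] by (simp add: has_real_derivative_iff_has_vector_derivative)
      show "(\<lambda>x. f (x + t *\<^sub>R e)) integrable_on cbox 0 One" for t
      proof (rule continuous_integrable_box)
        have "continuous_on UNIV (\<lambda>x. x + t *\<^sub>R e)" by (intro continuous_intros)
        then show "continuous_on UNIV (\<lambda>x. f (x + t *\<^sub>R e))"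
          by (rule continuous_on_compose2[OF sf(3)[of UNIV]]) simp
      qed
      have "continuous_on ({0..1} \<times> cbox 0 One) (\<lambda>z. snd z + fst z *\<^sub>R e)" by (intro continuous_intros)
      then show "continuous_on ({0..1} \<times> cbox 0 One) (\<lambda>(t, x). dd e f (x + t *\<^sub>R e))"
        unfolding split_beta by (rule continuous_on_compose2[OF sd(3)[of UNIV]]) simp
    qed auto
    moreover have "(I has_real_derivative 0) (at (1/2) within {0..1})"
    proof (rule has_field_derivative_transform_within[of "\<lambda>t. integral (cbox 0 One) f" _ _ _ 1])
      show "integral (cbox 0 One) f = I t" if "t \<in> {0..1}" for t
        using integral_box_shift[OF sf(3,2) e, of t] that by (simp add: I_def)
    qed auto
    ultimately have "integral (cbox 0 One) (\<lambda>x. dd e f (x + (1/2) *\<^sub>R e)) = 0"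
      by (metis at_within_Icc_at DERIV_unique divide_less_eq_1_pos half_gt_zero_iff zero_less_one
          one_less_numeral_iff semiring_norm(76) zero_less_numeral)
    then show ?thesis using integral_box_shift[OF sd(3,2) e, of "1/2"] by simp
  qed
  have "integral (cbox 0 One) (dd v f) = integral (cbox 0 One) (\<lambda>x. \<Sum>e\<in>Basis. (v \<bullet> e) * dd e f x)"
    by (rule arg_cong[where f="integral (cbox 0 One)"], rule ext)
      (rule smooth_dd_expand[OF smooth_periodicD(1)[OF f], unfolded real_scaleR_def])
  also have "\<dots> = (\<Sum>e\<in>Basis. integral (cbox 0 One) (\<lambda>x. (v \<bullet> e) * dd e f x))"
    by (intro integral_sum integrable_on_mult_right int) auto
  finally show ?thesis by (simp add: b)
qed

lemma integral_box_by_parts: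
  fixes f g :: "'a::euclidean_space \<Rightarrow> real"
  assumes f: "smooth_periodic f" and g: "smooth_periodic g"
  shows "integral (cbox 0 One) (\<lambda>x. f x * dd v g x) = - integral (cbox 0 One) (\<lambda>x. dd v f x * g x)"
proof -
  have "integral (cbox 0 One) (dd v (\<lambda>x. f x * g x)) = 0"
    by (rule integral_box_dd[OF smooth_periodic_mult[OF f g]])
  moreover have "dd v (\<lambda>x. f x * g x) = (\<lambda>x. f x * dd v g x + dd v f x * g x)"
    using dd_mult[of UNIV f g] f g by (auto simp: smooth_periodic_def)
  moreover have "integral (cbox 0 One) (\<lambda>x. f x * dd v g x + dd v f x * g x)
      = integral (cbox 0 One) (\<lambda>x. f x * dd v g x) + integral (cbox 0 One) (\<lambda>x. dd v f x * g x)"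
    by (intro integral_add continuous_integrable_box continuous_on_mult smooth_periodicD(3)
        smooth_periodic_dd f g)
  ultimately show ?thesis by simp
qed

lemma integral_box_second:
  fixes f g :: "'a::euclidean_space \<Rightarrow> real"
  assumes f: "smooth_periodic f" and g: "smooth_periodic g"
  shows "integral (cbox 0 One) (\<lambda>x. f x * dd u (dd v g) x)
      = integral (cbox 0 One) (\<lambda>x. dd u (dd v f) x * g x)"
proof -
  have "integral (cbox 0 One) (\<lambda>x. f x * dd u (dd v g) x)
      = integral (cbox 0 One) (\<lambda>x. dd v (dd u f) x * g x)"
    using integral_box_by_parts[OF f smooth_periodic_dd[OF g], of u v] integral_box_by_parts[OF
        smooth_periodic_dd[OF f] g, of u v]
    by simp
  then show ?thesis using dd_commute[OF smooth_periodicD(1)[OF f]] by simp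
qed

lemma integral_half_diff:
  assumes "smooth_periodic F" "smooth_periodic G"
  shows "integral (cbox 0 One) (\<lambda>x. (F x - G x) / 2)
      = (integral (cbox 0 One) F - integral (cbox 0 One) G) / 2"
  unfolding integral_divide using assms
  by (subst integral_diff) (auto intro!: continuous_integrable_box smooth_periodicD(3))

lemma integral_levi_self_adjoint:
  assumes f: "smooth_periodic f" and g: "smooth_periodic g"
  shows "integral (cbox 0 One) (\<lambda>x. f x * levi g a b x) = integral (cbox 0 One) (\<lambda>x. levi f a b x * g x)"
proof -
  note s = smooth_periodic_intros
  have "integral (cbox 0 One) (\<lambda>x. f x * levi g a b x)
      = integral (cbox 0 One) (\<lambda>x. (f x * dd b (dd (J a) g) x - f x * dd a (dd (J b) g) x) / 2)"
    by (simp add: levi_def right_diff_distrib)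
  also have "\<dots> = (integral (cbox 0 One) (\<lambda>x. f x * dd b (dd (J a) g) x) - integral (cbox 0 One)
      (\<lambda>x. f x * dd a (dd (J b) g) x)) / 2"
    by (intro integral_half_diff s f g)
  also have "\<dots> = (integral (cbox 0 One) (\<lambda>x. dd b (dd (J a) f) x * g x) - integral (cbox 0 One)
      (\<lambda>x. dd a (dd (J b) f) x * g x)) / 2"
    using integral_box_second[OF f g] by simp
  also have "\<dots> = integral (cbox 0 One) (\<lambda>x. (dd b (dd (J a) f) x * g x - dd a (dd (J b) f) x * g x) / 2)"
    by (intro integral_half_diff[symmetric] s f g)
  also have "\<dots> = integral (cbox 0 One) (\<lambda>x. levi f a b x * g x)"
    by (simp add: levi_def left_diff_distrib)
  finally show ?thesis .
qed

lemma integral_levi: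
  assumes f: "smooth_periodic f"
  shows "integral (cbox 0 One) (levi f a b) = 0"
  using integral_levi_self_adjoint[OF smooth_periodic_const f, of 1 a b] by (simp add: levi_def[abs_def])

section \<open>Curvature of a Hermitian metric\<close>

lemma levi_translate:
  assumes w: "smooth_on S w" "open S" "z \<in> S"
    and l: "\<And>y. y \<in> S \<Longrightarrow> y + l \<in> S" "\<And>y. y \<in> S \<Longrightarrow> w (y + l) = w y"
  shows "levi w a b (z + l) = levi w a b z"
proof -
  have d: "dd v f (y + l) = dd v f y" if f: "smooth_on S f"
      "\<And>y. y \<in> S \<Longrightarrow> f (y + l) = f y" and y: "y \<in> S" for f :: "complex^2 \<Rightarrow> real" and v y
  proof -
    have "((\<lambda>y. y + l) has_derivative (\<lambda>v. v)) (at y)" by (auto intro!: derivative_eq_intros)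
    from has_derivative_compose[OF this smooth_on_has_derivative[OF f(1) w(2) l(1)[OF y]]]
    have "((\<lambda>y. f (y + l)) has_derivative (\<lambda>v. dd v f (y + l))) (at y)" .
    then have "(f has_derivative (\<lambda>v. dd v f (y + l))) (at y)"
      by (rule has_derivative_transform_within_open[OF _ w(2) y]) (simp add: f(2))
    then show ?thesis by (simp add: dd_eqI)
  qed
  have "dd u (dd v w) (z + l) = dd u (dd v w) z" for u v
    using w by (intro d smooth_on_dd l) auto
  then show ?thesis by (simp add: levi_def)
qed

lemma smooth_on_ln_compose:
  assumes "smooth_on S h" "open S" "\<And>z. z \<in> S \<Longrightarrow> 0 < h z"
  shows "smooth_on S (\<lambda>z. ln (h z) :: real)"
  using assms by (intro smooth_on_compose[OF smooth_on_ln]) auto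

lemma bundle_chart:
  assumes "holomorphic_line_bundle L"
  obtains i where "i \<in> charts L" "z \<in> chart_dom L i"
  using assms unfolding holomorphic_line_bundle_def by blast

lemma bundleD:
  assumes "holomorphic_line_bundle L" "i \<in> charts L"
  shows "open (chart_dom L i)" "z \<in> chart_dom L i \<Longrightarrow> l \<in> lattice \<Longrightarrow> z + l \<in> chart_dom L i"
  using assms unfolding holomorphic_line_bundle_def by blast+

lemma transitionD:
  assumes "holomorphic_line_bundle L" "i \<in> charts L" "j \<in> charts L"
  shows "holomorphic2_on (transition L i j) (chart_dom L i \<inter> chart_dom L j)"
    "z \<in> chart_dom L i \<inter> chart_dom L j \<Longrightarrow> transition L i j z \<noteq> 0"
  using assms unfolding holomorphic_line_bundle_def by blast+

lemma metricD:
  assumes "hermitian_metric L h" "i \<in> charts L"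
  shows "smooth_on (chart_dom L i) (h i)" "z \<in> chart_dom L i \<Longrightarrow> 0 < h i z"
    "z \<in> chart_dom L i \<Longrightarrow> l \<in> lattice \<Longrightarrow> h i (z + l) = h i z"
    "j \<in> charts L \<Longrightarrow> z \<in> chart_dom L i \<inter> chart_dom L j \<Longrightarrow> h j z = (cmod (transition L i j z))\<^sup>2 * h i z"
  using assms unfolding hermitian_metric_def by blast+

text \<open>The definition of the curvature selects some chart at each point; this lemma makes the
  choice irrelevant.\<close>

lemma chern_curvature_chart:
  assumes L: "holomorphic_line_bundle L" and h: "hermitian_metric L h"
    and i: "i \<in> charts L" "z \<in> chart_dom L i"
  shows "chern_curvature L h z a b = \<i> * of_real (levi (\<lambda>y. ln (h i y)) a b z)"
proof -
  define j where "j = (SOME j. j \<in> charts L \<and> z \<in> chart_dom L j)"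
  have j: "j \<in> charts L" "z \<in> chart_dom L j" 
    using someI[of "\<lambda>j. j \<in> charts L \<and> z \<in> chart_dom L j", OF conjI[OF i]] unfolding j_def by blast+
  note o = bundleD(1)[OF L i(1)] bundleD(1)[OF L j(1)]
  note hi = metricD[OF h i(1)] and hj = metricD[OF h j(1)]
  have si: "smooth_on (chart_dom L i) (\<lambda>y. ln (h i y))" and sj: "smooth_on (chart_dom L j) (\<lambda>y. ln
      (h j y))"
    by (rule smooth_on_ln_compose[OF hi(1) o(1) hi(2)], assumption)
      (rule smooth_on_ln_compose[OF hj(1) o(2) hj(2)], assumption)
  let ?U = "chart_dom L j \<inter> chart_dom L i"
  have U: "open ?U" "z \<in> ?U" using o i j by auto
  let ?w = "\<lambda>y. ln (h i y) - ln (h j y)"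
  have si': "smooth_on ?U (\<lambda>y. ln (h i y))" and sj': "smooth_on ?U (\<lambda>y. ln (h j y))"
    using si sj smooth_on_subset by (metis inf_le2, metis inf_le1)
  note g = transitionD[OF L j(1) i(1)]
  have w: "?w y = ln ((cmod (transition L j i y))\<^sup>2)" if y: "y \<in> ?U" for y
  proof -
    have "h i y = (cmod (transition L j i y))\<^sup>2 * h j y" by (rule hj(4)[OF i(1) y])
    then have "ln (h i y) = ln ((cmod (transition L j i y))\<^sup>2) + ln (h j y)"
      using hj(2)[of y] g(2)[OF y] y by (simp add: ln_mult)
    then show ?thesis by simp
  qed
  have "levi ?w a b z = 0"
    by (rule levi_log_holomorphic[OF smooth_on_diff[OF U(1) si' sj'] U(1) g w U(2)])
  then have "levi (\<lambda>y. ln (h i y)) a b z = levi (\<lambda>y. ln (h j y)) a b z"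
    using levi_add[OF smooth_on_diff[OF U(1) si' sj'] sj' U, of a b] by simp
  moreover have "chern_curvature L h z = ext_deriv1 (del (\<lambda>y. of_real (ln (h j y)))) z"
    by (simp add: chern_curvature_def chern_connection_def j_def)
  ultimately show ?thesis using ext_deriv1_del[OF sj o(2) j(2)] by simp
qed

definition curvature_form :: "'i line_bundle \<Rightarrow> ('i \<Rightarrow> complex^2 \<Rightarrow> real) \<Rightarrow> complex^2 \<Rightarrow> complex^2 \<Rightarrow>
    complex^2 \<Rightarrow> real" where
  "curvature_form L h z a b = Im (chern_curvature L h z a b)"

context
  fixes L :: "'i line_bundle" and h
  assumes L: "holomorphic_line_bundle L" and h: "hermitian_metric L h"
begin

lemma curvature_form_chart:
  assumes "i \<in> charts L" "z \<in> chart_dom L i"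
  shows "curvature_form L h z a b = levi (\<lambda>y. ln (h i y)) a b z"
  using chern_curvature_chart[OF L h assms] by (simp add: curvature_form_def)

lemma chern_curvature_imaginary: "chern_curvature L h z a b = \<i> * of_real (curvature_form L h z a b)"
  using chern_curvature_chart[OF L h] curvature_form_chart bundle_chart[OF L] by metis

lemma local_potential:
  obtains S w where "open S" "z \<in> S" "smooth_on S w"
      "\<And>y a b. y \<in> S \<Longrightarrow> curvature_form L h y a b = levi w a b y"
    "\<And>y l. y \<in> S \<Longrightarrow> l \<in> lattice \<Longrightarrow> y + l \<in> S \<and> w (y + l) = w y"
proof -
  obtain i where i: "i \<in> charts L" "z \<in> chart_dom L i" by (rule bundle_chart[OF L])
  note t = bundleD[OF L i(1)] and hp = metricD[OF h i(1)]
  show ?thesis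
    by (rule that[OF t(1) i(2) smooth_on_ln_compose[OF hp(1) t(1) hp(2)] curvature_form_chart[OF i(1)]])
      (simp_all add: t(2) hp(3))
qed

lemma smooth_periodic_curvature_form: "smooth_periodic (\<lambda>z. curvature_form L h z a b)"
  unfolding smooth_periodic_def
proof
  show "smooth (\<lambda>z. curvature_form L h z a b)"
  proof (rule smooth_on_local)
    fix z
    obtain S w where S: "open S" "z \<in> S" "smooth_on S w"
      "\<And>y a b. y \<in> S \<Longrightarrow> curvature_form L h y a b = levi w a b y"
      by (rule local_potential[of z]) (rule that)
    have "smooth_on S (\<lambda>z. curvature_form L h z a b)"
      by (rule smooth_on_cong[OF S(1) S(4) smooth_on_levi[OF S(3,1)]])
    then show "\<exists>U. open U \<and> z \<in> U \<and> smooth_on U (\<lambda>z. curvature_form L h z a b)" using S by blast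
  qed
  have "curvature_form L h (z + l) a b = curvature_form L h z a b" if "l \<in> lattice" for z l
  proof -
    obtain S w where S: "open S" "z \<in> S" "smooth_on S w"
      "\<And>y a b. y \<in> S \<Longrightarrow> curvature_form L h y a b = levi w a b y"
      "\<And>y l. y \<in> S \<Longrightarrow> l \<in> lattice \<Longrightarrow> y + l \<in> S \<and> w (y + l) = w y"
      by (rule local_potential[of z]) (rule that)
    show ?thesis
      using levi_translate[OF S(3,1,2), of l a b] S(2,4,5) \<open>l \<in> lattice\<close> by simp
  qed
  then show "periodic (\<lambda>z. curvature_form L h z a b)"
    by (simp add: lattice_periodic_iff[symmetric] lattice_periodic_def)
qed

lemma curvature_form_commute:
  "levi (\<lambda>z. curvature_form L h z a b) c d z = levi (\<lambda>z. curvature_form L h z c d) a b z"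
proof -
  obtain S w where S: "open S" "z \<in> S" "smooth_on S w"
    "\<And>y a b. y \<in> S \<Longrightarrow> curvature_form L h y a b = levi w a b y"
    by (rule local_potential[of z]) (rule that)
  have "levi (\<lambda>z. curvature_form L h z a b) c d z = levi (levi w a b) c d z" for a b c d
    by (rule levi_cong[OF S(1,2,4)])
  then show ?thesis using levi_levi_commute[OF S(3,1,2)] by simp
qed

lemma curvature_form_symmetries:
  "curvature_form L h z (J a) (J b) = curvature_form L h z a b"
  "curvature_form L h z a (- b) = - curvature_form L h z a b"
proof -
  obtain S w where S: "open S" "z \<in> S" "smooth_on S w"
    "\<And>y a b. y \<in> S \<Longrightarrow> curvature_form L h y a b = levi w a b y"
    by (rule local_potential[of z]) (rule that)
  show "curvature_form L h z (J a) (J b) = curvature_form L h z a b"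
    "curvature_form L h z a (- b) = - curvature_form L h z a b"
    using levi_J[OF S(3,1,2)] levi_neg[OF S(3,1,2)] S(2,4) by auto
qed

text \<open>The weight \<open>ln h\<close> changes by \<open>\<xi>\<close> in every chart.\<close>

lemma conformal_change:
  assumes \<xi>: "smooth_periodic \<xi>"
  shows "hermitian_metric L (\<lambda>i z. h i z * exp (\<xi> z))" (is "hermitian_metric L ?h")
    and "chern_curvature L (\<lambda>i z. h i z * exp (\<xi> z)) z a b
      = \<i> * of_real (curvature_form L h z a b + levi \<xi> a b z)"
proof -
  have sexp: "smooth (\<lambda>z. exp (\<xi> z))"
    using smooth_periodicD(1)[OF \<xi>] by (intro smooth_on_compose[OF smooth_exp]) auto
  have per: "\<xi> (z + l) = \<xi> z" if "l \<in> lattice" for z l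
    using smooth_periodicD(2)[OF \<xi>] that
      by (simp add: lattice_periodic_iff[symmetric] lattice_periodic_def)
  note o = bundleD(1)[OF L]
  have sm: "smooth_on (chart_dom L i) (?h i)" if "i \<in> charts L" for i
    by (rule smooth_on_mult[OF o[OF that] metricD(1)[OF h that] smooth_on_subset[OF sexp subset_UNIV]])
  show h': "hermitian_metric L ?h"
    unfolding hermitian_metric_def
  proof (intro conjI ballI)
    fix i assume i: "i \<in> charts L"
    show "smooth_on (chart_dom L i) (?h i)" by (rule sm[OF i])
    fix z assume z: "z \<in> chart_dom L i"
    show "0 < ?h i z" using metricD(2)[OF h i z] by simp
    show "?h i (z + l) = ?h i z" if "l \<in> lattice" for l
      using metricD(3)[OF h i z that] per[OF that] by simp
  next
    fix i j z assume "i \<in> charts L" "j \<in> charts L" "z \<in> chart_dom L i \<inter> chart_dom L j"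
    from metricD(4)[OF h this] show "?h j z = (cmod (transition L i j z))\<^sup>2 * ?h i z" by simp
  qed
  obtain i where i: "i \<in> charts L" "z \<in> chart_dom L i" by (rule bundle_chart[OF L])
  note hp = metricD(2)[OF h i(1)]
  have sl: "smooth_on (chart_dom L i) (\<lambda>y. ln (h i y))"
    by (rule smooth_on_ln_compose[OF metricD(1)[OF h i(1)] o[OF i(1)] hp])
  have "levi (\<lambda>y. ln (?h i y)) a b z = levi (\<lambda>y. ln (h i y) + \<xi> y) a b z"
  proof (rule levi_cong[OF o[OF i(1)] i(2)])
    fix y assume "y \<in> chart_dom L i"
    from hp[OF this] show "ln (?h i y) = ln (h i y) + \<xi> y" by (simp add: ln_mult)
  qed
  also have "\<dots> = levi (\<lambda>y. ln (h i y)) a b z + levi \<xi> a b z"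
    by (rule levi_add[OF sl smooth_on_subset[OF smooth_periodicD(1)[OF \<xi>]] o[OF i(1)] i(2)]) simp
  finally show "chern_curvature L ?h z a b = \<i> * of_real (curvature_form L h z a b + levi \<xi> a b z)"
    using chern_curvature_chart[OF L h' i] curvature_form_chart[OF i] by simp
qed

end

section \<open>Squares of curvature forms\<close>

lemma square_coeff_expand:
  "square_coeff \<beta> z = 2 * (\<beta> z e1 f1 * \<beta> z e2 f2 - \<beta> z e1 e2 * \<beta> z f1 f2 + \<beta> z e1 f2 * \<beta> z f1 e2)"
  by (simp add: square_coeff_def top_coeff_def wedge_def algebra_simps)

definition diag2 :: "real \<Rightarrow> real^2^2" where
  "diag2 t = (\<chi> i j. if i = j then (if i = 1 then t else 1) else 0)"

lemma diag2_nth [simp]: "diag2 t $ 1 $ 1 = t" "diag2 t $ 1 $ 2 = 0" "diag2 t $ 2 $ 1 = 0"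
    "diag2 t $ 2 $ 2 = 1"
  by (simp_all add: diag2_def)

definition diag_form :: "real \<Rightarrow> complex^2 \<Rightarrow> complex^2 \<Rightarrow> complex" where
  "diag_form t = form_of_matrix (\<chi> i j. of_real (diag2 t $ i $ j))"

lemma diag_form: "diag_form t a b = of_real (- 2 * t * Im (a $ 1 * cnj (b $ 1)) - 2 * Im
    (a $ 2 * cnj (b $ 2)))"
  unfolding diag_form_def form_of_matrix_def
  by (simp add: sum_2 complex_eq_iff algebra_simps)

lemma flat_form_diag: "flat_form z = diag_form 1"
proof -
  have "(mat 1 :: complex^2^2) = (\<chi> i j. of_real (diag2 1 $ i $ j))"
    by (simp add: vec_eq_iff mat_def forall_2)
  then show ?thesis by (simp add: flat_form_def diag_form_def)
qed

lemma diag_form_axes: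
  "diag_form t e1 f1 = of_real (2 * t)" "diag_form t e2 f2 = 2" "diag_form t e1 e2 = 0"
  "diag_form t f1 f2 = 0" "diag_form t e1 f2 = 0" "diag_form t f1 e2 = 0"
  by (simp_all add: diag_form axis_def)

lemma square_coeff_diag: "square_coeff (\<lambda>z. diag_form (V z)) z = of_real (8 * V z)"
  by (simp add: square_coeff_expand diag_form_axes)

text \<open>The symmetries under \<open>J\<close> reduce the six coefficients of \<open>\<Phi>\<close> to four; the result is \<open>8\<close> times
  a determinant of size two.\<close>

lemma square_coeff_diff:
  assumes F: "\<And>a b. F z a b = \<i> * of_real (\<Phi> a b)" and J: "\<And>a b. \<Phi> (J a) (J b) = \<Phi> a b"
      "\<And>a b. \<Phi> a (- b) = - \<Phi> a b"
  shows "square_coeff (form_diff (\<lambda>z. diag_form (V z)) F) z =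
     2 * ((of_real (2 * V z) - \<i> * of_real (\<Phi> e1 f1)) * (2 - \<i> * of_real (\<Phi> e2 f2)) + of_real
         ((\<Phi> e1 e2)\<^sup>2 + (\<Phi> e1 f2)\<^sup>2))"
proof -
  have "\<Phi> f1 f2 = \<Phi> e1 e2" using J(1)[of e1 e2] by (simp add: J_axis)
  moreover have "\<Phi> f1 e2 = - \<Phi> e1 f2" using J(1)[of e1 f2] J(2)[of f1 "e2"] by (simp add: J_axis)
  ultimately show ?thesis
    by (simp add: square_coeff_expand form_diff_def diag_form_axes F power2_eq_square algebra_simps)
qed

lemma levi_axes:
  assumes w: "smooth w"
  shows "levi w e1 f1 z = (dd e1 (dd e1 w) z + dd f1 (dd f1 w) z) / 2"
    "levi w e2 f2 z = (dd e2 (dd e2 w) z + dd f2 (dd f2 w) z) / 2"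
    "levi w e1 e2 z = (dd e2 (dd f1 w) z - dd e1 (dd f2 w) z) / 2"
    "levi w e1 f2 z = (dd f2 (dd f1 w) z + dd e1 (dd e2 w) z) / 2"
proof -
  show "levi w e1 f1 z = (dd e1 (dd e1 w) z + dd f1 (dd f1 w) z) / 2"
    using levi_diagonal[OF w, of z e1] by (simp add: J_axis)
  show "levi w e2 f2 z = (dd e2 (dd e2 w) z + dd f2 (dd f2 w) z) / 2"
    using levi_diagonal[OF w, of z e2] by (simp add: J_axis)
  show "levi w e1 e2 z = (dd e2 (dd f1 w) z - dd e1 (dd f2 w) z) / 2"
    by (simp add: levi_def J_axis)
  have "dd (- e2) w = (\<lambda>z. - dd e2 w z)" using dd_minus[OF w] by auto
  then have "dd e1 (dd (- e2) w) z = - dd e1 (dd e2 w) z"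
    using dd_uminus[OF smooth_on_dd[OF w], of z e1 e2] by simp
  then show "levi w e1 f2 z = (dd f2 (dd f1 w) z + dd e1 (dd e2 w) z) / 2"
    by (simp add: levi_def J_axis)
qed

lemma dd_dd_levi:
  assumes "smooth w" shows "dd u (dd v (levi w a b)) z = levi (dd u (dd v w)) a b z"
proof -
  have "dd v (levi w a b) = levi (dd v w) a b" using dd_levi[OF assms] by auto
  then show ?thesis using dd_levi[OF smooth_on_dd[OF assms], of z u v a b] by simp
qed

text \<open>The identity \<open>(a d - b c)\<^sup>2 + (a c + b d)\<^sup>2 = (a\<^sup>2 + b\<^sup>2) (c\<^sup>2 + d\<^sup>2)\<close> for the commuting
  operators \<open>dd e1\<close>, \<open>dd f1\<close>, \<open>dd e2\<close>, \<open>dd f2\<close>.\<close>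

lemma levi_lagrange_identity:
  assumes w: "smooth w"
  shows "levi (levi w e1 e2) e1 e2 z + levi (levi w e1 f2) e1 f2 z = levi (levi w e1 f1) e2 f2 z"
proof -
  have c: "dd a (dd b f) = dd b (dd a f)" if "smooth f"
      for a b :: "complex^2" and f :: "complex^2 \<Rightarrow> real"
    using dd_commute[OF that] by auto
  note s = smooth_on_dd[OF w] smooth_on_dd[OF smooth_on_dd[OF w]]
  let ?D = "\<lambda>a b c d. dd a (dd b (dd c (dd d w))) z"
  have p1: "?D a b c d = ?D b a c d" for a b c d using c[OF s(2)[of c d], of a b] by simp
  have p2: "?D a b c d = ?D a c b d" for a b c d using c[OF s(1)[of d], of b c] by simp
  have p3: "?D a b c d = ?D a b d c" for a b c d using c[OF w, of c d] by simp
  have q1: "?D a b a b = ?D a a b b" for a b by (rule p2)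
  have q2: "?D a b a b = ?D b b a a" for a b
    using p1[of a b a b] p3[of b a a b] p2[of b a b a] by simp
  have q3: "?D a b c d = ?D d b c a" for a b c d
    using p1[of a b c d] p2[of b a c d] p3[of b c a d] p2[of b c d a] p1[of b d c a] by simp
  have XX: "levi (levi w e1 e2) e1 e2 z
     = ((?D e2 f1 e2 f1 - ?D e1 f2 e2 f1) / 2 - (?D e2 f1 e1 f2 - ?D e1 f2 e1 f2) / 2) / 2"
    unfolding levi_axes(3)[OF smooth_on_levi[OF w open_UNIV]] dd_dd_levi[OF w] levi_axes(3)[OF s(2)] ..
  have YY: "levi (levi w e1 f2) e1 f2 z
     = ((?D f2 f1 f2 f1 + ?D e1 e2 f2 f1) / 2 + (?D f2 f1 e1 e2 + ?D e1 e2 e1 e2) / 2) / 2"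
    unfolding levi_axes(4)[OF smooth_on_levi[OF w open_UNIV]] dd_dd_levi[OF w] levi_axes(4)[OF s(2)] ..
  have DD: "levi (levi w e1 f1) e2 f2 z
     = ((?D e1 e1 e2 e2 + ?D f1 f1 e2 e2) / 2 + (?D e1 e1 f2 f2 + ?D f1 f1 f2 f2) / 2) / 2"
    unfolding levi_axes(2)[OF smooth_on_levi[OF w open_UNIV]] dd_dd_levi[OF w] levi_axes(1)[OF s(2)] ..
  show ?thesis
    unfolding XX YY DD q2[of e2 f1] p2[of e1 f2 e2 f1] q3[of e2 f1 e1 f2] q1[of e1 f2] q2[of f2 f1]
        q1[of e1 e2]
    by (simp add: field_simps)
qed

text \<open>Cohomological invariance. Linear terms in \<open>levi \<phi>\<close> integrate to zero, and so does the
  quadratic one: moving one factor over by self-adjointness leaves \<open>\<phi>\<close> times the expression that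
  \<open>levi_lagrange_identity\<close> shows to vanish.\<close>

lemma integral_curvature_square:
  assumes \<phi>: "smooth_periodic \<phi>" and C: "\<And>z a b. \<Phi> z a b + levi \<phi> a b z = C a b"
  shows "torus_integral (\<lambda>z. 2 * ((2 - \<i> * of_real (\<Phi> z e1 f1)) * (2 - \<i> * of_real (\<Phi> z e2 f2))
        + of_real ((\<Phi> z e1 e2)\<^sup>2 + (\<Phi> z e1 f2)\<^sup>2)))
    = 2 * ((2 - \<i> * of_real (C e1 f1)) * (2 - \<i> * of_real (C e2 f2)) + of_real ((C e1 e2)\<^sup>2 +
        (C e1 f2)\<^sup>2))"
proof -
  let ?I = "integral (cbox (0 :: complex^2) One)"
  let ?L = "\<lambda>a b. levi \<phi> a b"
  note sL = smooth_periodic_levi[OF \<phi>]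
  have int: "f integrable_on cbox 0 One" if "smooth_periodic f" for f :: "complex^2 \<Rightarrow> real"
    by (rule continuous_integrable_box[OF smooth_periodicD(3)[OF that]])
  have I0: "?I (?L a b) = 0" for a b by (rule integral_levi[OF \<phi>])
  define R where "R z = ?L e1 e2 z * ?L e1 e2 z + ?L e1 f2 z * ?L e1 f2 z - ?L e1 f1 z * ?L e2 f2 z"
      for z
  have sR: "smooth_periodic R" unfolding R_def by (intro smooth_periodic_intros sL)
  have IR: "?I R = 0"
  proof -
    have "?I R = ?I (\<lambda>z. ?L e1 e2 z * ?L e1 e2 z) + ?I (\<lambda>z. ?L e1 f2 z * ?L e1 f2 z) - ?I
        (\<lambda>z. ?L e1 f1 z * ?L e2 f2 z)"
      unfolding R_def
      by (subst integral_diff integral_add, (intro int smooth_periodic_intros sL)+)+ simp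
    also have "\<dots> = ?I (\<lambda>z. levi (?L e1 e2) e1 e2 z * \<phi> z) + ?I (\<lambda>z. levi (?L e1 f2) e1 f2 z * \<phi> z)
        - ?I (\<lambda>z. levi (?L e1 f1) e2 f2 z * \<phi> z)"
      by (simp only: integral_levi_self_adjoint[OF sL \<phi>])
    also have "\<dots> = ?I (\<lambda>z. levi (?L e1 e2) e1 e2 z * \<phi> z + levi (?L e1 f2) e1 f2 z * \<phi> z - levi
        (?L e1 f1) e2 f2 z * \<phi> z)"
      by (subst integral_diff integral_add, (intro int smooth_periodic_intros smooth_periodic_levi
          \<phi>)+)+ simp
    also have "\<dots> = ?I (\<lambda>z. 0)"
      using levi_lagrange_identity[OF smooth_periodicD(1)[OF \<phi>]]
      by (intro arg_cong[where f="?I"] ext) (metis distrib_right diff_self)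
    finally show ?thesis by simp
  qed
  have \<Phi>: "\<Phi> z a b = C a b - ?L a b z" for z a b using C[of z a b] by linarith
  define P where "P z = 8 + 2 * ((C e1 e2)\<^sup>2 + (C e1 f2)\<^sup>2 - C e1 f1 * C e2 f2)
      + ((- 4 * C e1 e2) * ?L e1 e2 z + ((- 4 * C e1 f2) * ?L e1 f2 z + (2 * C e1 f1 * ?L e2 f2 z +
          (2 * C e2 f2 * ?L e1 f1 z + 2 * R z))))" for z
  define Q where "Q z = (- 4 * (C e1 f1 + C e2 f2)) + (4 * ?L e1 f1 z + 4 * ?L e2 f2 z)" for z
  have sPQ: "smooth_periodic P" "smooth_periodic Q"
    unfolding P_def Q_def by (intro smooth_periodic_intros sL sR)+
  have "2 * ((2 - \<i> * of_real (\<Phi> z e1 f1)) * (2 - \<i> * of_real (\<Phi> z e2 f2))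
        + of_real ((\<Phi> z e1 e2)\<^sup>2 + (\<Phi> z e1 f2)\<^sup>2)) = of_real (P z) + \<i> * of_real (Q z)" for z
    unfolding \<Phi> P_def Q_def R_def by (simp add: complex_eq_iff power2_eq_square algebra_simps)
  then have "torus_integral (\<lambda>z. 2 * ((2 - \<i> * of_real (\<Phi> z e1 f1)) * (2 - \<i> * of_real (\<Phi> z e2 f2))
        + of_real ((\<Phi> z e1 e2)\<^sup>2 + (\<Phi> z e1 f2)\<^sup>2))) = ?I (\<lambda>z. of_real (P z) + \<i> * of_real (Q z))"
    by (simp add: torus_integral_box)
  also have "\<dots> = of_real (?I P) + \<i> * of_real (?I Q)"
  proof (rule integral_unique)
    have c: "((\<lambda>z. complex_of_real (f z)) has_integral of_real (?I f)) (cbox 0 One)"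
        if "smooth_periodic f" for f :: "complex^2 \<Rightarrow> real"
      using has_integral_linear[OF integrable_integral[OF int[OF that]] bounded_linear_of_real]
        by (simp add: o_def)
    show "((\<lambda>z. of_real (P z) + \<i> * of_real (Q z))
        has_integral of_real (?I P) + \<i> * of_real (?I Q)) (cbox 0 One)"
      by (intro has_integral_add has_integral_mult_right c sPQ)
  qed
  also have "?I P = 8 + 2 * ((C e1 e2)\<^sup>2 + (C e1 f2)\<^sup>2 - C e1 f1 * C e2 f2)"
    unfolding P_def
    by (subst integral_add, (intro int smooth_periodic_intros sL sR)+)+ (simp add: I0 IR)
  also have "?I Q = - 4 * (C e1 f1 + C e2 f2)"
    unfolding Q_def
    by (subst integral_add, (intro int smooth_periodic_intros sL sR)+)+ (simp add: I0)
  also have "complex_of_real (8 + 2 * ((C e1 e2)\<^sup>2 + (C e1 f2)\<^sup>2 - C e1 f1 * C e2 f2)) + \<i> * of_real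
      (- 4 * (C e1 f1 + C e2 f2))
     = 2 * ((2 - \<i> * of_real (C e1 f1)) * (2 - \<i> * of_real (C e2 f2)) + of_real ((C e1 e2)\<^sup>2 +
         (C e1 f2)\<^sup>2))"
    by (simp add: complex_eq_iff power2_eq_square algebra_simps)
  finally show ?thesis .
qed

section \<open>The phase condition\<close>

text \<open>Let \<open>w = (2 - \<i> C2) exp(-\<i>\<theta>)\<close>. The part linear in \<open>s\<close> is \<open>4 s (1 - \<i> \<tau>) w\<close>, which is real
  for \<open>\<tau> = Im w / Re w\<close>, with value \<open>4 s \<bar>w\<bar>\<^sup>2 / Re w\<close>. That \<open>Re w\<close> is positive, and large enough
  for \<open>8 c \<le> r\<close>, follows from \<open>r Re w = 4 (4 + C2\<^sup>2 + M)\<close>.\<close>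

lemma phase_algebra:
  fixes C1 C2 M r \<theta> :: real
  assumes M: "M \<ge> 0" and r: "r > 0"
    and D: "2 * ((2 - \<i> * of_real C1) * (2 - \<i> * of_real C2) + of_real M) = of_real r * cis \<theta>"
  obtains \<tau> c where "8 * c \<le> r"
    "\<And>s. cis (- \<theta>) * (2 * ((of_real (2 * (1 + s)) - \<i> * of_real (C1 + 2 * \<tau> * s)) * (2
        - \<i> * of_real C2) + of_real M))
        = of_real (r + 8 * c * s)"
proof -
  define w where "w = (2 - \<i> * of_real C2) * cis (- \<theta>)"
  define a where "a = Re w"
  define b where "b = Im w"
  have cc: "cis (- \<theta>) * cis \<theta> = 1" by (simp add: cis_mult)
  have "of_real r * w = (2 - \<i> * of_real C2) * cnj (of_real r * cis \<theta>)"
    by (simp add: w_def cis_cnj)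
  also have "\<dots> = (2 - \<i> * of_real C2) * cnj (2 * ((2 - \<i> * of_real C1) * (2 - \<i> * of_real C2)
      + of_real M))"
    by (simp only: D)
  finally have "Re (of_real r * w) = Re ((2 - \<i> * of_real C2) * cnj (2 * ((2 - \<i> * of_real C1) * (2
      - \<i> * of_real C2) + of_real M)))"
    by (rule arg_cong)
  then have ra: "r * a = 4 * (4 + C2\<^sup>2 + M)"
    by (simp add: a_def power2_eq_square algebra_simps)
  have "4 + C2\<^sup>2 + M > 0" using M by (simp add: add_pos_nonneg)
  then have a: "a > 0" using ra r by (metis mult_pos_pos zero_less_mult_pos zero_less_numeral)
  have ab: "a\<^sup>2 + b\<^sup>2 = 4 + C2\<^sup>2"
  proof -
    have "(cmod w)\<^sup>2 = (cmod (2 - \<i> * of_real C2))\<^sup>2" by (simp add: w_def norm_mult)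
    then show ?thesis unfolding cmod_power2 by (simp add: a_def b_def power2_eq_square)
  qed
  define \<tau> where "\<tau> = b / a"
  define c where "c = (4 + C2\<^sup>2) / (2 * a)"
  have "8 * c \<le> r"
  proof -
    have "8 * c = 4 * (4 + C2\<^sup>2) / a" using a by (simp add: c_def field_simps)
    also have "\<dots> \<le> r * a / a" unfolding ra using a M by (intro divide_right_mono) auto
    finally show ?thesis using a by simp
  qed
  moreover have "cis (- \<theta>) * (2 * ((of_real (2 * (1 + s)) - \<i> * of_real (C1 + 2 * \<tau> * s)) * (2
      - \<i> * of_real C2) + of_real M))
      = of_real (r + 8 * c * s)" for s
  proof -
    have "2 * ((of_real (2 * (1 + s)) - \<i> * of_real (C1 + 2 * \<tau> * s)) * (2 - \<i> * of_real C2) + of_real M)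
      = 2 * ((2 - \<i> * of_real C1) * (2 - \<i> * of_real C2) + of_real M) + of_real (4 * s) * ((1
          - \<i> * of_real \<tau>) * (2 - \<i> * of_real C2))"
      by (simp add: complex_eq_iff algebra_simps)
    then have "cis (- \<theta>) * (2 * ((of_real (2 * (1 + s)) - \<i> * of_real (C1 + 2 * \<tau> * s)) * (2
        - \<i> * of_real C2) + of_real M))
      = cis (- \<theta>) * (of_real r * cis \<theta> + of_real (4 * s) * ((1 - \<i> * of_real \<tau>) * (2 - \<i> * of_real C2)))"
      by (simp only: D)
    also have "\<dots> = of_real r * (cis (- \<theta>) * cis \<theta>) + of_real (4 * s) * ((1 - \<i> * of_real \<tau>) * w)"
      unfolding w_def by (simp only: distrib_left mult_ac)
    also have "(1 - \<i> * of_real \<tau>) * w = of_real (2 * c)"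
    proof -
      have "a + \<tau> * b = (a\<^sup>2 + b\<^sup>2) / a" "b - \<tau> * a = 0"
        using a by (simp_all add: \<tau>_def field_simps power2_eq_square)
      then have "a + \<tau> * b = 2 * c" "b - \<tau> * a = 0" unfolding ab using a
        by (simp_all add: c_def field_simps)
      then show ?thesis by (simp add: complex_eq_iff a_def[symmetric] b_def[symmetric])
    qed
    finally show ?thesis unfolding cc by simp
  qed
  ultimately show ?thesis using that by blast
qed

section \<open>Invariant Kaehler forms depending on one coordinate\<close>

lemma bounded_linear_Re_nth: "bounded_linear (\<lambda>z::complex^2. Re (z $ i))"
  by (rule bounded_linear_compose[OF bounded_linear_Re bounded_linear_vec_nth])

lemma smooth_Re1:
  assumes "smooth s" shows "smooth (\<lambda>z::complex^2. s (Re (z $ 1)))"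
  by (rule smooth_on_compose[OF assms]) (auto intro!: smooth_on_linear[OF bounded_linear_Re_nth])

lemma has_derivative_Re1:
  fixes s :: "real \<Rightarrow> real"
  assumes "(s has_real_derivative d) (at (Re (z $ 1)))"
  shows "((\<lambda>z::complex^2. s (Re (z $ 1))) has_derivative (\<lambda>v. d * Re (v $ 1))) (at z)"
  using has_derivative_compose[OF bounded_linear_imp_has_derivative[OF bounded_linear_Re_nth, of 1],
      of s "(*) d" z UNIV] assms
  by (simp add: has_field_derivative_def)

lemma dd_Re1:
  fixes s :: "real \<Rightarrow> real"
  assumes "smooth s"
  shows "dd v (\<lambda>z::complex^2. s (Re (z $ 1))) z = dd 1 s (Re (z $ 1)) * Re (v $ 1)"
  by (rule dd_eqI[OF has_derivative_Re1[OF smooth_real_derivative[OF assms]]])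

lemma periodic_Re1:
  assumes "periodic s" shows "periodic (\<lambda>z::complex^2. s (Re (z $ 1)))"
  unfolding lattice_periodic_iff[symmetric] lattice_periodic_def
proof (intro allI ballI)
  fix z l :: "complex^2" assume "l \<in> lattice"
  then have "Re (l $ 1) \<in> \<int>" by (simp add: lattice_def)
  then show "s (Re ((z + l) $ 1)) = s (Re (z $ 1))"
    using periodic_lattice[OF assms, of "Re (l $ 1)"] by simp
qed

lemma smooth_periodic_Re1: "smooth_periodic s \<Longrightarrow> smooth_periodic (\<lambda>z::complex^2. s (Re (z $ 1)))"
  by (simp add: smooth_periodic_def smooth_Re1 periodic_Re1)

lemma levi_Re1:
  assumes s: "smooth s"
  shows "levi (\<lambda>z. s (Re (z $ 1))) a b z
     = dd 1 (dd 1 s) (Re (z $ 1)) * (Re (a $ 1) * Im (b $ 1) - Im (a $ 1) * Re (b $ 1)) / 2"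
proof -
  have "dd u (dd v (\<lambda>z::complex^2. s (Re (z $ 1)))) z
      = dd 1 (dd 1 s) (Re (z $ 1)) * Re (u $ 1) * Re (v $ 1)" for u v
  proof -
    have "dd v (\<lambda>z::complex^2. s (Re (z $ 1))) = (\<lambda>z. Re (v $ 1) * dd 1 s (Re (z $ 1)))"
      using dd_Re1[OF s] by (auto simp: mult.commute)
    then show ?thesis
      using dd_cmult[OF smooth_Re1[OF smooth_on_dd[OF s]], of z u "Re
          (v $ 1)" 1] dd_Re1[OF smooth_on_dd[OF s], of u 1 z]
      by simp
  qed
  then show ?thesis by (simp add: levi_def algebra_simps)
qed

definition invariant_form :: "(real \<Rightarrow> real) \<Rightarrow> two_form" where
  "invariant_form V z = diag_form (V (Re (z $ 1)))"

lemma kaehler_invariant_form: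
  assumes V: "smooth_periodic V" "\<And>t. V t > 0"
  shows "kaehler_form (invariant_form V)"
proof -
  let ?V = "\<lambda>z::complex^2. V (Re (z $ 1))"
  have form: "invariant_form V z a b = of_real ((- 2 * Im (a $ 1 * cnj (b $ 1))) * ?V z - 2 * Im
      (a $ 2 * cnj (b $ 2)))" for z a b
    by (simp add: invariant_form_def diag_form algebra_simps)
  have sV: "smooth ?V" using smooth_Re1[OF smooth_periodicD(1)[OF V(1)]] .
  have sf: "smooth (\<lambda>z. (- 2 * Im (a $ 1 * cnj (b $ 1))) * ?V z - 2 * Im (a $ 2 * cnj (b $ 2)))"
      for a b :: "complex^2"
    by (intro smooth_on_diff smooth_on_mult sV smooth_on_const) auto
  have per: "lattice_periodic (invariant_form V)"
    using periodic_Re1[OF smooth_periodicD(2)[OF V(1)]]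
    by (simp add: lattice_periodic_iff[symmetric] lattice_periodic_def invariant_form_def)
  have d: "dd c (\<lambda>z. invariant_form V z a b) z
      = of_real (- 2 * dd 1 V (Re (z $ 1)) * Im (a $ 1 * cnj (b $ 1)) * Re (c $ 1))" for a b c z
  proof -
    have "dd c (\<lambda>z. (- 2 * Im (a $ 1 * cnj (b $ 1))) * ?V z - 2 * Im (a $ 2 * cnj (b $ 2))) z
        = (- 2 * Im (a $ 1 * cnj (b $ 1))) * (dd 1 V (Re (z $ 1)) * Re (c $ 1))"
      using dd_diff[of UNIV "\<lambda>z. (- 2 * Im (a $ 1 * cnj (b $ 1))) * ?V z"
          "\<lambda>z. 2 * Im (a $ 2 * cnj (b $ 2))" z c]
        dd_cmult[OF sV, of z c "- 2 * Im (a $ 1 * cnj (b $ 1))"] dd_Re1[OF smooth_periodicD(1)[OF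
            V(1)], of c z]
        smooth_on_mult[OF open_UNIV smooth_on_const sV]
      by simp
    then have "complex_of_real (dd c (\<lambda>z. (- 2 * Im (a $ 1 * cnj (b $ 1))) * ?V z - 2 * Im
        (a $ 2 * cnj (b $ 2))) z)
        = of_real (- 2 * dd 1 V (Re (z $ 1)) * Im (a $ 1 * cnj (b $ 1)) * Re (c $ 1))"
      by (simp only: mult_ac)
    then show ?thesis
      unfolding form using dd_bounded_linear[OF sf[of a b] open_UNIV UNIV_I bounded_linear_of_real,
          of c z]
      by (rule trans[rotated])
  qed
  show ?thesis
    unfolding kaehler_form_def
  proof (intro conjI allI impI)
    show "lattice_periodic (invariant_form V)" by (rule per)
    show "smooth (\<lambda>z. invariant_form V z a b)" for a b
      unfolding form by (rule smooth_on_linear[OF bounded_linear_of_real open_UNIV sf])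
    show "bilinear (invariant_form V z)" for z
      unfolding bilinear_def form by (auto intro!: linearI simp: complex_eq_iff algebra_simps)
    show "invariant_form V z a b = - invariant_form V z b a" for z a b
      unfolding form by (simp add: complex_eq_iff algebra_simps)
    show "invariant_form V z a b \<in> \<real>" for z a b unfolding form by simp
    show "invariant_form V z (J a) (J b) = invariant_form V z a b" for z a b
      unfolding form by (simp add: complex_eq_iff algebra_simps)
    show "0 < Re (invariant_form V z a (J a))" if "a \<noteq> 0" for z a
    proof -
      have "Re (invariant_form V z a (J a)) = 2 * ?V z * (cmod (a $ 1))\<^sup>2 + 2 * (cmod (a $ 2))\<^sup>2"
        unfolding form cmod_power2 by (simp add: power2_eq_square algebra_simps)
      moreover have "2 * ?V z * (cmod (a $ 1))\<^sup>2 + 2 * (cmod (a $ 2))\<^sup>2 > 0"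
      proof (cases "a $ 1 = 0")
        case True
        then have "a $ 2 \<noteq> 0" using that by (auto simp: vec_eq_iff forall_2)
        then show ?thesis using True by simp
      next
        case False
        then have "2 * ?V z * (cmod (a $ 1))\<^sup>2 > 0" using V(2)[of "Re (z $ 1)"] by simp
        then show ?thesis by (rule add_pos_nonneg) simp
      qed
      ultimately show ?thesis by simp
    qed
    show "ext_deriv2 (invariant_form V) z a b c = 0" for z a b c
      unfolding ext_deriv2_def dd_def[symmetric] d by (simp add: complex_eq_iff algebra_simps)
  qed
qed

lemma torus_invariant_form: "torus_invariant (invariant_form V)"
  by (simp add: torus_invariant_def invariant_form_def)

text \<open>The primitive is \<open>2 \<psi>'(Re z\<^sub>1) d(Im z\<^sub>1)\<close>.\<close>

lemma cohomologous_invariant_form: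
  assumes \<psi>: "smooth_periodic \<psi>" and V: "\<And>t. V t = 1 + dd 1 (dd 1 \<psi>) t"
  shows "cohomologous (invariant_form V) flat_form"
proof -
  let ?\<psi>' = "dd 1 \<psi>"
  let ?\<eta> = "\<lambda>(z::complex^2) (a::complex^2). complex_of_real ((2 * Im (a $ 1)) * ?\<psi>' (Re (z $ 1)))"
  note s = smooth_periodicD[OF smooth_periodic_dd[OF \<psi>, of 1]]
  have sr: "smooth (\<lambda>z::complex^2. (2 * Im (a $ 1)) * ?\<psi>' (Re (z $ 1)))" for a :: "complex^2"
    by (intro smooth_on_mult smooth_Re1 s(1) smooth_on_const) auto
  have d: "dd b (\<lambda>z. ?\<eta> z a) z = of_real (2 * Im (a $ 1) * (dd 1 ?\<psi>' (Re (z $ 1)) * Re (b $ 1)))"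
      for a b z
  proof -
    have "dd b (\<lambda>z. ?\<eta> z a) z = of_real (dd b (\<lambda>z. (2 * Im (a $ 1)) * ?\<psi>' (Re (z $ 1))) z)"
      by (rule dd_bounded_linear[OF sr open_UNIV UNIV_I bounded_linear_of_real])
    then show ?thesis
      using dd_cmult[OF smooth_Re1[OF s(1)], of z b "2 * Im (a $ 1)"] dd_Re1[OF s(1), of b z] by simp
  qed
  show ?thesis
    unfolding cohomologous_def
  proof (intro exI[of _ ?\<eta>] conjI allI)
    show "lattice_periodic ?\<eta>"
      using periodic_Re1[OF s(2)] by (simp add: lattice_periodic_iff[symmetric] lattice_periodic_def)
    show "smooth (\<lambda>z. ?\<eta> z a)" for a
      by (rule smooth_on_linear[OF bounded_linear_of_real open_UNIV sr])
    show "linear (?\<eta> z)" for z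
      by (auto intro!: linearI simp: complex_eq_iff algebra_simps)
    show "invariant_form V z a b - flat_form z a b = ext_deriv1 ?\<eta> z a b" for z a b
      unfolding ext_deriv1_dd d flat_form_diag invariant_form_def diag_form V
      by (simp add: complex_eq_iff algebra_simps)
  qed
qed

section \<open>Convex potentials that are quadratic in one variable\<close>

lemma partial_dd: "partial i f y = dd (axis i 1) f y"
  by (simp add: partial_def dd_def)

lemma partial_separated:
  fixes s r :: "real \<Rightarrow> real"
  assumes "\<And>t. (s has_real_derivative s' t) (at t)" "\<And>t. (r has_real_derivative r' t) (at t)"
  shows "partial 1 (\<lambda>y. s (y $ 1) + r (y $ 2)) = (\<lambda>y. s' (y $ 1))"
      "partial 2 (\<lambda>y. s (y $ 1) + r (y $ 2)) = (\<lambda>y. r' (y $ 2))"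
proof -
  have nth: "((\<lambda>y::real^2. y $ i) has_derivative (\<lambda>v. v $ i)) (at y)" for i y
    by (rule bounded_linear_imp_has_derivative[OF bounded_linear_vec_nth])
  have "((\<lambda>y::real^2. s (y $ 1) + r (y $ 2)) has_derivative (\<lambda>v. s' (y $ 1) * v $ 1 + r'
      (y $ 2) * v $ 2)) (at y)" for y
    using has_derivative_add[OF has_derivative_compose[OF nth assms(1)[unfolded
        has_field_derivative_def]]
      has_derivative_compose[OF nth assms(2)[unfolded has_field_derivative_def]]] .
  from dd_eqI[OF this] show "partial 1 (\<lambda>y. s (y $ 1) + r (y $ 2)) = (\<lambda>y. s' (y $ 1))"
    "partial 2 (\<lambda>y. s (y $ 1) + r (y $ 2)) = (\<lambda>y. r' (y $ 2))"
    by (auto simp: partial_dd axis_def)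
qed

lemma partial_fst:
  fixes s :: "real \<Rightarrow> real"
  assumes "\<And>t. (s has_real_derivative s' t) (at t)"
  shows "partial 1 (\<lambda>y. s (y $ 1)) = (\<lambda>y. s' (y $ 1))" "partial 2 (\<lambda>y. s (y $ 1)) = (\<lambda>y. 0)"
  using partial_separated[OF assms DERIV_const, of 0] by simp_all

lemma partial_snd:
  fixes r :: "real \<Rightarrow> real"
  assumes "\<And>t. (r has_real_derivative r' t) (at t)"
  shows "partial 1 (\<lambda>y. r (y $ 2)) = (\<lambda>y. 0)" "partial 2 (\<lambda>y. r (y $ 2)) = (\<lambda>y. r' (y $ 2))"
  using partial_separated[OF DERIV_const assms, of 0] by simp_all

definition potential :: "(real \<Rightarrow> real) \<Rightarrow> real^2 \<Rightarrow> real" where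
  "potential \<psi> y = (norm y)\<^sup>2 / 2 + \<psi> (y $ 1)"

lemma potential_separated: "potential \<psi> = (\<lambda>y. ((y $ 1)\<^sup>2 / 2 + \<psi> (y $ 1)) + (y $ 2)\<^sup>2 / 2)"
  unfolding potential_def[abs_def] power2_norm_eq_inner
  by (rule ext) (simp add: inner_vec_def sum_2 power2_eq_square add_divide_distrib)

text \<open>Here \<open>k\<close> is the derivative of \<open>y \<mapsto> y\<^sup>2/2 + \<psi> y\<close>, \<open>g\<close> its inverse, and \<open>p\<close> the second
  derivative expressed in the dual coordinate.\<close>

locale one_variable_potential =
  fixes \<psi> k g p :: "real \<Rightarrow> real"
  assumes \<psi>: "smooth_periodic \<psi>" and p: "smooth_periodic p" "\<And>x. p x > 0"
    and d\<psi>: "\<And>y. (\<psi> has_real_derivative (k y - y)) (at y)"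
    and dk: "\<And>y. (k has_real_derivative p (k y)) (at y)"
    and dg: "\<And>x. (g has_real_derivative 1 / p x) (at x)"
    and kg: "\<And>x. k (g x) = x" and gk: "\<And>y. g (k y) = y"
begin

abbreviation V :: "real \<Rightarrow> real" where "V t \<equiv> p (k t)"

lemma dd\<psi>: "dd 1 \<psi> = (\<lambda>t. k t - t)" "dd 1 (dd 1 \<psi>) t = V t - 1"
proof -
  show 1: "dd 1 \<psi> = (\<lambda>t. k t - t)" using dd_real_eqI[OF d\<psi>] by auto
  have "((\<lambda>t. k t - t) has_real_derivative V t - 1) (at t)" using dk
    by (auto intro!: derivative_eq_intros)
  from dd_real_eqI[OF this, of 1] show "dd 1 (dd 1 \<psi>) t = V t - 1" unfolding 1 by simp
qed

lemma V: "smooth_periodic V" "V t > 0"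
proof -
  have "smooth_periodic (\<lambda>t. 1 + dd 1 (dd 1 \<psi>) t)" by (intro smooth_periodic_intros \<psi>)
  then show "smooth_periodic V" by (simp add: dd\<psi>(2))
qed (rule p(2))

lemma grad_potential: "partial 1 (potential \<psi>) = (\<lambda>y. k (y $ 1))" "partial 2 (potential \<psi>) = (\<lambda>y. y $ 2)"
proof -
  have 1: "((\<lambda>t. t\<^sup>2 / 2 + \<psi> t) has_real_derivative k t) (at t)" for t
    using d\<psi>[of t] by (auto intro!: derivative_eq_intros)
  have 2: "((\<lambda>t. t\<^sup>2 / 2) has_real_derivative t) (at t)" for t :: real
    by (auto intro!: derivative_eq_intros)
  show "partial 1 (potential \<psi>) = (\<lambda>y. k (y $ 1))" "partial 2 (potential \<psi>) = (\<lambda>y. y $ 2)"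
    unfolding potential_separated using partial_separated[OF 1 2] by auto
qed

lemma hessian_potential: "hessian (potential \<psi>) y = diag2 (V (y $ 1))"
proof -
  have "((\<lambda>t. t) has_real_derivative 1) (at t)" for t :: real by simp
  from partial_snd[OF this] partial_fst[OF dk] show ?thesis
    by (simp add: vec_eq_iff forall_2 hessian_def grad_potential)
qed

lemma invariant_potential: "invariant_potential (invariant_form V) (potential \<psi>)"
  unfolding invariant_potential_def
proof (intro conjI)
  have "smooth (\<lambda>y::real^2. \<psi> (y $ 1))"
    by (rule smooth_on_compose[OF smooth_periodicD(1)[OF \<psi>]])
        (auto intro!: smooth_on_linear[OF bounded_linear_vec_nth])
  moreover have "\<psi> ((y + m) $ 1) = \<psi> (y $ 1)" if "\<forall>j. m $ j \<in> \<int>" for y m :: "real^2"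
    using periodic_lattice[OF smooth_periodicD(2)[OF \<psi>], of "m $ 1"] that by simp
  ultimately show "\<exists>\<psi>'. smooth \<psi>' \<and> (\<forall>y m. (\<forall>j. m $ j \<in> \<int>) \<longrightarrow> \<psi>' (y + m) = \<psi>' y) \<and>
      potential \<psi> = (\<lambda>y. (norm y)\<^sup>2 / 2 + \<psi>' y)"
    by (intro exI[of _ "\<lambda>y. \<psi> (y $ 1)"]) (auto simp: potential_def)
  show "\<forall>z. invariant_form V z = form_of_matrix (\<chi> i j. of_real (hessian (potential \<psi>)
      (re_part z) $ i $ j))"
    by (simp add: hessian_potential invariant_form_def diag_form_def re_part_def)
  have c1: "convex_on UNIV (\<lambda>t. t\<^sup>2 / 2 + \<psi> t)"
  proof (rule f''_ge0_imp_convex)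
    show "((\<lambda>t. t\<^sup>2 / 2 + \<psi> t) has_real_derivative k t) (at t)" for t
      using d\<psi>[of t] by (auto intro!: derivative_eq_intros)
  qed (use dk p(2) in \<open>auto simp: less_imp_le\<close>)
  have c2: "convex_on UNIV (\<lambda>t::real. t\<^sup>2 / 2)"
  proof (rule f''_ge0_imp_convex)
    show "((\<lambda>t. t\<^sup>2 / 2) has_real_derivative t) (at t)" for t :: real
      by (auto intro!: derivative_eq_intros)
    show "((\<lambda>t. t) has_real_derivative 1) (at t)" for t :: real by simp
  qed auto
  have lin: "convex_on UNIV (\<lambda>y::real^2. s (y $ i))" if "convex_on UNIV s" for s :: "real \<Rightarrow> real" and i
    using that unfolding convex_on_def by auto
  show "convex_on UNIV (potential \<psi>)"
    unfolding potential_separated using convex_on_add[OF lin[OF c1, of 1] lin[OF c2, of 2]] by simp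
qed

lemma matrix_inv_diag2:
  assumes "t > 0" shows "matrix_inv (diag2 t) = diag2 (1 / t)"
proof -
  have "diag2 t ** diag2 (1 / t) = mat 1" "diag2 (1 / t) ** diag2 t = mat 1"
    using assms by (simp_all add: vec_eq_iff forall_2 matrix_matrix_mult_def sum_2 mat_def)
  then have "diag2 t ** matrix_inv (diag2 t) = mat 1" "diag2 (1 / t) ** diag2 t = mat 1"
    using someI[of "\<lambda>B. diag2 t ** B = mat 1 \<and> B ** diag2 t = mat 1"] by (auto simp: matrix_inv_def)
  then show ?thesis by (metis matrix_mul_assoc matrix_mul_lid matrix_mul_rid)
qed

text \<open>The first derivative of \<open>ln (p \<circ> k)\<close> is \<open>p' \<circ> k\<close>, because \<open>k' = p \<circ> k\<close>; the same
  cancellation occurs once more when the second derivative is divided by \<open>p \<circ> k\<close>.\<close>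

lemma scalar_curv_potential: "scalar_curv (potential \<psi>) y = - dd 1 (dd 1 p) (k (y $ 1)) / 4"
proof -
  have det: "(\<lambda>y'. ln (det (hessian (potential \<psi>) y'))) = (\<lambda>y. ln (V (y $ 1)))"
    by (simp add: hessian_potential det_2)
  note dp = smooth_real_derivative[OF smooth_periodicD(1)[OF p(1)]]
    and ddp = smooth_real_derivative[OF smooth_periodicD(1)[OF smooth_periodic_dd[OF p(1), of 1]]]
  have "((\<lambda>t. ln (V t)) has_real_derivative dd 1 p (k t)) (at t)" for t
    using DERIV_chain2[OF DERIV_ln_divide[OF p(2)] DERIV_chain2[OF dp dk], of t] p(2)[of "k t"] by simp
  note d1 = partial_fst[OF this]
  have "((\<lambda>t. dd 1 p (k t)) has_real_derivative dd 1 (dd 1 p) (k t) * V t) (at t)" for t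
    by (rule DERIV_chain2[OF ddp dk])
  note d2 = partial_fst[OF this]
  have d0: "partial i (\<lambda>y. 0) = (\<lambda>y. 0)" for i by (auto simp: partial_dd)
  show ?thesis
    unfolding scalar_curv_def det
    unfolding hessian_potential matrix_inv_diag2[OF p(2)]
    using p(2)[of "k (y $ 1)"] by (simp add: sum_2 hessian_def d1 d2 d0)
qed

lemma legendre_potential:
  "legendre (potential \<psi>) = (\<lambda>x. (x $ 1 * g (x $ 1) - ((g (x $ 1))\<^sup>2 / 2 + \<psi> (g (x $ 1)))) +
      (x $ 2)\<^sup>2 / 2)"
proof
  fix x :: "real^2"
  define y :: "real^2" where "y = (\<chi> i. if i = 1 then g (x $ 1) else x $ 2)"
  have y: "y $ 1 = g (x $ 1)" "y $ 2 = x $ 2" by (simp_all add: y_def)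
  have "(THE y. grad (potential \<psi>) y = x) = y"
  proof (rule the_equality)
    show "grad (potential \<psi>) y = x" by (simp add: vec_eq_iff forall_2 grad_def grad_potential y kg)
    fix y' assume "grad (potential \<psi>) y' = x"
    then have "k (y' $ 1) = x $ 1" "y' $ 2 = x $ 2"
      by (auto simp: vec_eq_iff forall_2 grad_def grad_potential)
    then show "y' = y" using gk[of "y' $ 1"] by (simp add: vec_eq_iff forall_2 y)
  qed
  then show "legendre (potential \<psi>) x = (x $ 1 * g (x $ 1) - ((g (x $ 1))\<^sup>2 / 2 + \<psi> (g (x $ 1)))) +
      (x $ 2)\<^sup>2 / 2"
    by (simp add: legendre_def potential_separated inner_vec_def sum_2 y power2_eq_square)
qed

lemma grad_legendre: "grad (legendre (potential \<psi>)) x $ 1 = g (x $ 1)"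
proof -
  have 1: "((\<lambda>t. t * g t - ((g t)\<^sup>2 / 2 + \<psi> (g t))) has_real_derivative g t) (at t)" for t
  proof -
    have "((\<lambda>t. \<psi> (g t)) has_real_derivative (k (g t) - g t) * (1 / p t)) (at t)"
      by (rule DERIV_chain2[OF d\<psi> dg])
    then show ?thesis using dg[of t] unfolding kg
      by (auto intro!: derivative_eq_intros simp: algebra_simps diff_divide_distrib)
  qed
  have 2: "((\<lambda>t. t\<^sup>2 / 2) has_real_derivative t) (at t)" for t :: real
    by (auto intro!: derivative_eq_intros)
  show ?thesis unfolding legendre_potential grad_def using partial_separated(1)[OF 1 2] by simp
qed

end

section \<open>Solution of the coupled equations\<close>

text \<open>Integrating the equation over a period shows that the condition on the mean is necessary,
  since \<open>1 / p = g'\<close> has integral \<open>1\<close>. For \<open>d = 0\<close> the singular term is absent and another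
  existence argument is needed.\<close>

lemma prescribed_curvature_ode:
  fixes A :: "real \<Rightarrow> real"
  assumes A: "smooth_periodic A" and mean: "integral {0..1} A = - (c + d)" and d: "d \<ge> 0"
  obtains \<psi> k g p where "one_variable_potential \<psi> k g p"
    "\<And>x. - dd 1 (dd 1 p) x / 4 = A x + c + d / p x"
proof -
  \<comment> \<open>The equation is \<open>p'' = B - 4 d / p\<close>; the mean of \<open>B\<close> is \<open>4 d\<close>.\<close>
  define B where "B x = (- 4) * A x + (- 4 * c)" for x
  have B: "smooth_periodic B" unfolding B_def
    by (intro smooth_periodic_add smooth_periodic_cmult smooth_periodic_const A)
  have iA: "A integrable_on {0..1}" using smooth_periodicD(3)[OF A] by (rule integrable_continuous_real)
  have "integral {0..1} B = (- 4) * integral {0..1} A + integral {0..1} (\<lambda>x::real. - 4 * c)"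
    unfolding B_def integral_add[OF integrable_on_mult_right[OF iA] integrable_const_ivl]
        integral_mult_right ..
  then have mB: "integral {0..1} B = 4 * d" using mean by simp
  have "\<exists>p. smooth_periodic p \<and> (\<forall>x. p x > 0) \<and> (\<forall>x. dd 1 (dd 1 p) x
      = B x - 4 * d / p x) \<and> integral {0..1} (\<lambda>x. 1 / p x) = 1"
  proof (cases "d = 0")
    case True
    obtain p where "smooth_periodic p" "\<And>x. p x > 0" "\<And>x. dd 1 (dd 1 p) x = B x"
        "integral {0..1} (\<lambda>x. 1 / p x) = 1"
      by (rule degenerate_ode_periodic[OF B]) (use mB True that in auto)
    then show ?thesis using True by auto
  next
    case False
    then have "4 * d > 0" using d by simp
    from singular_ode_periodic[OF B this mB] show ?thesis by metis
  qed
  then obtain p where p: "smooth_periodic p" "\<And>x. p x > 0" "\<And>x. dd 1 (dd 1 p) x = B x - 4 * d / p x"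
    "integral {0..1} (\<lambda>x. 1 / p x) = 1" by blast
  obtain \<psi> k g where c: "smooth_periodic \<psi>" "\<And>y. (\<psi> has_real_derivative (k y - y)) (at y)"
    "\<And>y. (k has_real_derivative p (k y)) (at y)" "\<And>x. (g has_real_derivative 1 / p x) (at x)"
    "\<And>x. k (g x) = x" "\<And>y. g (k y) = y"
    by (rule legendre_change_of_variable[OF p(1,2,4)]) (rule that)
  have "one_variable_potential \<psi> k g p" using c p by unfold_locales
  moreover have "- dd 1 (dd 1 p) x / 4 = A x + c + d / p x" for x
    unfolding p(3) B_def by (simp add: field_simps)
  ultimately show ?thesis using that by blast
qed

theorem theorem15:
  fixes L :: "'i line_bundle" and h\<^sub>0 :: "'i \<Rightarrow> complex^2 \<Rightarrow> real"
    and \<theta> \<alpha> :: real and A :: "real \<Rightarrow> real"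
  assumes "holomorphic_line_bundle L"
    and "hermitian_metric L h\<^sub>0"
    and "\<exists>r>0. torus_integral (square_coeff (form_diff flat_form (chern_curvature L h\<^sub>0)))
                = of_real r * cis \<theta>"
    and "0 < \<alpha>"
    and "smooth_on UNIV A" and "\<And>x. A (x + 1) = A x"
    and "integral {0..1} A =
           - \<alpha> * (torus_integral (\<lambda>z. Re (cis (- \<theta>) *
                     square_coeff (form_diff flat_form (chern_curvature L h\<^sub>0)) z))
                  / torus_integral (\<lambda>z. Re (square_coeff flat_form z)))"
  shows "\<exists>\<omega> v h f.
           kaehler_form \<omega> \<and> torus_invariant \<omega> \<and> cohomologous \<omega> flat_form \<and>
           invariant_potential \<omega> v \<and>
           hermitian_metric L h \<and>
           (\<forall>z. Im (cis (- \<theta>) * square_coeff (form_diff \<omega> (chern_curvature L h)) z) = 0) \<and>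
           (\<forall>z. scalar_curv v (re_part z)
                - \<alpha> * (Re (cis (- \<theta>) * square_coeff (form_diff \<omega> (chern_curvature L h)) z)
                       / Re (square_coeff \<omega> z))
                = f (re_part z $ 1)) \<and>
           (\<forall>x. f (grad (legendre v) x $ 1) = A (x $ 1))"
proof -
  note L = assms(1) and h0 = assms(2) and \<alpha> = assms(4)
  let ?\<Phi> = "curvature_form L h\<^sub>0"
  let ?sq0 = "square_coeff (form_diff flat_form (chern_curvature L h\<^sub>0))"
  have A: "smooth_periodic A" using assms(5,6) by (simp add: smooth_periodic_def periodic_def)
  obtain r where r: "r > 0" "torus_integral ?sq0 = of_real r * cis \<theta>" using assms(3) by blast
  obtain \<phi> C where \<phi>: "smooth_periodic \<phi>" and C: "\<And>z a b. ?\<Phi> z a b + levi \<phi> a b z = C a b"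
    by (rule ddbar_lemma[of ?\<Phi>, OF smooth_periodic_curvature_form[OF L h0] curvature_form_commute[OF
        L h0]]) (rule that)
  define M where "M = (C e1 e2)\<^sup>2 + (C e1 f2)\<^sup>2"
  define C1 where "C1 = C e1 f1"
  define C2 where "C2 = C e2 f2"
  have flat: "flat_form = (\<lambda>z. diag_form ((\<lambda>z. 1) z))" using flat_form_diag by auto
  have sq0: "?sq0 = (\<lambda>z. 2 * ((2 - \<i> * of_real (?\<Phi> z e1 f1)) * (2 - \<i> * of_real (?\<Phi> z e2 f2))
        + of_real ((?\<Phi> z e1 e2)\<^sup>2 + (?\<Phi> z e1 f2)\<^sup>2)))"
    unfolding flat
  proof
    fix z
    from square_coeff_diff[where F="chern_curvature L h\<^sub>0" and \<Phi>="?\<Phi> z" and z=z and V="\<lambda>z. 1",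
        OF chern_curvature_imaginary[OF L h0] curvature_form_symmetries[OF L h0]]
    show "square_coeff (form_diff (\<lambda>z. diag_form 1) (chern_curvature L h\<^sub>0)) z
      = 2 * ((2 - \<i> * of_real (?\<Phi> z e1 f1)) * (2 - \<i> * of_real (?\<Phi> z e2 f2))
        + of_real ((?\<Phi> z e1 e2)\<^sup>2 + (?\<Phi> z e1 f2)\<^sup>2))" by simp
  qed
  have D: "2 * ((2 - \<i> * of_real C1) * (2 - \<i> * of_real C2) + of_real M) = of_real r * cis \<theta>"
    using integral_curvature_square[OF \<phi> C] r(2) unfolding sq0 C1_def C2_def M_def by simp
  obtain \<tau> c where c: "8 * c \<le> r"
    and phase: "\<And>s. cis (- \<theta>) * (2 * ((of_real (2 * (1 + s)) - \<i> * of_real (C1 + 2 * \<tau> * s)) * (2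
        - \<i> * of_real C2) + of_real M))
        = of_real (r + 8 * c * s)"
    by (rule phase_algebra[OF _ r(1) D]) (auto simp: M_def intro: that)
  have meanA: "integral {0..1} A = - (\<alpha> * c + \<alpha> * (r / 8 - c))"
  proof -
    have "torus_integral (\<lambda>z. Re (square_coeff flat_form z)) = 8"
      unfolding flat square_coeff_diag by (simp add: torus_integral_box)
    moreover have "torus_integral (\<lambda>z. Re (cis (- \<theta>) * ?sq0 z)) = Re (cis (- \<theta>) * torus_integral ?sq0)"
    proof -
      have "continuous_on UNIV ?sq0"
        unfolding sq0 by (intro continuous_intros smooth_periodicD(3)[OF
            smooth_periodic_curvature_form[OF L h0]])
      then have "?sq0 integrable_on cbox 0 One" by (rule continuous_integrable_box)
      from has_integral_linear[OF has_integral_mult_right[OF integrable_integral[OF this]]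
          bounded_linear_Re]
      show ?thesis unfolding torus_integral_box o_def by (rule integral_unique)
    qed
    moreover have "Re (cis (- \<theta>) * (of_real r * cis \<theta>)) = r"
    proof -
      have "cis (- \<theta>) * (of_real r * cis \<theta>) = of_real r * (cis (- \<theta>) * cis \<theta>)" by simp
      also have "\<dots> = of_real r" by (simp add: cis_mult)
      finally show ?thesis by (simp only: Re_complex_of_real)
    qed
    ultimately show ?thesis using assms(7) r(2) by (simp add: field_simps)
  qed
  obtain \<psi> k g p where loc: "one_variable_potential \<psi> k g p"
    and ode: "\<And>x. - dd 1 (dd 1 p) x / 4 = A x + \<alpha> * c + \<alpha> * (r / 8 - c) / p x"
    by (rule prescribed_curvature_ode[OF A meanA]) (use \<alpha> c that in auto)
  interpret one_variable_potential \<psi> k g p by (rule loc)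
  \<comment> \<open>\<open>\<phi>\<close> makes the curvature constant; the second term produces the correction \<open>2 \<tau> \<psi>''\<close>.\<close>
  define \<xi> where "\<xi> z = \<phi> z + (4 * \<tau>) * \<psi> (Re (z $ 1))" for z :: "complex^2"
  have s\<psi>: "smooth_periodic (\<lambda>z::complex^2. \<psi> (Re (z $ 1)))" by (rule smooth_periodic_Re1[OF \<psi>])
  have s\<xi>: "smooth_periodic \<xi>" unfolding \<xi>_def by (intro smooth_periodic_add smooth_periodic_cmult \<phi> s\<psi>)
  define h where "h i z = h\<^sub>0 i z * exp (\<xi> z)" for i z
  define \<omega> where "\<omega> = invariant_form V"
  note new = conformal_change[OF L h0 s\<xi>, folded h_def]
  have hm: "hermitian_metric L h" using new(1) unfolding h_def[abs_def] .
  have curv: "curvature_form L h z a b = C a b + 2 * \<tau> * (V (Re (z $ 1)) - 1) * (Re (a $ 1) * Im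
      (b $ 1) - Im (a $ 1) * Re (b $ 1))" for z a b
  proof -
    have "curvature_form L h z a b = ?\<Phi> z a b + levi \<xi> a b z"
      using new(2)[of z a b] unfolding h_def[abs_def] by (simp add: curvature_form_def)
    also have "levi \<xi> a b z = levi \<phi> a b z + 4 * \<tau> * levi (\<lambda>z. \<psi> (Re (z $ 1))) a b z"
      unfolding \<xi>_def[abs_def] using smooth_periodicD(1)[OF s\<psi>] smooth_periodicD(1)[OF \<phi>]
      by (subst levi_add[where S=UNIV]) (auto simp: levi_cmult[where S=UNIV] smooth_on_mult)
    finally show ?thesis using C[of z a b] by (simp add: levi_Re1[OF smooth_periodicD(1)[OF \<psi>]] dd\<psi>(2))
  qed
  have sq: "cis (- \<theta>) * square_coeff (form_diff \<omega> (chern_curvature L h)) z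
      = of_real (r + 8 * c * (V (Re (z $ 1)) - 1))" for z
  proof -
    have \<omega>': "\<omega> = (\<lambda>z. diag_form ((\<lambda>z. V (Re (z $ 1))) z))" by (auto simp: \<omega>_def invariant_form_def)
    have ax: "curvature_form L h z e1 f1 = C1 + 2 * \<tau> * (V (Re (z $ 1)) - 1)"
        "curvature_form L h z e2 f2 = C2"
      "curvature_form L h z e1 e2 = C e1 e2" "curvature_form L h z e1 f2 = C e1 f2"
      by (simp_all add: curv C1_def C2_def axis_def)
    from square_coeff_diff[where F="chern_curvature L h" and \<Phi>="curvature_form L h z" and z=z and
        V="\<lambda>z. V (Re (z $ 1))",
        OF chern_curvature_imaginary[OF L hm] curvature_form_symmetries[OF L hm]]
    show ?thesis unfolding \<omega>' ax M_def[symmetric] phase[symmetric] by simp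
  qed
  have sq\<omega>: "square_coeff \<omega> z = of_real (8 * V (Re (z $ 1)))" for z
    using square_coeff_diag[of "\<lambda>z. V (Re (z $ 1))" z] by (simp add: \<omega>_def invariant_form_def[abs_def])
  have scal: "scalar_curv (potential \<psi>) (re_part z) - \<alpha> * (Re (cis (- \<theta>) * square_coeff (form_diff \<omega>
      (chern_curvature L h)) z)
      / Re (square_coeff \<omega> z)) = A (k (re_part z $ 1))" for z
  proof -
    have "scalar_curv (potential \<psi>) (re_part z)
        = A (k (Re (z $ 1))) + \<alpha> * c + \<alpha> * (r / 8 - c) / V (Re (z $ 1))"
      unfolding scalar_curv_potential using ode[of "k (Re (z $ 1))"] by (simp add: re_part_def)
    then show ?thesis unfolding sq sq\<omega> using p(2)[of "k (Re (z $ 1))"]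
      by (simp add: re_part_def field_simps)
  qed
  show ?thesis
  proof (intro exI conjI allI)
    show "kaehler_form \<omega>" unfolding \<omega>_def by (rule kaehler_invariant_form[OF V])
    show "torus_invariant \<omega>" unfolding \<omega>_def by (rule torus_invariant_form)
    show "cohomologous \<omega> flat_form" unfolding \<omega>_def
      by (rule cohomologous_invariant_form[OF \<psi>]) (simp add: dd\<psi>(2))
    show "invariant_potential \<omega> (potential \<psi>)" unfolding \<omega>_def by (rule invariant_potential)
    show "hermitian_metric L h" by (rule hm)
    show "Im (cis (- \<theta>) * square_coeff (form_diff \<omega> (chern_curvature L h)) z) = 0" for z
      by (simp add: sq)
    show "scalar_curv (potential \<psi>) (re_part z) - \<alpha> * (Re (cis (- \<theta>) * square_coeff (form_diff \<omega>
        (chern_curvature L h)) z)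
      / Re (square_coeff \<omega> z)) = (\<lambda>t. A (k t)) (re_part z $ 1)" for z by (rule scal)
    show "(\<lambda>t. A (k t)) (grad (legendre (potential \<psi>)) x $ 1) = A (x $ 1)" for x
      by (simp add: grad_legendre kg)
  qed
qed

end
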